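(* Let $A$ be a locally Frobenius $k$-algebra of shape $\Lambda$. (a) For each $\lambda\in\Lambda$, $A$ is injective, projective and flat as a left or right $A(\lambda)$-module. (b) The $k$-algebra $A$ is coherent. (c) Suppose that $M$ is a coherent $A$-module. Then for some $\lambda\in\Lambda$ there is an $A(\lambda)$-module $M'$ with a finite presentation (exact sequence of $A(\lambda)$-modules) $$0\longleftarrow M'\longleftarrow A(\lambda)^m\longleftarrow A(\lambda)^n$$ inducing a finite presentation $$0\longleftarrow A\otimes_{A(\lambda)}M'\longleftarrow A^m\longleftarrow A^n,$$ where $A\otimes_{A(\lambda)}M'\cong M$. (d) Let $\varphi\colon M\to N$ be a homomorphism of coherent $A$-modules. Then there are a $\lambda\in\Lambda$ and a homomorphism of finitely generated $A(\lambda)$-modules $\varphi''\colon M''\to N''$ together with $A$-module isomorphisms $A\otimes_{A(\lambda)}M''\cong M$ and $A\otimes_{A(\lambda)}N''\cong N$ under which $\mathrm{Id}\otimes\varphi''\colon A\otimes_{A(\lambda)}M''\to A\otimes_{A(\lambda)}N''$ corresponds to $\varphi$ (i.e. the evident square commutes).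
   Context: $k$ is a field; all rings, algebras, modules and homomorphisms are unital. In (c) and (d) modules are left modules. Frobenius notions: a finite dimensional $k$-algebra $R$ is Frobenius if there is a linear form $\theta\colon R\to k$ (a Frobenius form) such that the bilinear form $(x,y)\mapsto\theta(xy)$ is nondegenerate; it is symmetric if $\theta$ can be chosen so that this bilinear form is symmetric. For a homomorphism of $k$-algebras $B\to C$, the extension $C:B$ is a Frobenius extension if there are a $B$-bimodule homomorphism $\Phi\colon C\to B$ and elements $x_i,y_i\in C$ ($1\le i\le n$) with $\sum_i y_i\Phi(x_ic)=c=\sum_i\Phi(cy_i)x_i$ for all $c\in C$; it is a free Frobenius extension if moreover $C$ is free as a left and as a right $B$-module. Shape: $(\Lambda,\preccurlyeq,\lambda_0)$ is an infinite partially ordered set such that any two elements have a common upper bound, $\lambda_0$ is a unique initial element, and for every $\lambda\in\Lambda$ there is $\lambda'\in\Lambda$ with $\lambda\preccurlyeq\lambda'$, $\lambda\ne\lambda'$. A (necessarily infinite dimensional) $k$-algebra $A$ is locally Frobenius of shape $\Lambda$ if: (a) there is a $\Lambda$-directed system of symmetric Frobenius $k$-algebras $A(\lambda)$ ($\lambda\in\Lambda$), augmented over $k$, with proper inclusion homomorphisms (of augmented algebras) $A(\lambda')\hookrightarrow A(\lambda'')$ for $\lambda'\preccurlyeq\lambda''$, $\lambda'\neq\lambda''$, with $A(\lambda_0)=k$ and $A=\bigcup_{\lambda\in\Lambda}A(\lambda)$; (b) each inclusion makes $A(\lambda''):A(\lambda')$ a free Frobenius extension. A module is pseudo-coherent if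 every finitely generated submodule is finitely presented, and coherent if it is finitely generated and pseudo-coherent. A ring is coherent if it is coherent both as a left and as a right module over itself. *)

theory Defs
  imports "HOL-Algebra.Module" "HOL-Algebra.Subrings" "HOL-Algebra.Free_Abelian_Groups"
begin

section \<open>Modules over noncommutative rings\<close>

text \<open>
  The library's locale \<^locale>\<open>module\<close> requires a commutative ring of scalars, so modules over an
  arbitrary ring are introduced here on top of the library record of modules; the fields
  \<^const>\<open>monoid.mult\<close> and \<^const>\<open>one\<close> of that record play no role for modules.  A right
  \<open>R\<close>-module is a left module over \<open>opp R\<close>, the scalar multiplication \<open>r \<odot> x\<close> standing for
  \<open>x r\<close>.
\<close>

locale left_module = R?: ring R + M?: abelian_group M
    for R :: "('r, 's) ring_scheme" (structure) and M :: "('r, 'm, 't) module_scheme" (structure) +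
  assumes smult_closed:
      "\<lbrakk>a \<in> carrier R; x \<in> carrier M\<rbrakk> \<Longrightarrow> a \<odot>\<^bsub>M\<^esub> x \<in> carrier M"
    and smult_l_distr:
      "\<lbrakk>a \<in> carrier R; b \<in> carrier R; x \<in> carrier M\<rbrakk>
        \<Longrightarrow> (a \<oplus> b) \<odot>\<^bsub>M\<^esub> x = a \<odot>\<^bsub>M\<^esub> x \<oplus>\<^bsub>M\<^esub> b \<odot>\<^bsub>M\<^esub> x"
    and smult_r_distr:
      "\<lbrakk>a \<in> carrier R; x \<in> carrier M; y \<in> carrier M\<rbrakk>
        \<Longrightarrow> a \<odot>\<^bsub>M\<^esub> (x \<oplus>\<^bsub>M\<^esub> y) = a \<odot>\<^bsub>M\<^esub> x \<oplus>\<^bsub>M\<^esub> a \<odot>\<^bsub>M\<^esub> y"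
    and smult_assoc:
      "\<lbrakk>a \<in> carrier R; b \<in> carrier R; x \<in> carrier M\<rbrakk>
        \<Longrightarrow> (a \<otimes> b) \<odot>\<^bsub>M\<^esub> x = a \<odot>\<^bsub>M\<^esub> (b \<odot>\<^bsub>M\<^esub> x)"
    and smult_one:
      "x \<in> carrier M \<Longrightarrow> \<one> \<odot>\<^bsub>M\<^esub> x = x"

definition opp :: "('r, 's) ring_scheme \<Rightarrow> ('r, 's) ring_scheme" where
  "opp R = R\<lparr>monoid.mult := \<lambda>x y. y \<otimes>\<^bsub>R\<^esub> x\<rparr>"

abbreviation right_module :: "('r, 's) ring_scheme \<Rightarrow> ('r, 'm, 't) module_scheme \<Rightarrow> bool" where
  "right_module R M \<equiv> left_module (opp R) M"

definition mod_hom ::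
    "('r, 's) ring_scheme \<Rightarrow> ('r, 'm, 't) module_scheme \<Rightarrow> ('r, 'n, 'u) module_scheme
      \<Rightarrow> ('m \<Rightarrow> 'n) set" where
  "mod_hom R M N = {f \<in> carrier M \<rightarrow> carrier N.
     (\<forall>x\<in>carrier M. \<forall>y\<in>carrier M. f (x \<oplus>\<^bsub>M\<^esub> y) = f x \<oplus>\<^bsub>N\<^esub> f y) \<and>
     (\<forall>r\<in>carrier R. \<forall>x\<in>carrier M. f (r \<odot>\<^bsub>M\<^esub> x) = r \<odot>\<^bsub>N\<^esub> f x)}"

definition mod_iso ::
    "('r, 's) ring_scheme \<Rightarrow> ('r, 'm, 't) module_scheme \<Rightarrow> ('r, 'n, 'u) module_scheme
      \<Rightarrow> ('m \<Rightarrow> 'n) set" where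
  "mod_iso R M N = {f \<in> mod_hom R M N. bij_betw f (carrier M) (carrier N)}"

text \<open>
  For a ring homomorphism \<open>h : B \<rightarrow> C\<close>, the ring \<open>C\<close> as a left and as a right \<open>B\<close>-module.
  With \<open>h\<close> the identity function and \<open>B\<close> a subring of \<open>C\<close> (or \<open>B = C\<close>) this is the module
  structure given by inclusion.
\<close>

definition lmod :: "('b \<Rightarrow> 'c) \<Rightarrow> ('c, 's) ring_scheme \<Rightarrow> ('b, 'c) module" where
  "lmod h C = \<lparr>carrier = carrier C, monoid.mult = monoid.mult C, monoid.one = monoid.one C,
     ring.zero = ring.zero C, add = ring.add C, smult = \<lambda>b c. h b \<otimes>\<^bsub>C\<^esub> c\<rparr>"

definition rmod :: "('b \<Rightarrow> 'c) \<Rightarrow> ('c, 's) ring_scheme \<Rightarrow> ('b, 'c) module" where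
  "rmod h C = \<lparr>carrier = carrier C, monoid.mult = monoid.mult C, monoid.one = monoid.one C,
     ring.zero = ring.zero C, add = ring.add C, smult = \<lambda>b c. c \<otimes>\<^bsub>C\<^esub> h b\<rparr>"

section \<open>Finiteness conditions\<close>

definition fin_gen :: "('r, 's) ring_scheme \<Rightarrow> ('r, 'm, 't) module_scheme \<Rightarrow> bool" where
  "fin_gen R M \<longleftrightarrow> (\<exists>X. finite X \<and> X \<subseteq> carrier M \<and>
     (\<forall>m\<in>carrier M. \<exists>c\<in>X \<rightarrow> carrier R. m = (\<Oplus>\<^bsub>M\<^esub>x\<in>X. c x \<odot>\<^bsub>M\<^esub> x)))"

definition is_basis ::
    "('r, 's) ring_scheme \<Rightarrow> ('r, 'm, 't) module_scheme \<Rightarrow> 'm set \<Rightarrow> bool" where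
  "is_basis R M X \<longleftrightarrow> X \<subseteq> carrier M \<and>
     (\<forall>m\<in>carrier M. \<exists>F c. finite F \<and> F \<subseteq> X \<and> c \<in> F \<rightarrow> carrier R \<and>
        m = (\<Oplus>\<^bsub>M\<^esub>x\<in>F. c x \<odot>\<^bsub>M\<^esub> x)) \<and>
     (\<forall>F c. finite F \<and> F \<subseteq> X \<and> c \<in> F \<rightarrow> carrier R \<and>
        (\<Oplus>\<^bsub>M\<^esub>x\<in>F. c x \<odot>\<^bsub>M\<^esub> x) = \<zero>\<^bsub>M\<^esub> \<longrightarrow> (\<forall>x\<in>F. c x = \<zero>\<^bsub>R\<^esub>))"

definition free_module :: "('r, 's) ring_scheme \<Rightarrow> ('r, 'm, 't) module_scheme \<Rightarrow> bool" where
  "free_module R M \<longleftrightarrow> left_module R M \<and> (\<exists>X. is_basis R M X)"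

text \<open>The module \<open>R\<^sup>n\<close>, realised by extensional functions on \<open>{..<n}\<close>, and its standard basis.\<close>

definition std_free :: "('r, 's) ring_scheme \<Rightarrow> nat \<Rightarrow> ('r, nat \<Rightarrow> 'r) module" where
  "std_free R n = \<lparr>carrier = {..<n} \<rightarrow>\<^sub>E carrier R,
     monoid.mult = \<lambda>x y. \<lambda>i\<in>{..<n}. x i \<otimes>\<^bsub>R\<^esub> y i, monoid.one = \<lambda>i\<in>{..<n}. \<one>\<^bsub>R\<^esub>,
     ring.zero = \<lambda>i\<in>{..<n}. \<zero>\<^bsub>R\<^esub>, add = \<lambda>x y. \<lambda>i\<in>{..<n}. x i \<oplus>\<^bsub>R\<^esub> y i,
     smult = \<lambda>r x. \<lambda>i\<in>{..<n}. r \<otimes>\<^bsub>R\<^esub> x i\<rparr>"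

definition std_vec :: "('r, 's) ring_scheme \<Rightarrow> nat \<Rightarrow> nat \<Rightarrow> nat \<Rightarrow> 'r" where
  "std_vec R n i = (\<lambda>j\<in>{..<n}. if j = i then \<one>\<^bsub>R\<^esub> else \<zero>\<^bsub>R\<^esub>)"

text \<open>Exactness of \<open>0 \<leftarrow> M \<leftarrow> R\<^sup>m \<leftarrow> R\<^sup>n\<close> with the maps \<open>g : R\<^sup>m \<rightarrow> M\<close> and \<open>f : R\<^sup>n \<rightarrow> R\<^sup>m\<close>.\<close>

definition fin_presentation ::
    "('r, 's) ring_scheme \<Rightarrow> ('r, 'm, 't) module_scheme \<Rightarrow> nat \<Rightarrow> nat
      \<Rightarrow> ((nat \<Rightarrow> 'r) \<Rightarrow> 'm) \<Rightarrow> ((nat \<Rightarrow> 'r) \<Rightarrow> nat \<Rightarrow> 'r) \<Rightarrow> bool" where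
  "fin_presentation R M m n g f \<longleftrightarrow>
     g \<in> mod_hom R (std_free R m) M \<and> f \<in> mod_hom R (std_free R n) (std_free R m) \<and>
     g ` carrier (std_free R m) = carrier M \<and>
     f ` carrier (std_free R n) = {x \<in> carrier (std_free R m). g x = \<zero>\<^bsub>M\<^esub>}"

definition fin_presented :: "('r, 's) ring_scheme \<Rightarrow> ('r, 'm, 't) module_scheme \<Rightarrow> bool" where
  "fin_presented R M \<longleftrightarrow> (\<exists>m n g f. fin_presentation R M m n g f)"

definition pseudo_coherent :: "('r, 's) ring_scheme \<Rightarrow> ('r, 'm, 't) module_scheme \<Rightarrow> bool" where
  "pseudo_coherent R M \<longleftrightarrow> left_module R M \<and>
     (\<forall>N. submodule N R M \<and> fin_gen R (M\<lparr>carrier := N\<rparr>)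
        \<longrightarrow> fin_presented R (M\<lparr>carrier := N\<rparr>))"

definition coherent_module :: "('r, 's) ring_scheme \<Rightarrow> ('r, 'm, 't) module_scheme \<Rightarrow> bool" where
  "coherent_module R M \<longleftrightarrow> fin_gen R M \<and> pseudo_coherent R M"

definition coherent_ring :: "('r, 's) ring_scheme \<Rightarrow> bool" where
  "coherent_ring R \<longleftrightarrow>
     coherent_module R (lmod (\<lambda>x. x) R) \<and> coherent_module (opp R) (rmod (\<lambda>x. x) R)"

section \<open>Tensor products\<close>

text \<open>
  For a right \<open>R\<close>-module \<open>X\<close> and a left \<open>R\<close>-module \<open>Y\<close>, the abelian group \<open>X \<otimes>\<^sub>R Y\<close> is the quotient
  of the free abelian group on \<open>X \<times> Y\<close> by the subgroup generated by the usual relations.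
\<close>

abbreviation tensor_free ::
    "('r, 'x, 't) module_scheme \<Rightarrow> ('r, 'y, 'u) module_scheme \<Rightarrow> ('x \<times> 'y \<Rightarrow>\<^sub>0 int) monoid" where
  "tensor_free X Y \<equiv> free_Abelian_group (carrier X \<times> carrier Y)"

definition tensor_rel ::
    "('r, 's) ring_scheme \<Rightarrow> ('r, 'x, 't) module_scheme \<Rightarrow> ('r, 'y, 'u) module_scheme
      \<Rightarrow> ('x \<times> 'y \<Rightarrow>\<^sub>0 int) set" where
  "tensor_rel R X Y = generate (tensor_free X Y)
     ({frag_of (x \<oplus>\<^bsub>X\<^esub> x', y) - frag_of (x, y) - frag_of (x', y) |x x' y.
         x \<in> carrier X \<and> x' \<in> carrier X \<and> y \<in> carrier Y} \<union>
      {frag_of (x, y \<oplus>\<^bsub>Y\<^esub> y') - frag_of (x, y) - frag_of (x, y') |x y y'.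
         x \<in> carrier X \<and> y \<in> carrier Y \<and> y' \<in> carrier Y} \<union>
      {frag_of (r \<odot>\<^bsub>X\<^esub> x, y) - frag_of (x, r \<odot>\<^bsub>Y\<^esub> y) |r x y.
         r \<in> carrier R \<and> x \<in> carrier X \<and> y \<in> carrier Y})"

definition tensor ::
    "('r, 's) ring_scheme \<Rightarrow> ('r, 'x, 't) module_scheme \<Rightarrow> ('r, 'y, 'u) module_scheme
      \<Rightarrow> ('x \<times> 'y \<Rightarrow>\<^sub>0 int) set monoid" where
  "tensor R X Y = tensor_free X Y Mod tensor_rel R X Y"

definition pure_tensor ::
    "('r, 's) ring_scheme \<Rightarrow> ('r, 'x, 't) module_scheme \<Rightarrow> ('r, 'y, 'u) module_scheme
      \<Rightarrow> 'x \<Rightarrow> 'y \<Rightarrow> ('x \<times> 'y \<Rightarrow>\<^sub>0 int) set" where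
  "pure_tensor R X Y x y = tensor_rel R X Y #>\<^bsub>tensor_free X Y\<^esub> frag_of (x, y)"

text \<open>
  The map \<open>f \<otimes> g\<close> into \<open>X' \<otimes>\<^sub>R Y'\<close>.  Its argument \<open>U\<close> is a coset in the free abelian group on
  \<open>X \<times> Y\<close>; the image of \<open>U\<close> under the induced map of free groups lies in a single coset,
  which is obtained by adding the subgroup of relations.
\<close>

definition tensor_map ::
    "('r, 's) ring_scheme \<Rightarrow> ('r, 'v, 't) module_scheme \<Rightarrow> ('r, 'w, 'u) module_scheme
      \<Rightarrow> ('x \<Rightarrow> 'v) \<Rightarrow> ('y \<Rightarrow> 'w) \<Rightarrow> ('x \<times> 'y \<Rightarrow>\<^sub>0 int) set \<Rightarrow> ('v \<times> 'w \<Rightarrow>\<^sub>0 int) set" where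
  "tensor_map R X' Y' f g U = tensor_rel R X' Y' <#>\<^bsub>tensor_free X' Y'\<^esub>
     (frag_extend (\<lambda>(x, y). frag_of (f x, g y)) ` U)"

text \<open>
  For a ring homomorphism \<open>h : R \<rightarrow> A\<close> and a left \<open>R\<close>-module \<open>M\<close>, the left \<open>A\<close>-module
  \<open>A \<otimes>\<^sub>R M\<close> with \<open>a (b \<otimes> m) = a b \<otimes> m\<close>.  The record fields for a ring product and unit
  are filled arbitrarily.
\<close>

definition base_change ::
    "('r, 's) ring_scheme \<Rightarrow> ('a, 't) ring_scheme \<Rightarrow> ('r \<Rightarrow> 'a) \<Rightarrow> ('r, 'm, 'u) module_scheme
      \<Rightarrow> ('a, ('a \<times> 'm \<Rightarrow>\<^sub>0 int) set) module" where
  "base_change R A h M =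
     \<lparr>carrier = carrier (tensor R (rmod h A) M),
      monoid.mult = undefined, monoid.one = undefined,
      ring.zero = monoid.one (tensor R (rmod h A) M),
      add = monoid.mult (tensor R (rmod h A) M),
      smult = \<lambda>a. tensor_map R (rmod h A) M (\<lambda>b. a \<otimes>\<^bsub>A\<^esub> b) (\<lambda>m. m)\<rparr>"

text \<open>The homomorphism \<open>Id \<otimes> \<phi>\<close> into \<open>A \<otimes>\<^sub>R N\<close>.\<close>

definition base_change_map ::
    "('r, 's) ring_scheme \<Rightarrow> ('a, 't) ring_scheme \<Rightarrow> ('r \<Rightarrow> 'a) \<Rightarrow> ('r, 'n, 'u) module_scheme
      \<Rightarrow> ('m \<Rightarrow> 'n) \<Rightarrow> ('a \<times> 'm \<Rightarrow>\<^sub>0 int) set \<Rightarrow> ('a \<times> 'n \<Rightarrow>\<^sub>0 int) set" where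
  "base_change_map R A h N \<phi> = tensor_map R (rmod h A) N (\<lambda>b. b) \<phi>"

text \<open>The canonical isomorphism \<open>A\<^sup>n \<rightarrow> A \<otimes>\<^sub>R R\<^sup>n\<close>, \<open>(a\<^sub>i) \<mapsto> \<Sum>\<^sub>i a\<^sub>i \<otimes> e\<^sub>i\<close>.\<close>

definition base_change_free ::
    "('r, 's) ring_scheme \<Rightarrow> ('a, 't) ring_scheme \<Rightarrow> ('r \<Rightarrow> 'a) \<Rightarrow> nat
      \<Rightarrow> (nat \<Rightarrow> 'a) \<Rightarrow> ('a \<times> (nat \<Rightarrow> 'r) \<Rightarrow>\<^sub>0 int) set" where
  "base_change_free R A h n a = (\<Oplus>\<^bsub>base_change R A h (std_free R n)\<^esub>i\<in>{..<n}.
     pure_tensor R (rmod h A) (std_free R n) (a i) (std_vec R n i))"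

text \<open>
  The sequence of \<open>A\<close>-modules \<open>0 \<leftarrow> A \<otimes>\<^sub>R M \<leftarrow> A\<^sup>m \<leftarrow> A\<^sup>n\<close> with maps \<open>G\<close>, \<open>F\<close> is obtained from
  \<open>0 \<leftarrow> M \<leftarrow> R\<^sup>m \<leftarrow> R\<^sup>n\<close> with maps \<open>g\<close>, \<open>f\<close> by applying \<open>A \<otimes>\<^sub>R _\<close> and identifying
  \<open>A \<otimes>\<^sub>R R\<^sup>m\<close> with \<open>A\<^sup>m\<close> and \<open>A \<otimes>\<^sub>R R\<^sup>n\<close> with \<open>A\<^sup>n\<close>.
\<close>

definition induced_presentation ::
    "('r, 's) ring_scheme \<Rightarrow> ('a, 't) ring_scheme \<Rightarrow> ('r \<Rightarrow> 'a) \<Rightarrow> ('r, 'm, 'u) module_scheme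
      \<Rightarrow> nat \<Rightarrow> nat \<Rightarrow> ((nat \<Rightarrow> 'r) \<Rightarrow> 'm) \<Rightarrow> ((nat \<Rightarrow> 'r) \<Rightarrow> nat \<Rightarrow> 'r)
      \<Rightarrow> ((nat \<Rightarrow> 'a) \<Rightarrow> ('a \<times> 'm \<Rightarrow>\<^sub>0 int) set) \<Rightarrow> ((nat \<Rightarrow> 'a) \<Rightarrow> nat \<Rightarrow> 'a) \<Rightarrow> bool" where
  "induced_presentation R A h M m n g f G F \<longleftrightarrow>
     base_change_free R A h m \<in> mod_iso A (std_free A m) (base_change R A h (std_free R m)) \<and>
     base_change_free R A h n \<in> mod_iso A (std_free A n) (base_change R A h (std_free R n)) \<and>
     (\<forall>a\<in>carrier (std_free A m).
        G a = base_change_map R A h M g (base_change_free R A h m a)) \<and>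
     (\<forall>a\<in>carrier (std_free A n). F a \<in> carrier (std_free A m) \<and>
        base_change_free R A h m (F a) =
          base_change_map R A h (std_free R m) f (base_change_free R A h n a))"

section \<open>Injective, projective and flat modules\<close>

text \<open>
  The test modules have to range over modules with elements in fixed types, which are
  parameters of the definitions; a statement in which \<open>'x\<close> and \<open>'y\<close> are free type variables
  is a statement about all test modules.  For right modules use \<open>opp R\<close> in place of \<open>R\<close>.
\<close>

definition injective_module ::
    "'x itself \<Rightarrow> 'y itself \<Rightarrow> ('r, 's) ring_scheme \<Rightarrow> ('r, 'm, 't) module_scheme \<Rightarrow> bool" where
  "injective_module TX TY R M \<longleftrightarrow> left_module R M \<and>
     (\<forall>(X :: ('r, 'x) module) (Y :: ('r, 'y) module) i f.
        left_module R X \<and> left_module R Y \<and>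
        i \<in> mod_hom R X Y \<and> inj_on i (carrier X) \<and> f \<in> mod_hom R X M
        \<longrightarrow> (\<exists>g\<in>mod_hom R Y M. \<forall>x\<in>carrier X. g (i x) = f x))"

definition projective_module ::
    "'x itself \<Rightarrow> 'y itself \<Rightarrow> ('r, 's) ring_scheme \<Rightarrow> ('r, 'm, 't) module_scheme \<Rightarrow> bool" where
  "projective_module TX TY R M \<longleftrightarrow> left_module R M \<and>
     (\<forall>(X :: ('r, 'x) module) (Y :: ('r, 'y) module) p f.
        left_module R X \<and> left_module R Y \<and>
        p \<in> mod_hom R X Y \<and> p ` carrier X = carrier Y \<and> f \<in> mod_hom R M Y
        \<longrightarrow> (\<exists>g\<in>mod_hom R M X. \<forall>m\<in>carrier M. p (g m) = f m))"

definition flat_left_module ::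
    "'x itself \<Rightarrow> 'y itself \<Rightarrow> ('r, 's) ring_scheme \<Rightarrow> ('r, 'm, 't) module_scheme \<Rightarrow> bool" where
  "flat_left_module TX TY R M \<longleftrightarrow> left_module R M \<and>
     (\<forall>(X :: ('r, 'x) module) (Y :: ('r, 'y) module) i.
        right_module R X \<and> right_module R Y \<and>
        i \<in> mod_hom (opp R) X Y \<and> inj_on i (carrier X)
        \<longrightarrow> inj_on (tensor_map R Y M i (\<lambda>m. m)) (carrier (tensor R X M)))"

definition flat_right_module ::
    "'x itself \<Rightarrow> 'y itself \<Rightarrow> ('r, 's) ring_scheme \<Rightarrow> ('r, 'm, 't) module_scheme \<Rightarrow> bool" where
  "flat_right_module TX TY R M \<longleftrightarrow> right_module R M \<and>
     (\<forall>(X :: ('r, 'x) module) (Y :: ('r, 'y) module) i.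
        left_module R X \<and> left_module R Y \<and>
        i \<in> mod_hom R X Y \<and> inj_on i (carrier X)
        \<longrightarrow> inj_on (tensor_map R M Y (\<lambda>m. m) i) (carrier (tensor R M X)))"

section \<open>Frobenius algebras and locally Frobenius algebras\<close>

text \<open>The library's locale \<^locale>\<open>algebra\<close> is restricted to commutative algebras.\<close>

locale k_algebra = K?: field K + module K A + A?: ring A
    for K :: "('k, 's) ring_scheme" (structure) and A :: "('k, 'a, 't) module_scheme" (structure) +
  assumes smult_mult_left:
      "\<lbrakk>c \<in> carrier K; x \<in> carrier A; y \<in> carrier A\<rbrakk>
        \<Longrightarrow> (c \<odot>\<^bsub>A\<^esub> x) \<otimes>\<^bsub>A\<^esub> y = c \<odot>\<^bsub>A\<^esub> (x \<otimes>\<^bsub>A\<^esub> y)"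
    and smult_mult_right:
      "\<lbrakk>c \<in> carrier K; x \<in> carrier A; y \<in> carrier A\<rbrakk>
        \<Longrightarrow> x \<otimes>\<^bsub>A\<^esub> (c \<odot>\<^bsub>A\<^esub> y) = c \<odot>\<^bsub>A\<^esub> (x \<otimes>\<^bsub>A\<^esub> y)"

definition alg_hom ::
    "('k, 's) ring_scheme \<Rightarrow> ('k, 'b, 't) module_scheme \<Rightarrow> ('k, 'c, 'u) module_scheme
      \<Rightarrow> ('b \<Rightarrow> 'c) set" where
  "alg_hom K B C = ring_hom B C \<inter> mod_hom K B C"

definition frobenius_form ::
    "('k, 's) ring_scheme \<Rightarrow> ('k, 'a, 't) module_scheme \<Rightarrow> ('a \<Rightarrow> 'k) \<Rightarrow> bool" where
  "frobenius_form K R \<theta> \<longleftrightarrow> \<theta> \<in> mod_hom K R (lmod (\<lambda>c. c) K) \<and>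
     (\<forall>x\<in>carrier R. (\<forall>y\<in>carrier R. \<theta> (x \<otimes>\<^bsub>R\<^esub> y) = \<zero>\<^bsub>K\<^esub>) \<longrightarrow> x = \<zero>\<^bsub>R\<^esub>) \<and>
     (\<forall>y\<in>carrier R. (\<forall>x\<in>carrier R. \<theta> (x \<otimes>\<^bsub>R\<^esub> y) = \<zero>\<^bsub>K\<^esub>) \<longrightarrow> y = \<zero>\<^bsub>R\<^esub>)"

definition symmetric_frobenius ::
    "('k, 's) ring_scheme \<Rightarrow> ('k, 'a, 't) module_scheme \<Rightarrow> bool" where
  "symmetric_frobenius K R \<longleftrightarrow> k_algebra K R \<and> fin_gen K R \<and>
     (\<exists>\<theta>. frobenius_form K R \<theta> \<and>
        (\<forall>x\<in>carrier R. \<forall>y\<in>carrier R. \<theta> (x \<otimes>\<^bsub>R\<^esub> y) = \<theta> (y \<otimes>\<^bsub>R\<^esub> x)))"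

definition frobenius_extension ::
    "('k, 's) ring_scheme \<Rightarrow> ('k, 'b, 't) module_scheme \<Rightarrow> ('k, 'c, 'u) module_scheme
      \<Rightarrow> ('b \<Rightarrow> 'c) \<Rightarrow> bool" where
  "frobenius_extension K B C h \<longleftrightarrow> k_algebra K B \<and> k_algebra K C \<and> h \<in> alg_hom K B C \<and>
     (\<exists>\<Phi> (n :: nat) x y.
        \<Phi> \<in> mod_hom B (lmod h C) (lmod (\<lambda>b. b) B) \<and>
        \<Phi> \<in> mod_hom (opp B) (rmod h C) (rmod (\<lambda>b. b) B) \<and>
        x \<in> {1..n} \<rightarrow> carrier C \<and> y \<in> {1..n} \<rightarrow> carrier C \<and>
        (\<forall>c\<in>carrier C.
           (\<Oplus>\<^bsub>C\<^esub>i\<in>{1..n}. y i \<otimes>\<^bsub>C\<^esub> h (\<Phi> (x i \<otimes>\<^bsub>C\<^esub> c))) = c \<and>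
           (\<Oplus>\<^bsub>C\<^esub>i\<in>{1..n}. h (\<Phi> (c \<otimes>\<^bsub>C\<^esub> y i)) \<otimes>\<^bsub>C\<^esub> x i) = c))"

definition free_frobenius_extension ::
    "('k, 's) ring_scheme \<Rightarrow> ('k, 'b, 't) module_scheme \<Rightarrow> ('k, 'c, 'u) module_scheme
      \<Rightarrow> ('b \<Rightarrow> 'c) \<Rightarrow> bool" where
  "free_frobenius_extension K B C h \<longleftrightarrow> frobenius_extension K B C h \<and>
     free_module B (lmod h C) \<and> free_module (opp B) (rmod h C)"

definition shape :: "'l set \<Rightarrow> ('l \<times> 'l) set \<Rightarrow> 'l \<Rightarrow> bool" where
  "shape \<Lambda> rel l0 \<longleftrightarrow> infinite \<Lambda> \<and> partial_order_on \<Lambda> rel \<and>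
     (\<forall>l\<in>\<Lambda>. \<forall>l'\<in>\<Lambda>. \<exists>u\<in>\<Lambda>. (l, u) \<in> rel \<and> (l', u) \<in> rel) \<and>
     l0 \<in> \<Lambda> \<and> (\<forall>l\<in>\<Lambda>. (l0, l) \<in> rel) \<and>
     (\<forall>l\<in>\<Lambda>. \<exists>l'\<in>\<Lambda>. (l, l') \<in> rel \<and> l \<noteq> l')"

text \<open>
  The algebras of the directed system are the subalgebras \<open>A\<lparr>carrier := S l\<rparr>\<close> of \<open>A\<close>, with
  augmentations \<open>\<epsilon> l\<close>; the inclusion homomorphisms are the identity function.  The equation
  \<open>A(\<lambda>\<^sub>0) = k\<close> says that \<open>S l0\<close> is the image of the unit map of \<open>A\<close>.
\<close>

locale locally_frobenius = k_algebra K A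
    for K :: "('k, 's) ring_scheme" (structure) and A :: "('k, 'a, 't) module_scheme" (structure) +
  fixes \<Lambda> :: "'l set" and rel :: "('l \<times> 'l) set" and l0 :: 'l
    and S :: "'l \<Rightarrow> 'a set" and \<epsilon> :: "'l \<Rightarrow> 'a \<Rightarrow> 'k"
  assumes shape: "shape \<Lambda> rel l0"
    and subring: "l \<in> \<Lambda> \<Longrightarrow> subring (S l) A"
    and smult_sub: "\<lbrakk>l \<in> \<Lambda>; c \<in> carrier K; x \<in> S l\<rbrakk> \<Longrightarrow> c \<odot>\<^bsub>A\<^esub> x \<in> S l"
    and symmetric: "l \<in> \<Lambda> \<Longrightarrow> symmetric_frobenius K (A\<lparr>carrier := S l\<rparr>)"
    and augmentation: "l \<in> \<Lambda> \<Longrightarrow> \<epsilon> l \<in> alg_hom K (A\<lparr>carrier := S l\<rparr>) (lmod (\<lambda>c. c) K)"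
    and proper: "\<lbrakk>(l, l') \<in> rel; l \<noteq> l'\<rbrakk> \<Longrightarrow> S l \<subset> S l'"
    and augmented: "\<lbrakk>(l, l') \<in> rel; x \<in> S l\<rbrakk> \<Longrightarrow> \<epsilon> l' x = \<epsilon> l x"
    and initial: "S l0 = (\<lambda>c. c \<odot>\<^bsub>A\<^esub> \<one>\<^bsub>A\<^esub>) ` carrier K"
    and union: "carrier A = (\<Union>l\<in>\<Lambda>. S l)"
    and free_frobenius: "\<lbrakk>(l, l') \<in> rel; l \<noteq> l'\<rbrakk>
      \<Longrightarrow> free_frobenius_extension K (A\<lparr>carrier := S l\<rparr>) (A\<lparr>carrier := S l'\<rparr>) (\<lambda>x. x)"

end

theory Submission
  imports Defs
begin

text \<open>
  The stages \<open>R = A(\<lambda>)\<close> are finite dimensional Frobenius algebras, so they have dual bases \<open>r\<^sub>i, s\<^sub>i\<close> with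
  respect to their form \<open>\<theta>\<close>, and every homomorphism from a left ideal of \<open>R\<close> to \<open>R\<close> is a right multiplication.
  A homomorphism from a left ideal of \<open>R\<close> to \<open>A\<close> has its image in a larger stage \<open>C\<close>; the Frobenius extension
  \<open>C : R\<close> decomposes it into homomorphisms to \<open>R\<close>, so it is again a right multiplication, and \<open>A\<close> is injective by
  Baer's criterion.  Splitting the embedding of \<open>A\<close> into a coinduced module gives a \<open>k\<close>-linear
  \<open>\<phi> : A \<rightarrow> A\<close> with \<open>a = \<Sum>\<^sub>i r\<^sub>i \<phi>(s\<^sub>i a)\<close>, and averaging \<open>k\<close>-linear sections and retractions with
  \<open>\<Sum>\<^sub>i r\<^sub>i \<otimes> s\<^sub>i\<close> then shows that \<open>A\<close> is projective and flat.  The right-handed statements are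
  those for the opposite algebra.

  A finitely generated left ideal of \<open>A\<close> has generators in some \<open>R\<close>; the relations between them over \<open>A\<close> are generated
  by those over \<open>R\<close>, which form a finite dimensional space.  A finite presentation over \<open>A\<close> is a
  matrix, whose entries lie in some \<open>R\<close>, and the module presented by this matrix over \<open>R\<close> induces the given one;
  a homomorphism of finitely presented modules amounts to two further matrices.\<close>

section \<open>Modules over noncommutative rings\<close>

text \<open>A directed union of free modules is flat but in general not projective, so projectivity
  of \<open>A\<close> over a stage cannot be read off from the freeness of the steps; it is drawn
  from injectivity instead. Over a Frobenius algebra the identity of an injective module is a
  relative trace (Higman's criterion), and relative traces turn k-linear liftings and left inverses,
  which always exist, into R-linear ones. Injectivity faces the obstacle that a homomorphism into a
  union need not land in one member of it. What helps is that a left ideal of a stage is finite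
  dimensional over k, so its image meets finitely many generators only. The test modules of (a) have
  arbitrary types, while coinduced modules create new types on the way. Baer's condition speaks only
  of ideals, so it is one proposition from which extensions follow at every type. In (c) and (d) a
  homomorphism of free modules over a stage and its extension to \<open>A\<close> are the same
  function, restricted to vectors with entries in the stage; identities between matrices then
  descend by restriction.\<close>

lemma (in comm_monoid) finprod_swap:
  assumes "finite I" "finite J" "\<And>i j. i \<in> I \<Longrightarrow> j \<in> J \<Longrightarrow> f i j \<in> carrier G"
  shows "(\<Otimes>i\<in>I. \<Otimes>j\<in>J. f i j) = (\<Otimes>j\<in>J. \<Otimes>i\<in>I. f i j)"
  using assms(1,3)
proof (induction I rule: finite_induct)
  case (insert a I)
  have "(\<Otimes>i\<in>insert a I. \<Otimes>j\<in>J. f i j) = (\<Otimes>j\<in>J. f a j) \<otimes> (\<Otimes>i\<in>I. \<Otimes>j\<in>J. f i j)"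
    by (subst finprod_insert) (use insert in \<open>auto intro!: finprod_closed\<close>)
  also have "\<dots> = (\<Otimes>j\<in>J. f a j) \<otimes> (\<Otimes>j\<in>J. \<Otimes>i\<in>I. f i j)"
    using insert by simp
  also have "\<dots> = (\<Otimes>j\<in>J. f a j \<otimes> (\<Otimes>i\<in>I. f i j))"
    by (subst finprod_multf) (use insert in \<open>auto intro!: finprod_closed\<close>)
  also have "\<dots> = (\<Otimes>j\<in>J. \<Otimes>i\<in>insert a I. f i j)"
  proof (rule finprod_cong')
    fix j assume "j \<in> J"
    then show "f a j \<otimes> (\<Otimes>i\<in>I. f i j) = (\<Otimes>i\<in>insert a I. f i j)"
      using insert by (subst finprod_insert) auto
  qed (use insert in \<open>auto intro!: finprod_closed\<close>)
  finally show ?case .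
qed simp

text \<open>No condition on \<open>I\<close> appears because over an infinite index set both
  products are the unit by convention.\<close>

lemma hom_finprod:
  assumes "comm_group G" "comm_group H" "h \<in> hom G H" "g \<in> I \<rightarrow> carrier G"
  shows "h (finprod G g I) = finprod H (\<lambda>i. h (g i)) I"
proof -
  interpret G: comm_group G by fact
  interpret H: comm_group H by fact
  interpret group_hom G H h
    by (simp add: group_hom_def group_hom_axioms_def assms(3) G.is_group H.is_group)
  show ?thesis using assms(4)
  proof (induction I rule: infinite_finite_induct)
    case (insert x F)
    then have "h (finprod G g (insert x F)) = h (g x) \<otimes>\<^bsub>H\<^esub> h (finprod G g F)"
      by (subst G.finprod_insert) auto
    then show ?case using insert by (subst H.finprod_insert) (auto simp: Pi_iff)
  qed auto
qed

lemma left_moduleI: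
  fixes R (structure) and M (structure)
  assumes "ring R" "abelian_group M"
    and "\<And>a x. \<lbrakk>a \<in> carrier R; x \<in> carrier M\<rbrakk> \<Longrightarrow> a \<odot>\<^bsub>M\<^esub> x \<in> carrier M"
    and "\<And>a b x. \<lbrakk>a \<in> carrier R; b \<in> carrier R; x \<in> carrier M\<rbrakk>
        \<Longrightarrow> (a \<oplus>\<^bsub>R\<^esub> b) \<odot>\<^bsub>M\<^esub> x = a \<odot>\<^bsub>M\<^esub> x \<oplus>\<^bsub>M\<^esub> b \<odot>\<^bsub>M\<^esub> x"
    and "\<And>a x y. \<lbrakk>a \<in> carrier R; x \<in> carrier M; y \<in> carrier M\<rbrakk>
        \<Longrightarrow> a \<odot>\<^bsub>M\<^esub> (x \<oplus>\<^bsub>M\<^esub> y) = a \<odot>\<^bsub>M\<^esub> x \<oplus>\<^bsub>M\<^esub> a \<odot>\<^bsub>M\<^esub> y"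
    and "\<And>a b x. \<lbrakk>a \<in> carrier R; b \<in> carrier R; x \<in> carrier M\<rbrakk>
        \<Longrightarrow> (a \<otimes>\<^bsub>R\<^esub> b) \<odot>\<^bsub>M\<^esub> x = a \<odot>\<^bsub>M\<^esub> (b \<odot>\<^bsub>M\<^esub> x)"
    and "\<And>x. x \<in> carrier M \<Longrightarrow> \<one>\<^bsub>R\<^esub> \<odot>\<^bsub>M\<^esub> x = x"
  shows "left_module R M"
  using assms by (simp add: left_module_def left_module_axioms_def)

lemma left_moduleD:
  assumes "left_module R M"
  shows "ring R" "abelian_group M"
    and "\<And>a x. \<lbrakk>a \<in> carrier R; x \<in> carrier M\<rbrakk> \<Longrightarrow> a \<odot>\<^bsub>M\<^esub> x \<in> carrier M"
    and "\<And>a b x. \<lbrakk>a \<in> carrier R; b \<in> carrier R; x \<in> carrier M\<rbrakk>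
        \<Longrightarrow> (a \<oplus>\<^bsub>R\<^esub> b) \<odot>\<^bsub>M\<^esub> x = a \<odot>\<^bsub>M\<^esub> x \<oplus>\<^bsub>M\<^esub> b \<odot>\<^bsub>M\<^esub> x"
    and "\<And>a x y. \<lbrakk>a \<in> carrier R; x \<in> carrier M; y \<in> carrier M\<rbrakk>
        \<Longrightarrow> a \<odot>\<^bsub>M\<^esub> (x \<oplus>\<^bsub>M\<^esub> y) = a \<odot>\<^bsub>M\<^esub> x \<oplus>\<^bsub>M\<^esub> a \<odot>\<^bsub>M\<^esub> y"
    and "\<And>a b x. \<lbrakk>a \<in> carrier R; b \<in> carrier R; x \<in> carrier M\<rbrakk>
        \<Longrightarrow> (a \<otimes>\<^bsub>R\<^esub> b) \<odot>\<^bsub>M\<^esub> x = a \<odot>\<^bsub>M\<^esub> (b \<odot>\<^bsub>M\<^esub> x)"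
    and "\<And>x. x \<in> carrier M \<Longrightarrow> \<one>\<^bsub>R\<^esub> \<odot>\<^bsub>M\<^esub> x = x"
  using assms by (auto simp: left_module_def left_module_axioms_def)

lemma mod_homI:
  assumes "\<And>x. x \<in> carrier M \<Longrightarrow> f x \<in> carrier N"
    and "\<And>x y. \<lbrakk>x \<in> carrier M; y \<in> carrier M\<rbrakk> \<Longrightarrow> f (x \<oplus>\<^bsub>M\<^esub> y) = f x \<oplus>\<^bsub>N\<^esub> f y"
    and "\<And>r x. \<lbrakk>r \<in> carrier R; x \<in> carrier M\<rbrakk> \<Longrightarrow> f (r \<odot>\<^bsub>M\<^esub> x) = r \<odot>\<^bsub>N\<^esub> f x"
  shows "f \<in> mod_hom R M N"
  using assms by (auto simp: mod_hom_def)

lemma mod_homD: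
  assumes "f \<in> mod_hom R M N"
  shows "\<And>x. x \<in> carrier M \<Longrightarrow> f x \<in> carrier N"
    and "\<And>x y. \<lbrakk>x \<in> carrier M; y \<in> carrier M\<rbrakk> \<Longrightarrow> f (x \<oplus>\<^bsub>M\<^esub> y) = f x \<oplus>\<^bsub>N\<^esub> f y"
    and "\<And>r x. \<lbrakk>r \<in> carrier R; x \<in> carrier M\<rbrakk> \<Longrightarrow> f (r \<odot>\<^bsub>M\<^esub> x) = r \<odot>\<^bsub>N\<^esub> f x"
  using assms by (auto simp: mod_hom_def)

lemma mod_hom_comp:
  assumes "f \<in> mod_hom R M N" "g \<in> mod_hom R N P"
  shows "(\<lambda>x. g (f x)) \<in> mod_hom R M P"
  using assms by (auto simp: mod_hom_def Pi_iff)

lemma mod_hom_hom: "f \<in> mod_hom R M N \<Longrightarrow> f \<in> hom (add_monoid M) (add_monoid N)"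
  by (auto simp: mod_hom_def hom_def)

lemma add_hom_zero:
  assumes "abelian_group M" "abelian_group N" "f \<in> hom (add_monoid M) (add_monoid N)"
  shows "f \<zero>\<^bsub>M\<^esub> = \<zero>\<^bsub>N\<^esub>"
  using hom_one[OF assms(3) abelian_group.a_group[OF assms(1)] abelian_group.a_group[OF assms(2)]]
  by simp

lemma add_hom_minus:
  assumes "abelian_group M" "abelian_group N" "f \<in> hom (add_monoid M) (add_monoid N)"
    "x \<in> carrier M"
  shows "f (\<ominus>\<^bsub>M\<^esub> x) = \<ominus>\<^bsub>N\<^esub> f x"
proof -
  interpret group_hom "add_monoid M" "add_monoid N" f
    using assms by (simp add: group_hom_def group_hom_axioms_def abelian_group.a_group)
  show ?thesis using hom_inv[of x] assms(4) by (simp add: a_inv_def)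
qed

lemma add_hom_finsum:
  assumes "abelian_group M" "abelian_group N" "f \<in> hom (add_monoid M) (add_monoid N)"
    "g \<in> I \<rightarrow> carrier M"
  shows "f (finsum M g I) = finsum N (\<lambda>i. f (g i)) I"
  unfolding finsum_def
  by (rule hom_finprod) (use assms abelian_group.a_comm_group in auto)

lemma mod_hom_zero:
  assumes "left_module R M" "left_module R N" "f \<in> mod_hom R M N"
  shows "f \<zero>\<^bsub>M\<^esub> = \<zero>\<^bsub>N\<^esub>"
  by (rule add_hom_zero) (use assms left_moduleD(2) mod_hom_hom in auto)

lemma mod_hom_minus:
  assumes "left_module R M" "left_module R N" "f \<in> mod_hom R M N" "x \<in> carrier M"
  shows "f (\<ominus>\<^bsub>M\<^esub> x) = \<ominus>\<^bsub>N\<^esub> f x"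
  by (rule add_hom_minus) (use assms left_moduleD(2) mod_hom_hom in auto)

lemma mod_hom_finsum:
  assumes "left_module R M" "left_module R N" "f \<in> mod_hom R M N" "g \<in> I \<rightarrow> carrier M"
  shows "f (finsum M g I) = finsum N (\<lambda>i. f (g i)) I"
  by (rule add_hom_finsum) (use assms left_moduleD(2) mod_hom_hom in auto)

context left_module
begin

lemma smult_hom: "a \<in> carrier R \<Longrightarrow> (\<lambda>x. a \<odot>\<^bsub>M\<^esub> x) \<in> hom (add_monoid M) (add_monoid M)"
  by (auto simp: hom_def smult_closed smult_r_distr)

lemma smult_hom_left: "x \<in> carrier M \<Longrightarrow> (\<lambda>a. a \<odot>\<^bsub>M\<^esub> x) \<in> hom (add_monoid R) (add_monoid M)"
  by (auto simp: hom_def smult_closed smult_l_distr)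

lemma smult_zero_right: "a \<in> carrier R \<Longrightarrow> a \<odot>\<^bsub>M\<^esub> \<zero>\<^bsub>M\<^esub> = \<zero>\<^bsub>M\<^esub>"
  using add_hom_zero[OF M.abelian_group_axioms M.abelian_group_axioms smult_hom] by simp

lemma smult_zero_left: "x \<in> carrier M \<Longrightarrow> \<zero> \<odot>\<^bsub>M\<^esub> x = \<zero>\<^bsub>M\<^esub>"
  using add_hom_zero[OF R.abelian_group_axioms M.abelian_group_axioms smult_hom_left] by simp

lemma smult_minus_right:
  "\<lbrakk>a \<in> carrier R; x \<in> carrier M\<rbrakk> \<Longrightarrow> a \<odot>\<^bsub>M\<^esub> (\<ominus>\<^bsub>M\<^esub> x) = \<ominus>\<^bsub>M\<^esub> (a \<odot>\<^bsub>M\<^esub> x)"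
  using add_hom_minus[OF M.abelian_group_axioms M.abelian_group_axioms smult_hom] by simp

lemma smult_minus_left:
  "\<lbrakk>a \<in> carrier R; x \<in> carrier M\<rbrakk> \<Longrightarrow> (\<ominus> a) \<odot>\<^bsub>M\<^esub> x = \<ominus>\<^bsub>M\<^esub> (a \<odot>\<^bsub>M\<^esub> x)"
  using add_hom_minus[OF R.abelian_group_axioms M.abelian_group_axioms smult_hom_left] by simp

lemma smult_finsum:
  "\<lbrakk>a \<in> carrier R; g \<in> I \<rightarrow> carrier M\<rbrakk> \<Longrightarrow> a \<odot>\<^bsub>M\<^esub> finsum M g I = (\<Oplus>\<^bsub>M\<^esub>i\<in>I. a \<odot>\<^bsub>M\<^esub> g i)"
  by (rule add_hom_finsum[OF M.abelian_group_axioms M.abelian_group_axioms smult_hom])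

lemma finsum_smult:
  "\<lbrakk>x \<in> carrier M; g \<in> I \<rightarrow> carrier R\<rbrakk> \<Longrightarrow> finsum R g I \<odot>\<^bsub>M\<^esub> x = (\<Oplus>\<^bsub>M\<^esub>i\<in>I. g i \<odot>\<^bsub>M\<^esub> x)"
  by (rule add_hom_finsum[OF R.abelian_group_axioms M.abelian_group_axioms smult_hom_left])

text \<open>Negation is multiplication by -1, so closure under it comes with closure under
  scalars.\<close>

lemma submoduleI':
  assumes "H \<subseteq> carrier M" "\<zero>\<^bsub>M\<^esub> \<in> H"
    and "\<And>a b. \<lbrakk>a \<in> H; b \<in> H\<rbrakk> \<Longrightarrow> a \<oplus>\<^bsub>M\<^esub> b \<in> H"
    and "\<And>a x. \<lbrakk>a \<in> carrier R; x \<in> H\<rbrakk> \<Longrightarrow> a \<odot>\<^bsub>M\<^esub> x \<in> H"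
  shows "submodule H R M"
proof (intro submodule.intro subgroup.intro submodule_axioms.intro)
  fix x assume x: "x \<in> H"
  then have "\<ominus>\<^bsub>M\<^esub> x = (\<ominus> \<one>) \<odot>\<^bsub>M\<^esub> x"
    using assms(1) by (subst smult_minus_left) (auto simp: smult_one)
  then show "inv\<^bsub>add_monoid M\<^esub> x \<in> H"
    using assms(4)[of "\<ominus> \<one>" x] x by (simp add: a_inv_def)
qed (use assms in auto)

lemma submoduleD:
  assumes "submodule H R M"
  shows "H \<subseteq> carrier M" "\<zero>\<^bsub>M\<^esub> \<in> H"
    and "\<And>a b. \<lbrakk>a \<in> H; b \<in> H\<rbrakk> \<Longrightarrow> a \<oplus>\<^bsub>M\<^esub> b \<in> H"
    and "\<And>a x. \<lbrakk>a \<in> carrier R; x \<in> H\<rbrakk> \<Longrightarrow> a \<odot>\<^bsub>M\<^esub> x \<in> H"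
    and "\<And>a. a \<in> H \<Longrightarrow> \<ominus>\<^bsub>M\<^esub> a \<in> H"
  using submodule.axioms[OF assms]
  by (auto simp: subgroup_def submodule_axioms_def a_inv_def)

lemma submodule_carrier: "submodule (carrier M) R M"
  by (rule submoduleI') (auto simp: smult_closed)

lemma submodule_finsum:
  assumes "submodule H R M" "g \<in> I \<rightarrow> H"
  shows "finsum M g I \<in> H"
  using assms(2)
proof (induction I rule: infinite_finite_induct)
  case (insert x F)
  note H = submoduleD[OF assms(1)]
  show ?case
    using insert H by (subst M.finsum_insert) (auto simp: Pi_iff subset_iff)
qed (use submoduleD[OF assms(1)] in auto)

lemma submodule_left_module:
  assumes "submodule H R M"
  shows "left_module R (M\<lparr>carrier := H\<rparr>)"
proof -
  note H = submoduleD[OF assms]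
  have c: "x \<in> H \<Longrightarrow> x \<in> carrier M" for x using H(1) by auto
  show ?thesis
  proof (rule left_moduleI)
    show "abelian_group (M\<lparr>carrier := H\<rparr>)"
    proof (rule abelian_groupI)
      fix x assume "x \<in> carrier (M\<lparr>carrier := H\<rparr>)"
      then show "\<exists>y\<in>carrier (M\<lparr>carrier := H\<rparr>). y \<oplus>\<^bsub>M\<lparr>carrier := H\<rparr>\<^esub> x = \<zero>\<^bsub>M\<lparr>carrier := H\<rparr>\<^esub>"
        using H(5)[of x] c[of x] by (auto intro!: bexI[of _ "\<ominus>\<^bsub>M\<^esub> x"] simp: M.l_neg)
    qed (use H c in \<open>auto simp: M.a_ac\<close>)
  qed (use H(4) in \<open>auto dest!: c simp: smult_l_distr smult_r_distr smult_assoc smult_one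
     intro: R.ring_axioms\<close>)
qed

end

text \<open>Moves sums between a substructure and the ambient group: the inclusion is additive and
  so commutes with sums.\<close>

lemma finsum_carrier_update:
  assumes "abelian_group M" "abelian_group (M\<lparr>carrier := H\<rparr>)" "H \<subseteq> carrier M" "g \<in> I \<rightarrow> H"
  shows "finsum (M\<lparr>carrier := H\<rparr>) g I = finsum M g I"
  using add_hom_finsum[OF assms(2,1), of "\<lambda>x. x" g I] assms(3,4)
  by (auto simp: hom_def)

lemma (in left_module) restrict_scalars:
  assumes "subring S R"
  shows "left_module (R\<lparr>carrier := S\<rparr>) M"
  using subringE(1)[OF assms]
  by (intro left_moduleI R.subring_is_ring assms)
     (auto simp: subset_iff smult_closed smult_l_distr smult_r_distr smult_assoc smult_one M.abelian_group_axioms)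

lemma mod_hom_restrict: "f \<in> mod_hom R M N \<Longrightarrow> S \<subseteq> carrier R \<Longrightarrow> f \<in> mod_hom (R\<lparr>carrier := S\<rparr>) M N"
  by (auto simp: mod_hom_def)

text \<open>\<open>lmod\<close>, \<open>rmod\<close> and \<open>opp\<close> share their additive
  fields with the ring they come from, but they are different records; the group structure is
  transported by comparing fields.\<close>

lemma (in abelian_group) abelian_group_fields:
  assumes "carrier M = carrier G" "add M = add G" "ring.zero M = ring.zero G"
  shows "abelian_group M"
  using abelian_groupE[OF abelian_group_axioms]
  by (intro abelian_groupI) (auto simp: assms)

section \<open>The ring as a left and as a right module over a subring, and the opposite
  ring\<close>

lemma lmod_simps [simp]:
  "carrier (lmod h C) = carrier C" "ring.zero (lmod h C) = ring.zero C"
  "add (lmod h C) = add C" "smult (lmod h C) b c = h b \<otimes>\<^bsub>C\<^esub> c"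
  by (simp_all add: lmod_def)

lemma rmod_simps [simp]:
  "carrier (rmod h C) = carrier C" "ring.zero (rmod h C) = ring.zero C"
  "add (rmod h C) = add C" "smult (rmod h C) b c = c \<otimes>\<^bsub>C\<^esub> h b"
  by (simp_all add: rmod_def)

lemma opp_simps [simp]:
  "carrier (opp R) = carrier R" "ring.zero (opp R) = ring.zero R" "monoid.one (opp R) = monoid.one R"
  "add (opp R) = add R" "a \<otimes>\<^bsub>opp R\<^esub> b = b \<otimes>\<^bsub>R\<^esub> a"
  by (simp_all add: opp_def)

lemma finsum_fields:
  assumes "carrier M = carrier N" "add M = add N" "ring.zero M = ring.zero N"
  shows "finsum M = finsum N"
  by (intro ext) (simp add: finsum_def finprod_def assms comp_def)

lemma finsum_lmod [simp]: "finsum (lmod h C) = finsum C"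
  by (rule finsum_fields) auto

lemma finsum_opp [simp]: "finsum (opp C) = finsum C"
  by (rule finsum_fields) auto

lemma (in ring) ring_opp: "ring (opp R)"
  by (intro ringI abelian_group_fields[of "opp R"] monoidI) (auto simp: m_assoc l_distr r_distr)

lemma opp_carrier: "opp (R\<lparr>carrier := S\<rparr>) = (opp R)\<lparr>carrier := S\<rparr>"
  by (simp add: opp_def)

lemma subring_opp: "subring S R \<Longrightarrow> subring S (opp R)"
  by (auto simp: subring_def submonoid_def opp_def)

lemma (in ring) lmod_left_module:
  assumes "subring S R"
  shows "left_module (R\<lparr>carrier := S\<rparr>) (lmod (\<lambda>x. x) R)"
  using subringE(1)[OF assms]
  by (intro left_moduleI subring_is_ring assms abelian_group_fields[of "lmod _ R"])
     (auto simp: subset_iff l_distr r_distr m_assoc)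

lemma (in ring) rmod_right_module:
  assumes "subring S R"
  shows "right_module (R\<lparr>carrier := S\<rparr>) (rmod (\<lambda>x. x) R)"
  using subringE(1)[OF assms] subring_is_ring[OF assms]
  by (intro left_moduleI ring.ring_opp assms abelian_group_fields[of "rmod _ R"])
     (auto simp: subset_iff l_distr r_distr m_assoc)

lemma (in ring) lmod_self: "left_module R (lmod (\<lambda>x. x) R)"
  using lmod_left_module[OF carrier_is_subring] by simp

section \<open>Baer's criterion\<close>

text \<open>An extension of \<open>f\<close> to all of \<open>R\<close> is encoded by its value
  \<open>x\<close> at one. Only ideals of \<open>R\<close> occur, so no type of test modules is
  fixed here.\<close>

definition baer :: "('r, 's) ring_scheme \<Rightarrow> ('r, 'm, 't) module_scheme \<Rightarrow> bool" where
  "baer R M \<longleftrightarrow> (\<forall>I f. submodule I R (lmod (\<lambda>x. x) R) \<and> f \<in> mod_hom R ((lmod (\<lambda>x. x) R)\<lparr>carrier := I\<rparr>) M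
     \<longrightarrow> (\<exists>x\<in>carrier M. \<forall>u\<in>I. f u = u \<odot>\<^bsub>M\<^esub> x))"

lemma baerD:
  assumes "baer R M" "left_module R (lmod (\<lambda>x. x) R)" "I \<subseteq> carrier R" "\<zero>\<^bsub>R\<^esub> \<in> I"
    "\<And>a b. \<lbrakk>a \<in> I; b \<in> I\<rbrakk> \<Longrightarrow> a \<oplus>\<^bsub>R\<^esub> b \<in> I" "\<And>a b. \<lbrakk>a \<in> carrier R; b \<in> I\<rbrakk> \<Longrightarrow> a \<otimes>\<^bsub>R\<^esub> b \<in> I"
    "\<And>a. a \<in> I \<Longrightarrow> f a \<in> carrier M"
    "\<And>a b. \<lbrakk>a \<in> I; b \<in> I\<rbrakk> \<Longrightarrow> f (a \<oplus>\<^bsub>R\<^esub> b) = f a \<oplus>\<^bsub>M\<^esub> f b"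
    "\<And>a b. \<lbrakk>a \<in> carrier R; b \<in> I\<rbrakk> \<Longrightarrow> f (a \<otimes>\<^bsub>R\<^esub> b) = a \<odot>\<^bsub>M\<^esub> f b"
  shows "\<exists>x\<in>carrier M. \<forall>u\<in>I. f u = u \<odot>\<^bsub>M\<^esub> x"
proof -
  have "submodule I R (lmod (\<lambda>x. x) R)"
    by (rule left_module.submoduleI') (use assms in auto)
  moreover have "f \<in> mod_hom R ((lmod (\<lambda>x. x) R)\<lparr>carrier := I\<rparr>) M"
    by (rule mod_homI) (use assms in \<open>auto simp: lmod_def\<close>)
  ultimately show ?thesis
    using assms(1) by (auto simp: baer_def)
qed

text \<open>Zorn's lemma is applied to the graphs of partial extensions.\<close>

lemma baer_extension:
  assumes "left_module R Y" "left_module R M" "baer R M" "submodule X R Y"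
    and f: "f \<in> mod_hom R (Y\<lparr>carrier := X\<rparr>) M"
  shows "\<exists>g\<in>mod_hom R Y M. \<forall>x\<in>X. g x = f x"
proof -
  interpret Y: left_module R Y by fact
  interpret M: left_module R M by fact
  have L: "left_module R (lmod (\<lambda>x. x) R)" by (rule Y.R.lmod_self)
  note X = Y.submoduleD[OF assms(4)]
  note f = mod_homD[OF f, simplified]
  \<comment> \<open>Graphs of partial extensions of \<open>f\<close>. A graph is closed under
    differences, so it is single-valued as soon as only zero lies over zero.\<close>
  define \<A> where "\<A> = {G. G \<subseteq> carrier Y \<times> carrier M \<and> (\<forall>x\<in>X. (x, f x) \<in> G) \<and>
      (\<forall>y m y' m'. (y, m) \<in> G \<longrightarrow> (y', m') \<in> G \<longrightarrow> (y \<oplus>\<^bsub>Y\<^esub> y', m \<oplus>\<^bsub>M\<^esub> m') \<in> G) \<and>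
      (\<forall>r\<in>carrier R. \<forall>y m. (y, m) \<in> G \<longrightarrow> (r \<odot>\<^bsub>Y\<^esub> y, r \<odot>\<^bsub>M\<^esub> m) \<in> G) \<and>
      (\<forall>m. (\<zero>\<^bsub>Y\<^esub>, m) \<in> G \<longrightarrow> m = \<zero>\<^bsub>M\<^esub>)}"
  have f0: "f \<zero>\<^bsub>Y\<^esub> = \<zero>\<^bsub>M\<^esub>"
    using mod_hom_zero[OF Y.submodule_left_module[OF assms(4)] assms(2,5)] by simp
  have "\<exists>G\<in>\<A>. \<forall>G'\<in>\<A>. G \<subseteq> G' \<longrightarrow> G' = G"
  proof (rule subset_Zorn_nonempty)
    have "(\<lambda>x. (x, f x)) ` X \<in> \<A>"
      using X f f0 unfolding \<A>_def by (auto simp: image_iff)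
    then show "\<A> \<noteq> {}" by blast
  next
    fix C assume C: "C \<noteq> {}" "subset.chain \<A> C"
    have sub: "C \<subseteq> \<A>" using C(2) by (auto simp: subset.chain_def)
    have ch: "G \<subseteq> G' \<or> G' \<subseteq> G" if "G \<in> C" "G' \<in> C" for G G'
      using C(2) that by (auto simp: subset.chain_def)
    have *: "(y \<oplus>\<^bsub>Y\<^esub> y', m \<oplus>\<^bsub>M\<^esub> m') \<in> \<Union>C"
      if in_C: "(y, m) \<in> G" "G \<in> C" "(y', m') \<in> G'" "G' \<in> C" for y m y' m' G G'
    proof -
      obtain H where "H \<in> C" "(y, m) \<in> H" "(y', m') \<in> H"
        using ch[OF in_C(2,4)] in_C by blast
      moreover have "H \<in> \<A>" using \<open>H \<in> C\<close> sub by blast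
      ultimately show ?thesis unfolding \<A>_def by blast
    qed
    show "\<Union>C \<in> \<A>"
      unfolding \<A>_def
    proof (intro CollectI conjI)
      show "\<Union> C \<subseteq> carrier Y \<times> carrier M" using sub unfolding \<A>_def by blast
      show "\<forall>x\<in>X. (x, f x) \<in> \<Union> C" using sub C(1) unfolding \<A>_def by blast
      show "\<forall>y m y' m'. (y, m) \<in> \<Union> C \<longrightarrow> (y', m') \<in> \<Union> C \<longrightarrow> (y \<oplus>\<^bsub>Y\<^esub> y', m \<oplus>\<^bsub>M\<^esub> m') \<in> \<Union> C"
        using * by blast
      show "\<forall>r\<in>carrier R. \<forall>y m. (y, m) \<in> \<Union> C \<longrightarrow> (r \<odot>\<^bsub>Y\<^esub> y, r \<odot>\<^bsub>M\<^esub> m) \<in> \<Union> C"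
        using sub unfolding \<A>_def by blast
      show "\<forall>m. (\<zero>\<^bsub>Y\<^esub>, m) \<in> \<Union> C \<longrightarrow> m = \<zero>\<^bsub>M\<^esub>"
        using sub unfolding \<A>_def by blast
    qed
  qed
  then obtain G where "G \<in> \<A>" and max: "\<And>G'. G' \<in> \<A> \<Longrightarrow> G \<subseteq> G' \<Longrightarrow> G' = G" by blast
  then have G: "\<And>y m. (y, m) \<in> G \<Longrightarrow> y \<in> carrier Y \<and> m \<in> carrier M" "\<And>x. x \<in> X \<Longrightarrow> (x, f x) \<in> G"
    "\<And>y m y' m'. (y, m) \<in> G \<Longrightarrow> (y', m') \<in> G \<Longrightarrow> (y \<oplus>\<^bsub>Y\<^esub> y', m \<oplus>\<^bsub>M\<^esub> m') \<in> G"
    "\<And>r y m. r \<in> carrier R \<Longrightarrow> (y, m) \<in> G \<Longrightarrow> (r \<odot>\<^bsub>Y\<^esub> y, r \<odot>\<^bsub>M\<^esub> m) \<in> G"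
    "\<And>m. (\<zero>\<^bsub>Y\<^esub>, m) \<in> G \<Longrightarrow> m = \<zero>\<^bsub>M\<^esub>"
    unfolding \<A>_def by blast+
  have Gzero: "(\<zero>\<^bsub>Y\<^esub>, \<zero>\<^bsub>M\<^esub>) \<in> G" using G(2)[of "\<zero>\<^bsub>Y\<^esub>"] X(2) f0 by simp
  have Gneg: "(\<ominus>\<^bsub>Y\<^esub> y, \<ominus>\<^bsub>M\<^esub> m) \<in> G" if "(y, m) \<in> G" for y m
    using G(4)[of "\<ominus>\<^bsub>R\<^esub> \<one>\<^bsub>R\<^esub>", OF _ that] G(1)[OF that]
    by (simp add: Y.smult_minus_left M.smult_minus_left Y.smult_one M.smult_one)
  have sv: "m = m'" if "(y, m) \<in> G" "(y, m') \<in> G" for y m m'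
  proof -
    have "(y \<oplus>\<^bsub>Y\<^esub> \<ominus>\<^bsub>Y\<^esub> y, m \<oplus>\<^bsub>M\<^esub> \<ominus>\<^bsub>M\<^esub> m') \<in> G"
      using G(3)[OF that(1) Gneg[OF that(2)]] .
    then have "m \<oplus>\<^bsub>M\<^esub> \<ominus>\<^bsub>M\<^esub> m' = \<zero>\<^bsub>M\<^esub>"
      using G(1)[OF that(1)] by (intro G(5)) (simp add: Y.M.r_neg)
    then show ?thesis
      using G(1)[OF that(1)] G(1)[OF that(2)] by (metis M.M.minus_equality M.M.minus_minus M.M.a_inv_closed)
  qed
  have total: "\<exists>m. (y, m) \<in> G" if y: "y \<in> carrier Y" for y
  proof (rule ccontr)
    assume no: "\<not> ?thesis"
    \<comment> \<open>\<open>I\<close> is the left ideal of scalars that carry \<open>y\<close> into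
      the domain of \<open>G\<close>, and \<open>h\<close> is the value of \<open>G\<close> there.
      Baer's condition turns \<open>h\<close> into an element \<open>x\<close> that can serve as the
      value at \<open>y\<close>.\<close>
    define I where "I = {r \<in> carrier R. \<exists>m. (r \<odot>\<^bsub>Y\<^esub> y, m) \<in> G}"
    define h where "h r = (SOME m. (r \<odot>\<^bsub>Y\<^esub> y, m) \<in> G)" for r
    have h: "(r \<odot>\<^bsub>Y\<^esub> y, h r) \<in> G" if "r \<in> I" for r
      using that unfolding I_def h_def by (auto intro: someI)
    have IG: "r \<in> I" "h r = m" if "r \<in> carrier R" "(r \<odot>\<^bsub>Y\<^esub> y, m) \<in> G" for r m
    proof -
      show "r \<in> I" using that I_def by auto
      from sv[OF h[OF this] that(2)] show "h r = m" .
    qed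
    have I: "r \<in> carrier R" if "r \<in> I" for r using that by (simp add: I_def)
    have addG: "((a \<oplus>\<^bsub>R\<^esub> b) \<odot>\<^bsub>Y\<^esub> y, h a \<oplus>\<^bsub>M\<^esub> h b) \<in> G" if "a \<in> I" "b \<in> I" for a b
      using G(3)[OF h[OF that(1)] h[OF that(2)]] that by (simp add: Y.smult_l_distr y I)
    have multG: "((a \<otimes>\<^bsub>R\<^esub> b) \<odot>\<^bsub>Y\<^esub> y, a \<odot>\<^bsub>M\<^esub> h b) \<in> G" if "a \<in> carrier R" "b \<in> I" for a b
      using G(4)[OF that(1) h[OF that(2)]] that by (simp add: Y.smult_assoc y I)
    have "\<exists>x\<in>carrier M. \<forall>u\<in>I. h u = u \<odot>\<^bsub>M\<^esub> x"
    proof (rule baerD[OF assms(3) L])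
      show "I \<subseteq> carrier R" using I by auto
      show "\<zero>\<^bsub>R\<^esub> \<in> I" using Gzero by (intro IG) (auto simp: Y.smult_zero_left y)
      show "a \<oplus>\<^bsub>R\<^esub> b \<in> I" if "a \<in> I" "b \<in> I" for a b using IG(1)[OF _ addG[OF that]] that I by auto
      show "h (a \<oplus>\<^bsub>R\<^esub> b) = h a \<oplus>\<^bsub>M\<^esub> h b" if "a \<in> I" "b \<in> I" for a b using IG(2)[OF _ addG[OF that]] that I by auto
      show "a \<otimes>\<^bsub>R\<^esub> b \<in> I" if "a \<in> carrier R" "b \<in> I" for a b using IG(1)[OF _ multG[OF that]] that I by auto
      show "h (a \<otimes>\<^bsub>R\<^esub> b) = a \<odot>\<^bsub>M\<^esub> h b" if "a \<in> carrier R" "b \<in> I" for a b using IG(2)[OF _ multG[OF that]] that I by auto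
      show "h a \<in> carrier M" if "a \<in> I" for a using G(1)[OF h[OF that]] by auto
    qed
    then obtain x where x: "x \<in> carrier M" "\<And>u. u \<in> I \<Longrightarrow> h u = u \<odot>\<^bsub>M\<^esub> x" by blast
    \<comment> \<open>The graph extended to the domain of \<open>G\<close> plus \<open>R y\<close>,
      with \<open>y\<close> sent to \<open>x\<close>.\<close>
    define G' where "G' = {(d \<oplus>\<^bsub>Y\<^esub> r \<odot>\<^bsub>Y\<^esub> y, m \<oplus>\<^bsub>M\<^esub> r \<odot>\<^bsub>M\<^esub> x) | d m r. (d, m) \<in> G \<and> r \<in> carrier R}"
    have G'I: "(d \<oplus>\<^bsub>Y\<^esub> r \<odot>\<^bsub>Y\<^esub> y, m \<oplus>\<^bsub>M\<^esub> r \<odot>\<^bsub>M\<^esub> x) \<in> G'" if "(d, m) \<in> G" "r \<in> carrier R" for d m r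
      using that unfolding G'_def by blast
    have GG': "G \<subseteq> G'"
    proof safe
      fix d m assume d: "(d, m) \<in> G"
      show "(d, m) \<in> G'"
        using G'I[OF d Y.R.zero_closed] G(1)[OF d] y x(1) by (simp add: Y.smult_zero_left M.smult_zero_left)
    qed
    have "G' \<in> \<A>"
      unfolding \<A>_def
    proof (intro CollectI conjI allI impI ballI)
      show "G' \<subseteq> carrier Y \<times> carrier M"
        using G(1) y x(1) unfolding G'_def by (auto simp: Y.smult_closed M.smult_closed)
      show "(x, f x) \<in> G'" if "x \<in> X" for x using GG' G(2)[OF that] by blast
    next
      fix z m z' m' assume "(z, m) \<in> G'" "(z', m') \<in> G'"
      then obtain d n r d' n' r' where e: "z = d \<oplus>\<^bsub>Y\<^esub> r \<odot>\<^bsub>Y\<^esub> y" "m = n \<oplus>\<^bsub>M\<^esub> r \<odot>\<^bsub>M\<^esub> x" "(d, n) \<in> G" "r \<in> carrier R"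
        "z' = d' \<oplus>\<^bsub>Y\<^esub> r' \<odot>\<^bsub>Y\<^esub> y" "m' = n' \<oplus>\<^bsub>M\<^esub> r' \<odot>\<^bsub>M\<^esub> x" "(d', n') \<in> G" "r' \<in> carrier R"
        unfolding G'_def by blast
      have "(z \<oplus>\<^bsub>Y\<^esub> z', m \<oplus>\<^bsub>M\<^esub> m') = ((d \<oplus>\<^bsub>Y\<^esub> d') \<oplus>\<^bsub>Y\<^esub> (r \<oplus>\<^bsub>R\<^esub> r') \<odot>\<^bsub>Y\<^esub> y, (n \<oplus>\<^bsub>M\<^esub> n') \<oplus>\<^bsub>M\<^esub> (r \<oplus>\<^bsub>R\<^esub> r') \<odot>\<^bsub>M\<^esub> x)"
        using e y x(1) G(1)[OF e(3)] G(1)[OF e(7)]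
        by (simp add: Y.smult_l_distr M.smult_l_distr Y.smult_closed M.smult_closed Y.M.a_ac M.M.a_ac)
      then show "(z \<oplus>\<^bsub>Y\<^esub> z', m \<oplus>\<^bsub>M\<^esub> m') \<in> G'"
        using G'I[OF G(3)[OF e(3,7)], of "r \<oplus>\<^bsub>R\<^esub> r'"] e by simp
    next
      fix t z m assume t: "t \<in> carrier R" and "(z, m) \<in> G'"
      then obtain d n r where e: "z = d \<oplus>\<^bsub>Y\<^esub> r \<odot>\<^bsub>Y\<^esub> y" "m = n \<oplus>\<^bsub>M\<^esub> r \<odot>\<^bsub>M\<^esub> x" "(d, n) \<in> G" "r \<in> carrier R"
        unfolding G'_def by blast
      have "(t \<odot>\<^bsub>Y\<^esub> z, t \<odot>\<^bsub>M\<^esub> m) = (t \<odot>\<^bsub>Y\<^esub> d \<oplus>\<^bsub>Y\<^esub> (t \<otimes>\<^bsub>R\<^esub> r) \<odot>\<^bsub>Y\<^esub> y, t \<odot>\<^bsub>M\<^esub> n \<oplus>\<^bsub>M\<^esub> (t \<otimes>\<^bsub>R\<^esub> r) \<odot>\<^bsub>M\<^esub> x)"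
        using e y x(1) t G(1)[OF e(3)]
        by (simp add: Y.smult_r_distr M.smult_r_distr Y.smult_closed M.smult_closed Y.smult_assoc M.smult_assoc)
      then show "(t \<odot>\<^bsub>Y\<^esub> z, t \<odot>\<^bsub>M\<^esub> m) \<in> G'"
        using G'I[OF G(4)[OF t e(3)], of "t \<otimes>\<^bsub>R\<^esub> r"] e t by simp
    next
      fix m assume "(\<zero>\<^bsub>Y\<^esub>, m) \<in> G'"
      then obtain d n r where e: "\<zero>\<^bsub>Y\<^esub> = d \<oplus>\<^bsub>Y\<^esub> r \<odot>\<^bsub>Y\<^esub> y" "m = n \<oplus>\<^bsub>M\<^esub> r \<odot>\<^bsub>M\<^esub> x" "(d, n) \<in> G" "r \<in> carrier R"
        unfolding G'_def by blast
      \<comment> \<open>If d + r y = 0, then r y lies in the domain of \<open>G\<close>, where its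
        value is r x by the choice of \<open>x\<close> and -n by linearity. So only zero lies over
        zero in \<open>G'\<close> too.\<close>
      have ry: "r \<odot>\<^bsub>Y\<^esub> y = \<ominus>\<^bsub>Y\<^esub> d"
        using e y G(1)[OF e(3)] by (metis Y.M.a_comm Y.M.minus_equality Y.smult_closed)
      then have "(r \<odot>\<^bsub>Y\<^esub> y, \<ominus>\<^bsub>M\<^esub> n) \<in> G" using Gneg[OF e(3)] by simp
      note IG[OF e(4) this]
      then have "r \<odot>\<^bsub>M\<^esub> x = \<ominus>\<^bsub>M\<^esub> n" using x(2) by simp
      then show "m = \<zero>\<^bsub>M\<^esub>" using e(2) G(1)[OF e(3)] by (simp add: M.M.r_neg)
    qed
    from max[OF this GG'] have "G' = G" .
    moreover have "(y, x) \<in> G'"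
      using G'I[OF Gzero Y.R.one_closed] y x(1) by (simp add: Y.smult_one M.smult_one)
    ultimately show False using no by blast
  qed
  define g where "g y = (SOME m. (y, m) \<in> G)" for y
  have g: "(y, g y) \<in> G" if "y \<in> carrier Y" for y
    unfolding g_def using someI_ex[OF total[OF that]] .
  have "g \<in> mod_hom R Y M"
  proof (rule mod_homI)
    fix x assume x: "x \<in> carrier Y"
    then show "g x \<in> carrier M" using G(1)[OF g] by blast
    fix y assume y: "y \<in> carrier Y"
    show "g (x \<oplus>\<^bsub>Y\<^esub> y) = g x \<oplus>\<^bsub>M\<^esub> g y" using sv[OF g G(3)[OF g[OF x] g[OF y]]] x y by simp
  next
    fix r x assume r: "r \<in> carrier R" and x: "x \<in> carrier Y"
    show "g (r \<odot>\<^bsub>Y\<^esub> x) = r \<odot>\<^bsub>M\<^esub> g x" using sv[OF g G(4)[OF r g[OF x]]] x r by (simp add: Y.smult_closed)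
  qed
  moreover have "g x = f x" if "x \<in> X" for x
    using sv[OF g G(2)] that X(1) by blast
  ultimately show ?thesis by blast
qed

lemma mod_hom_image_submodule:
  assumes "left_module R X" "left_module R Y" "i \<in> mod_hom R X Y"
  shows "submodule (i ` carrier X) R Y"
proof -
  interpret X: left_module R X by fact
  interpret Y: left_module R Y by fact
  note i = mod_homD[OF assms(3)]
  show ?thesis
  proof (rule Y.submoduleI')
    show "\<zero>\<^bsub>Y\<^esub> \<in> i ` carrier X"
      using mod_hom_zero[OF assms] by (metis X.M.zero_closed imageI)
    fix a b assume "a \<in> i ` carrier X" "b \<in> i ` carrier X"
    then show "a \<oplus>\<^bsub>Y\<^esub> b \<in> i ` carrier X" by (auto simp flip: i(2))
  qed (auto simp: i(1) X.smult_closed simp flip: i(3))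
qed

text \<open>The inverse of \<open>i\<close> on its image reduces an arbitrary injection to the
  inclusion of a submodule.\<close>

lemma baer_extension_inj:
  assumes X: "left_module R X" and Y: "left_module R Y" and M: "left_module R M" "baer R M"
    and i: "i \<in> mod_hom R X Y" "inj_on i (carrier X)" and f: "f \<in> mod_hom R X M"
  shows "\<exists>g\<in>mod_hom R Y M. \<forall>x\<in>carrier X. g (i x) = f x"
proof -
  interpret X: left_module R X by fact
  define j where "j = the_inv_into (carrier X) i"
  have j: "j (i x) = x" if "x \<in> carrier X" for x
    using the_inv_into_f_f[OF i(2) that] by (simp add: j_def)
  note i' = mod_homD[OF i(1)] and f' = mod_homD[OF f]
  have "(\<lambda>y. f (j y)) \<in> mod_hom R (Y\<lparr>carrier := i ` carrier X\<rparr>) M"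
    by (rule mod_homI) (auto simp: j f' X.smult_closed simp flip: i'(2,3))
  from baer_extension[OF Y M mod_hom_image_submodule[OF X Y i(1)] this]
  show ?thesis using j by auto
qed

lemma baer_injective:
  assumes "left_module R M" "baer R M"
  shows "injective_module TX TY R M"
  using baer_extension_inj[OF _ _ assms] assms(1) by (auto simp: injective_module_def)

section \<open>Algebras with dual bases over a central field\<close>

text \<open>The ground field is a central subring \<open>F\<close> of \<open>R\<close>, and \<open>\<theta>\<close> takes its values there; in this way an
  \<open>R\<close>-module is an \<open>F\<close>-module without any change of the module record.\<close>

locale frobenius_ring = R?: ring R for R :: "('r, 's) ring_scheme" (structure) +
  fixes F :: "'r set" and \<theta> :: "'r \<Rightarrow> 'r" and n :: nat and r s :: "nat \<Rightarrow> 'r"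
  assumes F_subring: "subring F R"
    and F_central: "\<lbrakk>c \<in> F; x \<in> carrier R\<rbrakk> \<Longrightarrow> c \<otimes> x = x \<otimes> c"
    and F_inv: "\<lbrakk>c \<in> F; c \<noteq> \<zero>\<rbrakk> \<Longrightarrow> \<exists>d\<in>F. d \<otimes> c = \<one>"
    and form_closed: "x \<in> carrier R \<Longrightarrow> \<theta> x \<in> F"
    and form_add: "\<lbrakk>x \<in> carrier R; y \<in> carrier R\<rbrakk> \<Longrightarrow> \<theta> (x \<oplus> y) = \<theta> x \<oplus> \<theta> y"
    and form_smult: "\<lbrakk>c \<in> F; x \<in> carrier R\<rbrakk> \<Longrightarrow> \<theta> (c \<otimes> x) = c \<otimes> \<theta> x"
    and r_closed: "i < n \<Longrightarrow> r i \<in> carrier R"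
    and s_closed: "i < n \<Longrightarrow> s i \<in> carrier R"
    and dual_left: "x \<in> carrier R \<Longrightarrow> (\<Oplus>i\<in>{..<n}. \<theta> (x \<otimes> r i) \<otimes> s i) = x"
    and dual_right: "x \<in> carrier R \<Longrightarrow> (\<Oplus>i\<in>{..<n}. r i \<otimes> \<theta> (s i \<otimes> x)) = x"
begin

abbreviation Fr where "Fr \<equiv> R\<lparr>carrier := F\<rparr>"

lemma F_sub: "c \<in> F \<Longrightarrow> c \<in> carrier R"
  using subringE(1)[OF F_subring] by auto

lemma form_closed': "x \<in> carrier R \<Longrightarrow> \<theta> x \<in> carrier R"
  using form_closed F_sub by auto

lemma lmod_F: "left_module Fr (lmod (\<lambda>x. x) R)"
  by (rule lmod_left_module[OF F_subring])

lemma lmod_Fr: "left_module Fr (lmod (\<lambda>x. x) Fr)"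
  by (rule ring.lmod_self[OF subring_is_ring[OF F_subring]])

text \<open>Reversing products turns the two expansions into each other with \<open>r\<close> and
  \<open>s\<close> exchanged, and centrality of \<open>F\<close> keeps \<theta> linear. Every
  left-handed statement thereby yields a right-handed one.\<close>

lemma frobenius_ring_opp: "frobenius_ring (opp R) F \<theta> n s r"
proof -
  interpret O: ring "opp R" by (rule ring_opp)
  show ?thesis
  proof (intro frobenius_ring.intro frobenius_ring_axioms.intro ring_opp subring_opp F_subring)
    fix x assume x: "x \<in> carrier (opp R)"
    have "(\<Oplus>i\<in>{..<n}. r i \<otimes> \<theta> (s i \<otimes> x)) = (\<Oplus>i\<in>{..<n}. \<theta> (s i \<otimes> x) \<otimes> r i)"
      using x r_closed s_closed form_closed form_closed' F_central[of "\<theta> _" "r _"]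
      by (intro finsum_cong') auto
    from x show "(\<Oplus>\<^bsub>opp R\<^esub>i\<in>{..<n}. \<theta> (x \<otimes>\<^bsub>opp R\<^esub> s i) \<otimes>\<^bsub>opp R\<^esub> r i) = x"
      using dual_right[of x] by simp
    have "(\<Oplus>i\<in>{..<n}. \<theta> (x \<otimes> r i) \<otimes> s i) = (\<Oplus>i\<in>{..<n}. s i \<otimes> \<theta> (x \<otimes> r i))"
      using x r_closed s_closed form_closed form_closed' F_central[of "\<theta> _" "s _"]
      by (intro finsum_cong') auto
    then show "(\<Oplus>\<^bsub>opp R\<^esub>i\<in>{..<n}. s i \<otimes>\<^bsub>opp R\<^esub> \<theta> (r i \<otimes>\<^bsub>opp R\<^esub> x)) = x"
      using dual_left[of x] x by simp
    fix c assume c: "c \<in> F"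
    show "c \<otimes>\<^bsub>opp R\<^esub> x = x \<otimes>\<^bsub>opp R\<^esub> c" using F_central[OF c] x by simp
    show "\<theta> (c \<otimes>\<^bsub>opp R\<^esub> x) = c \<otimes>\<^bsub>opp R\<^esub> \<theta> x"
      using F_central[OF c] c x form_smult[OF c] form_closed' by simp
  next
    fix c assume "c \<in> F" "c \<noteq> \<zero>\<^bsub>opp R\<^esub>"
    then show "\<exists>d\<in>F. d \<otimes>\<^bsub>opp R\<^esub> c = \<one>\<^bsub>opp R\<^esub>"
      using F_inv[of c] F_central[of c] F_sub by auto
  qed (use form_closed form_add r_closed s_closed in auto)
qed

text \<open>The element \<open>\<Sum>\<^sub>i r\<^sub>i \<otimes> s\<^sub>i\<close> commutes with every \<open>t\<close>.\<close>

lemma casimir: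
  assumes G: "comm_group G"
    and b: "\<And>u v. \<lbrakk>u \<in> carrier R; v \<in> carrier R\<rbrakk> \<Longrightarrow> b u v \<in> carrier G"
    and bl: "\<And>u u' v. \<lbrakk>u \<in> carrier R; u' \<in> carrier R; v \<in> carrier R\<rbrakk> \<Longrightarrow> b (u \<oplus> u') v = b u v \<otimes>\<^bsub>G\<^esub> b u' v"
    and br: "\<And>u v v'. \<lbrakk>u \<in> carrier R; v \<in> carrier R; v' \<in> carrier R\<rbrakk> \<Longrightarrow> b u (v \<oplus> v') = b u v \<otimes>\<^bsub>G\<^esub> b u v'"
    and bF: "\<And>u v c. \<lbrakk>u \<in> carrier R; v \<in> carrier R; c \<in> F\<rbrakk> \<Longrightarrow> b (u \<otimes> c) v = b u (c \<otimes> v)"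
    and t: "t \<in> carrier R"
  shows "(\<Otimes>\<^bsub>G\<^esub>i\<in>{..<n}. b (t \<otimes> r i) (s i)) = (\<Otimes>\<^bsub>G\<^esub>i\<in>{..<n}. b (r i) (s i \<otimes> t))"
proof -
  interpret G: comm_group G by fact
  note [simp] = r_closed s_closed form_closed form_closed' t
  \<comment> \<open>Expand t r_i in the r_j by \<open>dual_right\<close>, move the coefficient
    \<theta>(s_j t r_i) from the first argument to the second, exchange the sums, and collect s_j t
    by \<open>dual_left\<close>.\<close>
  have "(\<Otimes>\<^bsub>G\<^esub>i\<in>{..<n}. b (t \<otimes> r i) (s i))
      = (\<Otimes>\<^bsub>G\<^esub>i\<in>{..<n}. \<Otimes>\<^bsub>G\<^esub>j\<in>{..<n}. b (r j \<otimes> \<theta> (s j \<otimes> (t \<otimes> r i))) (s i))"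
  proof (rule G.finprod_cong')
    fix i assume "i \<in> {..<n}"
    then have i: "i < n" by simp
    have "b (t \<otimes> r i) (s i) = b (\<Oplus>j\<in>{..<n}. r j \<otimes> \<theta> (s j \<otimes> (t \<otimes> r i))) (s i)"
      using dual_right[of "t \<otimes> r i"] i by simp
    also have "\<dots> = (\<Otimes>\<^bsub>G\<^esub>j\<in>{..<n}. b (r j \<otimes> \<theta> (s j \<otimes> (t \<otimes> r i))) (s i))"
      unfolding finsum_def
      by (rule hom_finprod[OF a_comm_group G, of "\<lambda>u. b u (s i)"]) (use i b bl in \<open>auto simp: hom_def\<close>)
    finally show "b (t \<otimes> r i) (s i) = \<dots>" .
  qed (use b in \<open>auto intro!: G.finprod_closed\<close>)
  also have "\<dots> = (\<Otimes>\<^bsub>G\<^esub>j\<in>{..<n}. \<Otimes>\<^bsub>G\<^esub>i\<in>{..<n}. b (r j \<otimes> \<theta> (s j \<otimes> (t \<otimes> r i))) (s i))"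
    by (rule G.finprod_swap) (use b in auto)
  also have "\<dots> = (\<Otimes>\<^bsub>G\<^esub>j\<in>{..<n}. b (r j) (s j \<otimes> t))"
  proof (rule G.finprod_cong')
    fix j assume "j \<in> {..<n}"
    then have j: "j < n" by simp
    have "b (r j) (s j \<otimes> t) = b (r j) (\<Oplus>i\<in>{..<n}. \<theta> (s j \<otimes> t \<otimes> r i) \<otimes> s i)"
      using dual_left[of "s j \<otimes> t"] j by simp
    also have "\<dots> = (\<Otimes>\<^bsub>G\<^esub>i\<in>{..<n}. b (r j) (\<theta> (s j \<otimes> t \<otimes> r i) \<otimes> s i))"
      unfolding finsum_def
      by (rule hom_finprod[OF a_comm_group G, of "\<lambda>u. b (r j) u"]) (use j b br in \<open>auto simp: hom_def\<close>)
    also have "\<dots> = (\<Otimes>\<^bsub>G\<^esub>i\<in>{..<n}. b (r j \<otimes> \<theta> (s j \<otimes> (t \<otimes> r i))) (s i))"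
      by (rule G.finprod_cong') (use j b in \<open>auto simp: bF m_assoc\<close>)
    finally show "(\<Otimes>\<^bsub>G\<^esub>i\<in>{..<n}. b (r j \<otimes> \<theta> (s j \<otimes> (t \<otimes> r i))) (s i)) = b (r j) (s j \<otimes> t)" by simp
  qed (use b in auto)
  finally show ?thesis .
qed

text \<open>The relative trace of \<psi>; for a group algebra, with the group elements and their
  inverses as dual bases, it is the averaging of a linear map over the group. Linearity over
  \<open>R\<close> is \<open>casimir\<close> for the map (u, v) to u \<psi>(v m), which is balanced
  over \<open>F\<close> because \<psi> is F-linear.\<close>

lemma trace_hom:
  assumes M: "left_module R M" and X: "left_module R X" and \<psi>: "\<psi> \<in> mod_hom Fr M X"
  shows "(\<lambda>m. \<Oplus>\<^bsub>X\<^esub>i\<in>{..<n}. r i \<odot>\<^bsub>X\<^esub> \<psi> (s i \<odot>\<^bsub>M\<^esub> m)) \<in> mod_hom R M X"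
proof -
  interpret M: left_module R M by fact
  interpret X: left_module R X by fact
  note [simp] = r_closed s_closed form_closed form_closed' M.smult_closed X.smult_closed
  note p = mod_homD[OF \<psi>, simplified]
  show ?thesis
  proof (rule mod_homI)
    fix m assume m: "m \<in> carrier M"
    then show "(\<Oplus>\<^bsub>X\<^esub>i\<in>{..<n}. r i \<odot>\<^bsub>X\<^esub> \<psi> (s i \<odot>\<^bsub>M\<^esub> m)) \<in> carrier X"
      by (auto intro!: X.M.finsum_closed simp: p)
    fix m' assume m': "m' \<in> carrier M"
    show "(\<Oplus>\<^bsub>X\<^esub>i\<in>{..<n}. r i \<odot>\<^bsub>X\<^esub> \<psi> (s i \<odot>\<^bsub>M\<^esub> (m \<oplus>\<^bsub>M\<^esub> m'))) =
      (\<Oplus>\<^bsub>X\<^esub>i\<in>{..<n}. r i \<odot>\<^bsub>X\<^esub> \<psi> (s i \<odot>\<^bsub>M\<^esub> m)) \<oplus>\<^bsub>X\<^esub> (\<Oplus>\<^bsub>X\<^esub>i\<in>{..<n}. r i \<odot>\<^bsub>X\<^esub> \<psi> (s i \<odot>\<^bsub>M\<^esub> m'))"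
      (is "?l = ?a \<oplus>\<^bsub>X\<^esub> ?b")
    proof -
      have "?l = (\<Oplus>\<^bsub>X\<^esub>i\<in>{..<n}. r i \<odot>\<^bsub>X\<^esub> \<psi> (s i \<odot>\<^bsub>M\<^esub> m) \<oplus>\<^bsub>X\<^esub> r i \<odot>\<^bsub>X\<^esub> \<psi> (s i \<odot>\<^bsub>M\<^esub> m'))"
        using m m' by (intro X.M.finsum_cong') (auto simp: p M.smult_r_distr X.smult_r_distr)
      also have "\<dots> = ?a \<oplus>\<^bsub>X\<^esub> ?b"
        using m m' by (intro X.M.finsum_addf) (auto simp: p)
      finally show ?thesis .
    qed
  next
    fix t m assume t: "t \<in> carrier R" and m: "m \<in> carrier M"
    define b where "b u v = u \<odot>\<^bsub>X\<^esub> \<psi> (v \<odot>\<^bsub>M\<^esub> m)" for u v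
    have "(\<Oplus>\<^bsub>X\<^esub>i\<in>{..<n}. r i \<odot>\<^bsub>X\<^esub> \<psi> (s i \<odot>\<^bsub>M\<^esub> (t \<odot>\<^bsub>M\<^esub> m))) = (\<Oplus>\<^bsub>X\<^esub>i\<in>{..<n}. b (r i) (s i \<otimes> t))"
      using t m by (intro X.M.finsum_cong') (auto simp: b_def M.smult_assoc p)
    also have "\<dots> = (\<Oplus>\<^bsub>X\<^esub>i\<in>{..<n}. b (t \<otimes> r i) (s i))"
      unfolding finsum_def
      by (rule casimir[symmetric, OF X.M.a_comm_group])
         (use t m in \<open>auto simp: b_def p M.smult_l_distr X.smult_l_distr X.smult_r_distr X.smult_assoc
            M.smult_assoc F_sub\<close>)
    also have "\<dots> = t \<odot>\<^bsub>X\<^esub> (\<Oplus>\<^bsub>X\<^esub>i\<in>{..<n}. r i \<odot>\<^bsub>X\<^esub> \<psi> (s i \<odot>\<^bsub>M\<^esub> m))"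
      using t m by (subst X.smult_finsum) (auto intro!: X.M.finsum_cong' simp: b_def X.smult_assoc p)
    finally show "(\<Oplus>\<^bsub>X\<^esub>i\<in>{..<n}. r i \<odot>\<^bsub>X\<^esub> \<psi> (s i \<odot>\<^bsub>M\<^esub> (t \<odot>\<^bsub>M\<^esub> m))) = \<dots>" .
  qed
qed

text \<open>A nonzero ideal of a field contains one. So every vector space over \<open>F\<close> is
  injective, and this serves in place of bases and complements.\<close>

lemma baer_F:
  assumes "left_module Fr V"
  shows "baer Fr V"
  unfolding baer_def
proof (intro allI impI, elim conjE)
  interpret V: left_module Fr V by fact
  fix I f assume I: "submodule I Fr (lmod (\<lambda>x. x) Fr)"
    and f: "f \<in> mod_hom Fr ((lmod (\<lambda>x. x) Fr)\<lparr>carrier := I\<rparr>) V"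
  note I' = left_module.submoduleD[OF lmod_Fr I, simplified]
  have m: "left_module Fr ((lmod (\<lambda>x. x) Fr)\<lparr>carrier := I\<rparr>)"
    by (rule left_module.submodule_left_module[OF lmod_Fr I])
  note f' = mod_homD[OF f, simplified]
  show "\<exists>x\<in>carrier V. \<forall>u\<in>I. f u = u \<odot>\<^bsub>V\<^esub> x"
  proof (cases "I = {\<zero>}")
    case True
    then show ?thesis
      using mod_hom_zero[OF m assms f] by (intro bexI[of _ "\<zero>\<^bsub>V\<^esub>"])
        (auto simp: V.smult_zero_right F_subring subringE)
  next
    case False
    then obtain u where "u \<in> I" "u \<noteq> \<zero>" using I'(2) by auto
    then have one: "\<one> \<in> I" using F_inv[of u] I'(1,4) by force
    show ?thesis
    proof (intro bexI ballI)
      show "f \<one> \<in> carrier V" using f'(1) one by auto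
      fix u assume "u \<in> I"
      then have "u \<in> F" using I'(1) by auto
      then show "f u = u \<odot>\<^bsub>V\<^esub> f \<one>" using f'(3)[of u \<one>] one by (simp add: lmod_def F_sub)
    qed
  qed
qed

lemma retraction:
  assumes "left_module Fr Y" "submodule X Fr Y"
  shows "\<exists>\<pi>\<in>mod_hom Fr Y (Y\<lparr>carrier := X\<rparr>). \<forall>x\<in>X. \<pi> x = x"
proof -
  have "(\<lambda>x. x) \<in> mod_hom Fr (Y\<lparr>carrier := X\<rparr>) (Y\<lparr>carrier := X\<rparr>)"
    by (auto simp: mod_hom_def)
  then show ?thesis
    using baer_extension[OF assms(1) _ baer_F assms(2)] left_module.submodule_left_module[OF assms] by blast
qed

text \<open>The form identifies \<open>R\<close> with its F-dual, sending b to \<theta>(_ b), and an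
  R-linear map f into a dual is the same as the linear form \<theta> f. This form extends from
  \<open>I\<close> to \<open>R\<close> by linear algebra.\<close>

lemma self_injective: "baer R (lmod (\<lambda>x. x) R)"
  unfolding baer_def
proof (intro allI impI, elim conjE)
  let ?L = "lmod (\<lambda>x. x) R"
  note [simp] = r_closed s_closed form_closed form_closed'
  fix I f assume I: "submodule I R ?L" and f: "f \<in> mod_hom R (?L\<lparr>carrier := I\<rparr>) ?L"
  note I' = left_module.submoduleD[OF lmod_self I, simplified]
  note f' = mod_homD[OF f, simplified]
  have IF: "submodule I Fr ?L"
    by (rule left_module.submoduleI'[OF lmod_F]) (use I' F_sub in auto)
  have "(\<lambda>u. \<theta> (f u)) \<in> mod_hom Fr (?L\<lparr>carrier := I\<rparr>) (lmod (\<lambda>x. x) Fr)"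
    using f' form_closed form_add form_smult F_sub by (intro mod_homI) (auto simp: lmod_def)
  from baer_extension[OF lmod_F lmod_Fr baer_F[OF lmod_Fr] IF this]
  obtain l where l: "l \<in> mod_hom Fr ?L (lmod (\<lambda>x. x) Fr)" "\<And>u. u \<in> I \<Longrightarrow> l u = \<theta> (f u)" by blast
  note l' = mod_homD[OF l(1), simplified]
  \<comment> \<open>The element that represents \<open>l\<close>: with coefficients l(s_i) at the
    r_i, the expansion of u in the s_i gives l u = \<theta>(u b).\<close>
  define b where "b = (\<Oplus>i\<in>{..<n}. r i \<otimes> l (s i))"
  have b: "b \<in> carrier R" unfolding b_def using l' F_sub by (auto intro!: finsum_closed)
  have form_hom: "\<theta> \<in> hom (add_monoid R) (add_monoid R)"
    using form_closed' form_add by (auto simp: hom_def)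
  have lb: "l u = \<theta> (u \<otimes> b)" if u: "u \<in> carrier R" for u
  proof -
    have "l u = l (\<Oplus>i\<in>{..<n}. \<theta> (u \<otimes> r i) \<otimes> s i)" using dual_left[OF u] by simp
    also have "\<dots> = (\<Oplus>i\<in>{..<n}. l (\<theta> (u \<otimes> r i) \<otimes> s i))"
      by (rule add_hom_finsum) (use l' F_sub u abelian_group_axioms in \<open>auto simp: hom_def\<close>)
    also have "\<dots> = (\<Oplus>i\<in>{..<n}. \<theta> (u \<otimes> (r i \<otimes> l (s i))))"
    proof (rule finsum_cong')
      fix i assume i: "i \<in> {..<n}"
      then have "\<theta> (u \<otimes> (r i \<otimes> l (s i))) = \<theta> (l (s i) \<otimes> (u \<otimes> r i))"
        using u l'(1)[of "s i"] F_central[of "l (s i)" "u \<otimes> r i"] by (simp add: m_assoc F_sub)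
      also have "\<dots> = l (s i) \<otimes> \<theta> (u \<otimes> r i)"
        using i u l'(1)[of "s i"] by (simp add: form_smult)
      also have "\<dots> = \<theta> (u \<otimes> r i) \<otimes> l (s i)"
        using i u l'(1)[of "s i"] by (intro F_central) auto
      finally show "l (\<theta> (u \<otimes> r i) \<otimes> s i) = \<theta> (u \<otimes> (r i \<otimes> l (s i)))" using i u l'(3) by simp
    qed (use u l' F_sub in auto)
    also have "\<dots> = \<theta> (\<Oplus>i\<in>{..<n}. u \<otimes> (r i \<otimes> l (s i)))"
      by (rule add_hom_finsum[symmetric]) (use form_hom abelian_group_axioms u l' F_sub in auto)
    also have "\<dots> = \<theta> (u \<otimes> b)"
      unfolding b_def using left_module.smult_finsum[OF lmod_self u, of "\<lambda>i. r i \<otimes> l (s i)" "{..<n}"] l' F_sub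
      by (simp add: Pi_iff)
    finally show ?thesis .
  qed
  show "\<exists>x\<in>carrier ?L. \<forall>u\<in>I. f u = u \<odot>\<^bsub>?L\<^esub> x"
  proof (intro bexI ballI)
    show "b \<in> carrier ?L" using b by simp
    fix u assume u: "u \<in> I"
    then have uR: "u \<in> carrier R" using I' by auto
    \<comment> \<open>f u is recovered from the numbers \<theta>(s_i f u) = \<theta>(f(s_i u)), and
      these are values of \<open>l\<close> because s_i u stays in the left ideal
      \<open>I\<close>.\<close>
    have "f u = (\<Oplus>i\<in>{..<n}. r i \<otimes> \<theta> (s i \<otimes> f u))" using dual_right[of "f u"] f' u by simp
    also have "\<dots> = (\<Oplus>i\<in>{..<n}. r i \<otimes> \<theta> (s i \<otimes> (u \<otimes> b)))"
    proof (rule finsum_cong')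
      fix i assume i: "i \<in> {..<n}"
      have "s i \<otimes> u \<in> I" using I'(4) i u by auto
      moreover have "f (s i \<otimes> u) = s i \<otimes> f u" using f'(3)[of "s i" u] i u by (simp add: lmod_def)
      ultimately have "\<theta> (s i \<otimes> f u) = \<theta> (s i \<otimes> u \<otimes> b)" using l(2) lb[of "s i \<otimes> u"] i uR by simp
      then show "r i \<otimes> \<theta> (s i \<otimes> f u) = r i \<otimes> \<theta> (s i \<otimes> (u \<otimes> b))" using i uR b by (simp add: m_assoc)
    qed (use uR b in auto)
    also have "\<dots> = u \<otimes> b" using dual_right[of "u \<otimes> b"] uR b by simp
    finally show "f u = u \<odot>\<^bsub>?L\<^esub> b" by simp
  qed
qed

end

section \<open>Tensor products\<close>

locale tensor_pair = X?: left_module "opp R" X + Y?: left_module R Y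
  for R :: "('r, 's) ring_scheme" and X :: "('r, 'x, 't) module_scheme"
    and Y :: "('r, 'y, 'u) module_scheme"
begin

abbreviation "N \<equiv> tensor_rel R X Y"
abbreviation "FXY \<equiv> tensor_free X Y"
abbreviation "T \<equiv> tensor R X Y"
abbreviation "pure \<equiv> pure_tensor R X Y"

text \<open>A name for the generating set inside \<open>tensor_rel\<close>, so that \<open>N\<close>
  can be folded into the subgroup generated by it.\<close>

definition "gens = {frag_of (x \<oplus>\<^bsub>X\<^esub> x', y) - frag_of (x, y) - frag_of (x', y) |x x' y.
         x \<in> carrier X \<and> x' \<in> carrier X \<and> y \<in> carrier Y} \<union>
      {frag_of (x, y \<oplus>\<^bsub>Y\<^esub> y') - frag_of (x, y) - frag_of (x, y') |x y y'.
         x \<in> carrier X \<and> y \<in> carrier Y \<and> y' \<in> carrier Y} \<union>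
      {frag_of (r \<odot>\<^bsub>X\<^esub> x, y) - frag_of (x, r \<odot>\<^bsub>Y\<^esub> y) |r x y.
         r \<in> carrier R \<and> x \<in> carrier X \<and> y \<in> carrier Y}"

lemma diff_closed: "a \<in> carrier FXY \<Longrightarrow> b \<in> carrier FXY \<Longrightarrow> a - b \<in> carrier FXY"
  using keys_diff[of a b] by auto

lemma of_closed: "x \<in> carrier X \<Longrightarrow> y \<in> carrier Y \<Longrightarrow> frag_of (x, y) \<in> carrier FXY"
  by simp

lemma smultX_closed: "r \<in> carrier R \<Longrightarrow> x \<in> carrier X \<Longrightarrow> r \<odot>\<^bsub>X\<^esub> x \<in> carrier X"
  using X.smult_closed by simp

lemma gens_closed: "gens \<subseteq> carrier FXY"
  unfolding gens_def
  by (auto simp del: carrier_free_Abelian_group_iff intro!: diff_closed of_closed smultX_closed Y.smult_closed)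

lemma comm_FXY: "comm_group FXY"
  by (rule abelian_free_Abelian_group)

lemma N_subgroup: "subgroup N FXY"
  unfolding tensor_rel_def gens_def[symmetric]
  by (rule group.generate_is_subgroup[OF group_free_Abelian_group gens_closed])

lemma N_normal: "N \<lhd> FXY"
  using comm_group.normal_iff_subgroup[OF comm_FXY] N_subgroup by blast

lemma comm_T: "comm_group T"
  unfolding tensor_def by (rule comm_group.abelian_FactGroup[OF comm_FXY N_subgroup])

abbreviation "q z \<equiv> N #>\<^bsub>FXY\<^esub> z"

lemma q_hom: "(\<lambda>z. q z) \<in> hom FXY T"
  unfolding tensor_def by (rule normal.r_coset_hom_Mod[OF N_normal])

lemma carrier_T: "carrier T = (\<lambda>z. q z) ` carrier FXY"
  unfolding tensor_def by (rule carrier_FactGroup)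

lemma q_group_hom: "group_hom FXY T (\<lambda>z. q z)"
  using q_hom comm_T by (simp add: group_hom_def group_hom_axioms_def comm_group_def)

lemma q_N: "z \<in> N \<Longrightarrow> q z = \<one>\<^bsub>T\<^esub>"
  using group.coset_join2[OF group_free_Abelian_group subgroup.mem_carrier[OF N_subgroup] N_subgroup]
  by (simp add: tensor_def)

lemma q_eq:
  assumes "a \<in> carrier FXY" "b \<in> carrier FXY" "a - b \<in> gens"
  shows "q a = q b"
proof -
  interpret group_hom FXY T "\<lambda>z. q z" by (rule q_group_hom)
  have N: "a - b \<in> N"
    unfolding tensor_rel_def gens_def[symmetric] by (rule generate.incl) fact
  then have ab: "a - b \<in> carrier FXY" by (rule subgroup.mem_carrier[OF N_subgroup])
  have "q ((a - b) \<otimes>\<^bsub>FXY\<^esub> b) = q (a - b) \<otimes>\<^bsub>T\<^esub> q b"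
    by (rule hom_mult) (rule ab assms)+
  then show ?thesis using q_N[OF N] assms(2) hom_closed[OF assms(2)] by simp
qed

lemma pure_closed: "x \<in> carrier X \<Longrightarrow> y \<in> carrier Y \<Longrightarrow> pure x y \<in> carrier T"
  unfolding pure_tensor_def using hom_in_carrier[OF q_hom] of_closed by blast

lemma pure_add:
  assumes "a \<in> carrier FXY" "b \<in> carrier FXY" "c \<in> carrier FXY" "a - b - c \<in> gens"
  shows "q a = q b \<otimes>\<^bsub>T\<^esub> q c"
proof -
  have "b + c \<in> carrier FXY" using assms(2,3) keys_add[of b c] by auto
  then have "q a = q (b \<otimes>\<^bsub>FXY\<^esub> c)"
    using assms(4) by (intro q_eq assms) (auto simp: algebra_simps)
  also have "\<dots> = q b \<otimes>\<^bsub>T\<^esub> q c"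
    using assms by (intro hom_mult[OF q_hom])
  finally show ?thesis .
qed

lemma pure_add_left:
  assumes "x \<in> carrier X" "x' \<in> carrier X" "y \<in> carrier Y"
  shows "pure (x \<oplus>\<^bsub>X\<^esub> x') y = pure x y \<otimes>\<^bsub>T\<^esub> pure x' y"
  unfolding pure_tensor_def
  by (rule pure_add) (use assms in \<open>auto simp: gens_def\<close>)

lemma pure_add_right:
  assumes "x \<in> carrier X" "y \<in> carrier Y" "y' \<in> carrier Y"
  shows "pure x (y \<oplus>\<^bsub>Y\<^esub> y') = pure x y \<otimes>\<^bsub>T\<^esub> pure x y'"
  unfolding pure_tensor_def
  by (rule pure_add) (use assms in \<open>auto simp: gens_def\<close>)

lemma pure_balanced:
  assumes "r \<in> carrier R" "x \<in> carrier X" "y \<in> carrier Y"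
  shows "pure (r \<odot>\<^bsub>X\<^esub> x) y = pure x (r \<odot>\<^bsub>Y\<^esub> y)"
  unfolding pure_tensor_def
  by (rule q_eq)
     (use assms in \<open>auto simp: gens_def smultX_closed Y.smult_closed\<close>)

lemma pure_hom_left: "y \<in> carrier Y \<Longrightarrow> (\<lambda>x. pure x y) \<in> hom (add_monoid X) T"
  by (auto simp: hom_def pure_closed pure_add_left)

lemma pure_hom_right: "x \<in> carrier X \<Longrightarrow> (\<lambda>y. pure x y) \<in> hom (add_monoid Y) T"
  by (auto simp: hom_def pure_closed pure_add_right)

lemma pure_zero_right: "x \<in> carrier X \<Longrightarrow> pure x \<zero>\<^bsub>Y\<^esub> = \<one>\<^bsub>T\<^esub>"
  using hom_one[OF pure_hom_right] Y.M.a_group comm_T by (simp add: comm_group_def)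

lemma pure_minus: 
  assumes "x \<in> carrier X" "y \<in> carrier Y"
  shows "pure (\<ominus>\<^bsub>X\<^esub> x) y = inv\<^bsub>T\<^esub> (pure x y)"
proof -
  interpret group_hom "add_monoid X" T "\<lambda>x. pure x y"
    using assms comm_T X.M.a_group
    by (simp add: group_hom_def group_hom_axioms_def pure_hom_left comm_group_def)
  show ?thesis using hom_inv[of x] assms(1) by (simp add: a_inv_def)
qed

text \<open>Sums of pure tensors exhaust the tensor product: the negative of x (x) y is (-x) (x) y,
  again pure, and zero is the pure tensor of two zeros.\<close>

lemma tensor_induct [consumes 1, case_names pure add]:
  assumes "u \<in> carrier T"
    and P: "\<And>x y. \<lbrakk>x \<in> carrier X; y \<in> carrier Y\<rbrakk> \<Longrightarrow> P (pure x y)"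
    and add: "\<And>u v. \<lbrakk>u \<in> carrier T; v \<in> carrier T; P u; P v\<rbrakk> \<Longrightarrow> P (u \<otimes>\<^bsub>T\<^esub> v)"
  shows "P u"
proof -
  interpret T: comm_group T by (rule comm_T)
  interpret q: group_hom FXY T "\<lambda>z. q z" by (rule q_group_hom)
  obtain z where z: "z \<in> carrier FXY" "u = q z" using assms(1) carrier_T by auto
  \<comment> \<open>Induction in the free abelian group passes through differences, so the claim is
    strengthened to cover inverses as well.\<close>
  have "P (q z) \<and> P (inv\<^bsub>T\<^esub> (q z))"
  proof (rule free_Abelian_group_induct[of z "carrier X \<times> carrier Y" "\<lambda>z. P (q z) \<and> P (inv\<^bsub>T\<^esub> (q z))"])
    show "Poly_Mapping.keys z \<subseteq> carrier X \<times> carrier Y" using z by simp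
    have "P (pure \<zero>\<^bsub>X\<^esub> \<zero>\<^bsub>Y\<^esub>)" by (rule P) auto
    then show "P (q 0) \<and> P (inv\<^bsub>T\<^esub> (q 0))"
      using q.hom_one by (simp add: pure_zero_right)
  next
    fix a b :: "'x \<times> 'y \<Rightarrow>\<^sub>0 int"
    assume "Poly_Mapping.keys a \<subseteq> carrier X \<times> carrier Y" "Poly_Mapping.keys b \<subseteq> carrier X \<times> carrier Y"
    then have ab: "a \<in> carrier FXY" "b \<in> carrier FXY" by auto
    assume Pa: "P (q a) \<and> P (inv\<^bsub>T\<^esub> (q a))" and Pb: "P (q b) \<and> P (inv\<^bsub>T\<^esub> (q b))"
    have "q (a \<otimes>\<^bsub>FXY\<^esub> inv\<^bsub>FXY\<^esub> b) = q a \<otimes>\<^bsub>T\<^esub> inv\<^bsub>T\<^esub> (q b)"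
      using q.hom_mult[OF ab(1) q.G.inv_closed[OF ab(2)]] q.hom_inv[OF ab(2)] by simp
    then have e: "q (a - b) = q a \<otimes>\<^bsub>T\<^esub> inv\<^bsub>T\<^esub> (q b)" using ab by simp
    have cl: "q a \<in> carrier T" "q b \<in> carrier T" using ab q.hom_closed by blast+
    show "P (q (a - b)) \<and> P (inv\<^bsub>T\<^esub> (q (a - b)))"
      unfolding e using Pa Pb cl by (auto simp: T.inv_mult intro!: add)
  next
    fix a assume "a \<in> carrier X \<times> carrier Y"
    then obtain x y where a: "a = (x, y)" "x \<in> carrier X" "y \<in> carrier Y" by auto
    show "P (q (frag_of a)) \<and> P (inv\<^bsub>T\<^esub> (q (frag_of a)))"
      using P[of x y] P[of "\<ominus>\<^bsub>X\<^esub> x" y] pure_minus[of x y] a by (simp add: pure_tensor_def)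
  qed
  then show ?thesis using z by simp
qed

lemma tensor_hom_eqI:
  assumes "h \<in> hom T G" "h' \<in> hom T G"
    and "\<And>x y. \<lbrakk>x \<in> carrier X; y \<in> carrier Y\<rbrakk> \<Longrightarrow> h (pure x y) = h' (pure x y)"
    and "u \<in> carrier T"
  shows "h u = h' u"
  using assms(4)
proof (induction u rule: tensor_induct)
  case (pure x y)
  then show ?case by (rule assms(3))
next
  case (add u v)
  then show ?case using hom_mult[OF assms(1)] hom_mult[OF assms(2)] by simp
qed

text \<open>The map induced on the free group kills the generators of \<open>N\<close>, hence all of
  \<open>N\<close>, and is therefore constant on cosets.\<close>

lemma tensor_universal:
  assumes G: "comm_group G"
    and b: "\<And>x y. \<lbrakk>x \<in> carrier X; y \<in> carrier Y\<rbrakk> \<Longrightarrow> b x y \<in> carrier G"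
    and bl: "\<And>x x' y. \<lbrakk>x \<in> carrier X; x' \<in> carrier X; y \<in> carrier Y\<rbrakk> \<Longrightarrow> b (x \<oplus>\<^bsub>X\<^esub> x') y = b x y \<otimes>\<^bsub>G\<^esub> b x' y"
    and br: "\<And>x y y'. \<lbrakk>x \<in> carrier X; y \<in> carrier Y; y' \<in> carrier Y\<rbrakk> \<Longrightarrow> b x (y \<oplus>\<^bsub>Y\<^esub> y') = b x y \<otimes>\<^bsub>G\<^esub> b x y'"
    and bb: "\<And>r x y. \<lbrakk>r \<in> carrier R; x \<in> carrier X; y \<in> carrier Y\<rbrakk> \<Longrightarrow> b (r \<odot>\<^bsub>X\<^esub> x) y = b x (r \<odot>\<^bsub>Y\<^esub> y)"
  obtains h where "h \<in> hom T G" "\<And>x y. \<lbrakk>x \<in> carrier X; y \<in> carrier Y\<rbrakk> \<Longrightarrow> h (pure x y) = b x y"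
proof -
  interpret G: comm_group G by fact
  obtain g where g: "g \<in> hom FXY G" "\<And>z. z \<in> carrier X \<times> carrier Y \<Longrightarrow> g (frag_of z) = (\<lambda>(x, y). b x y) z"
  proof (rule G.free_Abelian_group_universal)
    show "(\<lambda>(x, y). b x y) ` (carrier X \<times> carrier Y) \<subseteq> carrier G" using b by auto
  qed blast
  interpret g: group_hom FXY G g
    using g(1) G.is_group by (simp add: group_hom_def group_hom_axioms_def)
  have gd: "g (u - v) = g u \<otimes>\<^bsub>G\<^esub> inv\<^bsub>G\<^esub> (g v)" if "u \<in> carrier FXY" "v \<in> carrier FXY" for u v
  proof -
    have "g (u \<otimes>\<^bsub>FXY\<^esub> inv\<^bsub>FXY\<^esub> v) = g u \<otimes>\<^bsub>G\<^esub> inv\<^bsub>G\<^esub> (g v)"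
      using g.hom_mult[OF that(1) g.G.inv_closed[OF that(2)]] g.hom_inv[OF that(2)] by simp
    then show ?thesis using that by simp
  qed
  have gf: "g (frag_of (x, y)) = b x y" if "x \<in> carrier X" "y \<in> carrier Y" for x y
    using g(2) that by simp
  have cancel: "p \<otimes>\<^bsub>G\<^esub> p' \<otimes>\<^bsub>G\<^esub> inv\<^bsub>G\<^esub> p \<otimes>\<^bsub>G\<^esub> inv\<^bsub>G\<^esub> p' = \<one>\<^bsub>G\<^esub>"
    if "p \<in> carrier G" "p' \<in> carrier G" for p p'
    using that by (simp add: G.m_comm[of p p'] G.m_assoc)
  have gens: "g z = \<one>\<^bsub>G\<^esub>" if z: "z \<in> gens" for z
  proof -
    consider (l) x x' y where "z = frag_of (x \<oplus>\<^bsub>X\<^esub> x', y) - frag_of (x, y) - frag_of (x', y)"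
        "x \<in> carrier X" "x' \<in> carrier X" "y \<in> carrier Y"
      | (r) x y y' where "z = frag_of (x, y \<oplus>\<^bsub>Y\<^esub> y') - frag_of (x, y) - frag_of (x, y')"
        "x \<in> carrier X" "y \<in> carrier Y" "y' \<in> carrier Y"
      | (b) r x y where "z = frag_of (r \<odot>\<^bsub>X\<^esub> x, y) - frag_of (x, r \<odot>\<^bsub>Y\<^esub> y)"
        "r \<in> carrier R" "x \<in> carrier X" "y \<in> carrier Y"
      using z unfolding gens_def by blast
    then show ?thesis
    proof cases
      case l
      then show ?thesis
        by (simp add: gd gf diff_closed of_closed bl b cancel del: carrier_free_Abelian_group_iff)
    next
      case r
      then show ?thesis
        by (simp add: gd gf diff_closed of_closed br b cancel del: carrier_free_Abelian_group_iff)
    next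
      case b
      then show ?thesis
        by (simp add: gd gf of_closed bb assms(2) smultX_closed Y.smult_closed del: carrier_free_Abelian_group_iff)
    qed
  qed
  have N: "g z = \<one>\<^bsub>G\<^esub>" if "z \<in> N" for z
    using that unfolding tensor_rel_def gens_def[symmetric]
  proof (induction z rule: generate.induct)
    case (inv h)
    then show ?case using gens g.hom_inv[of h] gens_closed by auto
  next
    case (eng a b)
    have "a \<in> carrier FXY" "b \<in> carrier FXY"
      using group.generate_in_carrier[OF group_free_Abelian_group gens_closed] eng by blast+
    then show ?case using eng g.hom_mult[of a b] by simp
  qed (use gens g.hom_one in auto)
  have eq: "g u = g v" if uv: "u \<in> carrier FXY" "v \<in> carrier FXY" "q u = q v" for u v
  proof -
    have "u \<in> q v"
      using group.rcos_self[OF group_free_Abelian_group uv(1) N_subgroup] uv(3) by simp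
    then obtain w where w: "w \<in> N" "u = w \<otimes>\<^bsub>FXY\<^esub> v" by (auto simp: r_coset_def)
    moreover have "w \<in> carrier FXY" using w(1) by (rule subgroup.mem_carrier[OF N_subgroup])
    ultimately show ?thesis using g.hom_mult[of w v] N[OF w(1)] uv(2) by simp
  qed
  obtain h where h: "h \<in> hom (FXY Mod N) G" "\<And>z. z \<in> carrier FXY \<Longrightarrow> h (q z) = g z"
    using FactGroup_universal[OF g(1) N_normal eq] by blast
  show thesis
    by (rule that[of h]) (use h gf in \<open>auto simp: tensor_def pure_tensor_def\<close>)
qed

end

text \<open>\<open>tensor_map\<close> manipulates cosets as sets, so neither that its value is a
  single coset nor that it is additive is immediate. Both follow by comparison with the homomorphism
  \<open>h\<close> that the universal property provides.\<close>

lemma tensor_map_hom: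
  assumes "tensor_pair R X Y" "tensor_pair R X' Y'"
    and f: "f \<in> mod_hom (opp R) X X'" and g: "g \<in> mod_hom R Y Y'"
  shows "tensor_map R X' Y' f g \<in> hom (tensor R X Y) (tensor R X' Y')"
    and "\<And>x y. \<lbrakk>x \<in> carrier X; y \<in> carrier Y\<rbrakk>
      \<Longrightarrow> tensor_map R X' Y' f g (pure_tensor R X Y x y) = pure_tensor R X' Y' (f x) (g y)"
proof -
  interpret A: tensor_pair R X Y by fact
  interpret B: tensor_pair R X' Y' by fact
  note f' = mod_homD[OF f, simplified] and g' = mod_homD[OF g]
  obtain h where h: "h \<in> hom A.T B.T" "\<And>x y. \<lbrakk>x \<in> carrier X; y \<in> carrier Y\<rbrakk> \<Longrightarrow> h (A.pure x y) = B.pure (f x) (g y)"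
    by (rule A.tensor_universal[of B.T "\<lambda>x y. B.pure (f x) (g y)"])
       (auto simp: B.comm_T f' g' B.pure_closed B.pure_add_left B.pure_add_right B.pure_balanced)
  let ?E = "frag_extend (\<lambda>(x, y). frag_of (f x, g y))"
  have E: "?E z \<in> carrier B.FXY" if "z \<in> carrier A.FXY" for z
  proof -
    have "Poly_Mapping.keys (case p of (x, y) \<Rightarrow> frag_of (f x, g y)) \<subseteq> carrier X' \<times> carrier Y'"
      if "p \<in> Poly_Mapping.keys z" for p
      using that \<open>z \<in> carrier A.FXY\<close> f'(1) g'(1) by (auto simp: keys_frag_of)
    then show ?thesis
      using keys_frag_extend[of "\<lambda>(x, y). frag_of (f x, g y)" z]
      unfolding carrier_free_Abelian_group_iff by blast
  qed
  interpret q: group_hom A.FXY A.T "\<lambda>z. A.q z" by (rule A.q_group_hom)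
  interpret q': group_hom B.FXY B.T "\<lambda>z. B.q z" by (rule B.q_group_hom)
  interpret h: group_hom A.T B.T h
    using h(1) by (simp add: group_hom_def group_hom_axioms_def q.H.is_group q'.H.is_group)
  have hq: "h (A.q z) = B.q (?E z)" if "z \<in> carrier A.FXY" for z
  proof -
    have "Poly_Mapping.keys z \<subseteq> carrier X \<times> carrier Y" using that by simp
    then show ?thesis
    proof (rule free_Abelian_group_induct[of z "carrier X \<times> carrier Y" "\<lambda>z. h (A.q z) = B.q (?E z)"])
      show "h (A.q 0) = B.q (?E 0)" using q.hom_one q'.hom_one h.hom_one by simp
    next
      fix a b :: "'c \<times> 'e \<Rightarrow>\<^sub>0 int"
      assume "Poly_Mapping.keys a \<subseteq> carrier X \<times> carrier Y" "Poly_Mapping.keys b \<subseteq> carrier X \<times> carrier Y"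
        and eq: "h (A.q a) = B.q (?E a)" "h (A.q b) = B.q (?E b)"
      then have ab: "a \<in> carrier A.FXY" "b \<in> carrier A.FXY" by auto
      have "A.q (a \<otimes>\<^bsub>A.FXY\<^esub> inv\<^bsub>A.FXY\<^esub> b) = A.q a \<otimes>\<^bsub>A.T\<^esub> inv\<^bsub>A.T\<^esub> (A.q b)"
        using q.hom_mult[OF ab(1) q.G.inv_closed[OF ab(2)]] q.hom_inv[OF ab(2)] by simp
      then have 1: "A.q (a - b) = A.q a \<otimes>\<^bsub>A.T\<^esub> inv\<^bsub>A.T\<^esub> (A.q b)" using ab by simp
      have "B.q (?E a \<otimes>\<^bsub>B.FXY\<^esub> inv\<^bsub>B.FXY\<^esub> ?E b) = B.q (?E a) \<otimes>\<^bsub>B.T\<^esub> inv\<^bsub>B.T\<^esub> (B.q (?E b))"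
        using q'.hom_mult[OF E[OF ab(1)] q'.G.inv_closed[OF E[OF ab(2)]]] q'.hom_inv[OF E[OF ab(2)]] by simp
      then have 2: "B.q (?E (a - b)) = B.q (?E a) \<otimes>\<^bsub>B.T\<^esub> inv\<^bsub>B.T\<^esub> (B.q (?E b))"
        using E[OF ab(2)] by (simp add: frag_extend_diff)
      have "A.q a \<in> carrier A.T" "A.q b \<in> carrier A.T" using ab q.hom_closed by blast+
      then show "h (A.q (a - b)) = B.q (?E (a - b))" using 1 2 eq by simp
    next
      fix a assume "a \<in> carrier X \<times> carrier Y"
      then show "h (A.q (frag_of a)) = B.q (?E (frag_of a))"
        using h(2)[of "fst a" "snd a"] by (auto simp: pure_tensor_def)
    qed
  qed
  have eq: "tensor_map R X' Y' f g u = h u" if u: "u \<in> carrier A.T" for u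
  proof -
    obtain z where z: "z \<in> carrier A.FXY" "u = A.q z" using u A.carrier_T by auto
    \<comment> \<open>Every representative of \<open>u\<close> is sent into the same coset h u, so
      the union of cosets that \<open>tensor_map\<close> forms collapses to h u.\<close>
    have w: "w \<in> carrier A.FXY \<and> h u = B.q (?E w)" if "w \<in> u" for w
    proof -
      have "A.q z = A.q w"
        by (rule group.repr_independence[OF group_free_Abelian_group]) (use that z A.N_subgroup in auto)
      moreover have "w \<in> carrier A.FXY"
        using subgroup.elemrcos_carrier[OF A.N_subgroup group_free_Abelian_group z(1)] that z(2) by blast
      ultimately show ?thesis using hq[of w] z by simp
    qed
    have z_in: "z \<in> u" using group.rcos_self[OF group_free_Abelian_group z(1) A.N_subgroup] z(2) by simp
    have "tensor_map R X' Y' f g u = (\<Union>w\<in>u. B.q (?E w))"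
      unfolding tensor_map_def set_mult_def r_coset_def by blast
    also have "\<dots> = (\<Union>w\<in>u. h u)" using w by auto
    also have "\<dots> = h u" using z_in by auto
    finally show ?thesis .
  qed
  show "tensor_map R X' Y' f g \<in> hom A.T B.T"
    using h(1) eq q.H.m_closed by (auto simp: hom_def)
  show "\<And>x y. \<lbrakk>x \<in> carrier X; y \<in> carrier Y\<rbrakk> \<Longrightarrow> tensor_map R X' Y' f g (A.pure x y) = B.pure (f x) (g y)"
    using eq h(2) A.pure_closed by simp
qed

section \<open>Relative traces and Higman's criterion\<close>

text \<open>The coinduced module Hom_Z(R, M) of additive maps, with t acting through right
  multiplication on the argument. Extensional functions make maps that agree on \<open>R\<close>
  equal.\<close>

definition coind :: "('r, 's) ring_scheme \<Rightarrow> ('r, 'm, 't) module_scheme \<Rightarrow> ('r, 'r \<Rightarrow> 'm) module" where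
  "coind R M = \<lparr>carrier = {f \<in> carrier R \<rightarrow>\<^sub>E carrier M.
       \<forall>a\<in>carrier R. \<forall>b\<in>carrier R. f (a \<oplus>\<^bsub>R\<^esub> b) = f a \<oplus>\<^bsub>M\<^esub> f b},
     monoid.mult = undefined, monoid.one = undefined,
     ring.zero = \<lambda>s\<in>carrier R. \<zero>\<^bsub>M\<^esub>, add = \<lambda>f g. \<lambda>s\<in>carrier R. f s \<oplus>\<^bsub>M\<^esub> g s,
     smult = \<lambda>t f. \<lambda>s\<in>carrier R. f (s \<otimes>\<^bsub>R\<^esub> t)\<rparr>"

lemma coind_simps [simp]:
  "f \<in> carrier (coind R M) \<longleftrightarrow> f \<in> carrier R \<rightarrow>\<^sub>E carrier M \<and>
     (\<forall>a\<in>carrier R. \<forall>b\<in>carrier R. f (a \<oplus>\<^bsub>R\<^esub> b) = f a \<oplus>\<^bsub>M\<^esub> f b)"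
  "ring.zero (coind R M) = (\<lambda>s\<in>carrier R. \<zero>\<^bsub>M\<^esub>)"
  "add (coind R M) f g = (\<lambda>s\<in>carrier R. f s \<oplus>\<^bsub>M\<^esub> g s)"
  "smult (coind R M) t f = (\<lambda>s\<in>carrier R. f (s \<otimes>\<^bsub>R\<^esub> t))"
  by (simp_all add: coind_def)

lemma coind_left_module:
  assumes "left_module R M"
  shows "left_module R (coind R M)"
proof -
  interpret M: left_module R M by fact
  show ?thesis
  proof (rule left_moduleI)
    show "ring R" by (rule M.R.ring_axioms)
    show "abelian_group (coind R M)"
    proof (rule abelian_groupI)
      fix f assume "f \<in> carrier (coind R M)"
      then show "\<exists>g\<in>carrier (coind R M). g \<oplus>\<^bsub>coind R M\<^esub> f = \<zero>\<^bsub>coind R M\<^esub>"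
        by (intro bexI[of _ "\<lambda>s\<in>carrier R. \<ominus>\<^bsub>M\<^esub> f s"])
           (auto simp: PiE_iff M.M.l_neg M.M.minus_add M.M.a_comm[of "\<ominus>\<^bsub>M\<^esub> f _" "\<ominus>\<^bsub>M\<^esub> f _"] intro!: restrict_ext)
    next
      fix f assume "f \<in> carrier (coind R M)"
      then show "\<zero>\<^bsub>coind R M\<^esub> \<oplus>\<^bsub>coind R M\<^esub> f = f"
        by (auto intro!: ext simp: PiE_iff extensional_def)
    qed (auto simp: PiE_iff M.M.a_ac intro!: restrict_ext)
  next
    fix f assume "f \<in> carrier (coind R M)"
    then show "\<one>\<^bsub>R\<^esub> \<odot>\<^bsub>coind R M\<^esub> f = f"
      by (auto intro!: ext simp: PiE_iff extensional_def)
  next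
    fix a b f assume "a \<in> carrier R" "b \<in> carrier R" and f: "f \<in> carrier (coind R M)"
    then show "(a \<oplus>\<^bsub>R\<^esub> b) \<odot>\<^bsub>coind R M\<^esub> f = a \<odot>\<^bsub>coind R M\<^esub> f \<oplus>\<^bsub>coind R M\<^esub> b \<odot>\<^bsub>coind R M\<^esub> f"
      by (auto intro!: restrict_ext simp: M.R.r_distr)
  qed (auto simp: PiE_iff M.R.m_assoc M.R.l_distr intro!: restrict_ext)
qed

context frobenius_ring
begin

text \<open>The identity of \<open>M\<close> is the relative trace of an F-linear endomorphism:
  Higman's form of relative projectivity over \<open>F\<close>.\<close>

definition higman :: "('r, 'm, 't) module_scheme \<Rightarrow> bool" where
  "higman M \<longleftrightarrow> left_module R M \<and>
     (\<exists>\<phi>\<in>mod_hom Fr M M. \<forall>m\<in>carrier M. (\<Oplus>\<^bsub>M\<^esub>i\<in>{..<n}. r i \<odot>\<^bsub>M\<^esub> \<phi> (s i \<odot>\<^bsub>M\<^esub> m)) = m)"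

text \<open>\<open>M\<close> embeds into the coinduced module by \<open>m \<mapsto> (s \<mapsto> s m)\<close>, and a retraction \<open>\<rho>\<close> of this
  embedding yields \<open>\<phi>(m) = \<rho>(s \<mapsto> \<theta>(s) m)\<close>.\<close>

lemma baer_higman:
  assumes M: "left_module R M" "baer R M"
  shows "higman M"
proof -
  interpret M: left_module R M by fact
  note [simp] = r_closed s_closed form_closed form_closed' M.smult_closed F_sub
  let ?H = "coind R M"
  have H: "left_module R ?H" by (rule coind_left_module[OF M(1)])
  interpret H: left_module R ?H by fact
  define \<iota> where "\<iota> m = (\<lambda>s\<in>carrier R. s \<odot>\<^bsub>M\<^esub> m)" for m
  define \<delta> where "\<delta> m = (\<lambda>s\<in>carrier R. \<theta> s \<odot>\<^bsub>M\<^esub> m)" for m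
  have \<iota>: "\<iota> \<in> mod_hom R M ?H"
    by (rule mod_homI) (auto simp: \<iota>_def M.smult_r_distr M.smult_l_distr M.smult_assoc intro!: restrict_ext)
  have "inj_on \<iota> (carrier M)"
  proof (rule inj_onI)
    fix x y assume "x \<in> carrier M" "y \<in> carrier M" "\<iota> x = \<iota> y"
    then show "x = y" by (metis M.smult_one R.one_closed \<iota>_def restrict_apply')
  qed
  moreover have "(\<lambda>x. x) \<in> mod_hom R M M" by (auto simp: mod_hom_def)
  \<comment> \<open>The coinduced module has functions as elements, so the extension lemma is
    applied here at a type other than those of the test modules in (a).\<close>
  ultimately obtain \<rho> where \<rho>: "\<rho> \<in> mod_hom R ?H M" "\<And>x. x \<in> carrier M \<Longrightarrow> \<rho> (\<iota> x) = x"
    using baer_extension_inj[OF M(1) H M \<iota>] by blast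
  note \<rho>' = mod_homD[OF \<rho>(1)]
  have \<delta>: "\<delta> m \<in> carrier ?H" if "m \<in> carrier M" for m
    using that by (auto simp: \<delta>_def form_add M.smult_l_distr)
  \<comment> \<open>For c in \<open>F\<close> one has \<theta>(x c) = \<theta>(x) c by centrality;
    this is where \<delta> is compatible with scalars.\<close>
  have \<delta>F: "\<delta> \<in> mod_hom Fr M ?H"
  proof (rule mod_homI)
    fix c m assume c: "c \<in> carrier Fr" and m: "m \<in> carrier M"
    show "\<delta> (c \<odot>\<^bsub>M\<^esub> m) = c \<odot>\<^bsub>?H\<^esub> \<delta> m"
      unfolding \<delta>_def coind_simps
    proof (rule restrict_ext)
      fix x assume x: "x \<in> carrier R"
      have "\<theta> (x \<otimes> c) = c \<otimes> \<theta> x" using c x F_central[of c x] form_smult[of c x] by simp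
      also have "\<dots> = \<theta> x \<otimes> c" using c x F_central[of c "\<theta> x"] by simp
      finally show "\<theta> x \<odot>\<^bsub>M\<^esub> (c \<odot>\<^bsub>M\<^esub> m) = restrict (\<lambda>s. \<theta> s \<odot>\<^bsub>M\<^esub> m) (carrier R) (x \<otimes> c)"
        using c x m by (simp flip: M.smult_assoc)
    qed
  next
    fix m m' assume "m \<in> carrier M" "m' \<in> carrier M"
    then show "\<delta> (m \<oplus>\<^bsub>M\<^esub> m') = \<delta> m \<oplus>\<^bsub>?H\<^esub> \<delta> m'"
      by (auto simp: \<delta>_def M.smult_r_distr intro!: restrict_ext)
  qed (rule \<delta>)
  have \<rho>F: "\<rho> \<in> mod_hom Fr ?H M"
    by (rule mod_hom_restrict[OF \<rho>(1)]) auto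
  have eval: "finsum ?H g I x = (\<Oplus>\<^bsub>M\<^esub>i\<in>I. g i x)" if "x \<in> carrier R" "g \<in> I \<rightarrow> carrier ?H" for x g and I :: "nat set"
    by (rule add_hom_finsum[OF H.M.abelian_group_axioms M.M.abelian_group_axioms, of "\<lambda>f. f x"])
       (use that in \<open>auto simp: hom_def simp del: PiE_restrict\<close>)
  \<comment> \<open>At x the i-th summand takes the value \<theta>(x r_i) s_i m, and these add up to
    x m by \<open>dual_left\<close>.\<close>
  have dec: "(\<Oplus>\<^bsub>?H\<^esub>i\<in>{..<n}. r i \<odot>\<^bsub>?H\<^esub> \<delta> (s i \<odot>\<^bsub>M\<^esub> m)) = \<iota> m" if m: "m \<in> carrier M" for m
  proof
    fix x
    have cl: "(\<lambda>i. r i \<odot>\<^bsub>?H\<^esub> \<delta> (s i \<odot>\<^bsub>M\<^esub> m)) \<in> {..<n} \<rightarrow> carrier ?H"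
      using m by (auto intro!: H.smult_closed \<delta> simp del: coind_simps)
    show "(\<Oplus>\<^bsub>?H\<^esub>i\<in>{..<n}. r i \<odot>\<^bsub>?H\<^esub> \<delta> (s i \<odot>\<^bsub>M\<^esub> m)) x = \<iota> m x"
    proof (cases "x \<in> carrier R")
      case True
      have "(\<Oplus>\<^bsub>?H\<^esub>i\<in>{..<n}. r i \<odot>\<^bsub>?H\<^esub> \<delta> (s i \<odot>\<^bsub>M\<^esub> m)) x
          = (\<Oplus>\<^bsub>M\<^esub>i\<in>{..<n}. (\<theta> (x \<otimes> r i) \<otimes> s i) \<odot>\<^bsub>M\<^esub> m)"
        unfolding eval[OF True cl]
        using True m by (intro M.M.finsum_cong') (auto simp: \<delta>_def M.smult_assoc)
      also have "\<dots> = x \<odot>\<^bsub>M\<^esub> m"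
        using M.finsum_smult[OF m, of "\<lambda>i. \<theta> (x \<otimes> r i) \<otimes> s i" "{..<n}"] dual_left[OF True] True
        by (simp add: Pi_iff)
      finally show ?thesis using True by (simp add: \<iota>_def)
    next
      case False
      have "finsum ?H (\<lambda>i. r i \<odot>\<^bsub>?H\<^esub> \<delta> (s i \<odot>\<^bsub>M\<^esub> m)) {..<n} \<in> carrier ?H"
        using cl by (rule H.M.finsum_closed)
      then show ?thesis using False by (auto simp: PiE_iff extensional_def \<iota>_def)
    qed
  qed
  show ?thesis
    unfolding higman_def
  proof (intro conjI bexI ballI)
    show "(\<lambda>m. \<rho> (\<delta> m)) \<in> mod_hom Fr M M" by (rule mod_hom_comp[OF \<delta>F \<rho>F])
    fix m assume m: "m \<in> carrier M"
    have cl: "(\<lambda>i. r i \<odot>\<^bsub>?H\<^esub> \<delta> (s i \<odot>\<^bsub>M\<^esub> m)) \<in> {..<n} \<rightarrow> carrier ?H"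
      using m by (auto intro!: H.smult_closed \<delta> simp del: coind_simps)
    have "m = \<rho> (\<Oplus>\<^bsub>?H\<^esub>i\<in>{..<n}. r i \<odot>\<^bsub>?H\<^esub> \<delta> (s i \<odot>\<^bsub>M\<^esub> m))"
      using dec[OF m] \<rho>(2)[OF m] by simp
    also have "\<dots> = (\<Oplus>\<^bsub>M\<^esub>i\<in>{..<n}. \<rho> (r i \<odot>\<^bsub>?H\<^esub> \<delta> (s i \<odot>\<^bsub>M\<^esub> m)))"
      by (rule mod_hom_finsum[OF H M(1) \<rho>(1) cl])
    also have "\<dots> = (\<Oplus>\<^bsub>M\<^esub>i\<in>{..<n}. r i \<odot>\<^bsub>M\<^esub> \<rho> (\<delta> (s i \<odot>\<^bsub>M\<^esub> m)))"
      using m \<delta> \<rho>' by (intro M.M.finsum_cong') (auto simp del: coind_simps)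
    finally show "(\<Oplus>\<^bsub>M\<^esub>i\<in>{..<n}. r i \<odot>\<^bsub>M\<^esub> \<rho> (\<delta> (s i \<odot>\<^bsub>M\<^esub> m))) = m" by simp
  qed (rule M(1))
qed

text \<open>The kernel of \<open>p\<close> splits off by \<open>retraction\<close>, and \<tau> = id
  - \<pi> vanishes on it. Hence \<tau> of a chosen preimage does not depend on the choice, and for
  this reason it is linear.\<close>

lemma F_section:
  assumes "left_module Fr X" "left_module Fr Y" "p \<in> mod_hom Fr X Y" "p ` carrier X = carrier Y"
  shows "\<exists>\<sigma>\<in>mod_hom Fr Y X. \<forall>y\<in>carrier Y. p (\<sigma> y) = y"
proof -
  interpret X: left_module Fr X by fact
  interpret Y: left_module Fr Y by fact
  note p = mod_homD[OF assms(3)]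
  have p0: "p \<zero>\<^bsub>X\<^esub> = \<zero>\<^bsub>Y\<^esub>" by (rule mod_hom_zero[OF assms(1-3)])
  define N where "N = {x \<in> carrier X. p x = \<zero>\<^bsub>Y\<^esub>}"
  have N: "submodule N Fr X"
    by (rule X.submoduleI') (use p p0 X.smult_closed Y.smult_zero_right in \<open>auto simp: N_def\<close>)
  obtain \<pi> where \<pi>: "\<pi> \<in> mod_hom Fr X (X\<lparr>carrier := N\<rparr>)" "\<And>x. x \<in> N \<Longrightarrow> \<pi> x = x"
    using retraction[OF assms(1) N] by blast
  note \<pi>' = mod_homD[OF \<pi>(1), simplified]
  have \<pi>c: "\<pi> x \<in> carrier X" "p (\<pi> x) = \<zero>\<^bsub>Y\<^esub>" if "x \<in> carrier X" for x
    using \<pi>'(1)[OF that] by (auto simp: N_def)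
  define \<tau> where "\<tau> x = x \<oplus>\<^bsub>X\<^esub> \<ominus>\<^bsub>X\<^esub> \<pi> x" for x
  have \<tau>: "\<tau> \<in> mod_hom Fr X X"
    using \<pi>c \<pi>' by (intro mod_homI)
      (auto simp: \<tau>_def X.smult_r_distr X.smult_minus_right X.smult_closed X.M.minus_add X.M.a_ac)
  note \<tau>' = mod_homD[OF \<tau>, simplified]
  have \<tau>N: "\<tau> x = \<tau> y" if "x \<in> carrier X" "y \<in> carrier X" "p x = p y" for x y
  proof -
    have "x \<oplus>\<^bsub>X\<^esub> \<ominus>\<^bsub>X\<^esub> y \<in> N"
      using that p mod_hom_minus[OF assms(1-3)] by (simp add: N_def Y.M.r_neg)
    then have "\<tau> (x \<oplus>\<^bsub>X\<^esub> \<ominus>\<^bsub>X\<^esub> y) = \<zero>\<^bsub>X\<^esub>"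
      using that by (simp add: \<tau>_def \<pi>(2) X.M.r_neg)
    then have "\<tau> x \<oplus>\<^bsub>X\<^esub> \<ominus>\<^bsub>X\<^esub> \<tau> y = \<zero>\<^bsub>X\<^esub>"
      using that \<tau>'(2) mod_hom_minus[OF assms(1) assms(1) \<tau>] by simp
    then show ?thesis
      using that \<tau>'(1) by (metis X.M.minus_equality X.M.minus_minus X.M.a_inv_closed)
  qed
  define l where "l y = (SOME x. x \<in> carrier X \<and> p x = y)" for y
  have l: "l y \<in> carrier X" "p (l y) = y" if "y \<in> carrier Y" for y
  proof -
    have "\<exists>x. x \<in> carrier X \<and> p x = y" using that unfolding assms(4)[symmetric] by auto
    from someI_ex[OF this] show "l y \<in> carrier X" "p (l y) = y" unfolding l_def by blast+
  qed
  have "(\<lambda>y. \<tau> (l y)) \<in> mod_hom Fr Y X"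
  proof (rule mod_homI)
    fix x y assume xy: "x \<in> carrier Y" "y \<in> carrier Y"
    have "\<tau> (l (x \<oplus>\<^bsub>Y\<^esub> y)) = \<tau> (l x \<oplus>\<^bsub>X\<^esub> l y)"
      using xy l p by (intro \<tau>N) auto
    then show "\<tau> (l (x \<oplus>\<^bsub>Y\<^esub> y)) = \<tau> (l x) \<oplus>\<^bsub>X\<^esub> \<tau> (l y)" using xy l \<tau>' by simp
  next
    fix c y assume cy: "c \<in> carrier Fr" "y \<in> carrier Y"
    have "\<tau> (l (c \<odot>\<^bsub>Y\<^esub> y)) = \<tau> (c \<odot>\<^bsub>X\<^esub> l y)"
      using cy l p Y.smult_closed X.smult_closed by (intro \<tau>N) auto
    then show "\<tau> (l (c \<odot>\<^bsub>Y\<^esub> y)) = c \<odot>\<^bsub>X\<^esub> \<tau> (l y)" using cy l \<tau>' by simp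
  qed (use l \<tau>' in auto)
  moreover have "p (\<tau> (l y)) = y" if "y \<in> carrier Y" for y
    using l[OF that] \<pi>c p mod_hom_minus[OF assms(1-3)] that by (simp add: \<tau>_def)
  ultimately show ?thesis by (intro bexI[of _ "\<lambda>y. \<tau> (l y)"]) auto
qed

text \<open>Lift f \<phi> through an F-linear section \<sigma> of \<open>p\<close> and take the
  trace of \<sigma> f \<phi>. Since \<open>p\<close> and \<open>f\<close> are R-linear,
  \<open>p\<close> maps this trace to \<open>f\<close> of the trace of \<phi>, which is
  \<open>f\<close>.\<close>

lemma higman_projective:
  assumes "higman M"
  shows "projective_module TX TY R M"
  unfolding projective_module_def
proof (intro conjI allI impI, goal_cases)
  case 1
  then show ?case using assms by (simp add: higman_def)
next
  case (2 X Y p f)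
  then have X: "left_module R X" and Y: "left_module R Y" and p: "p \<in> mod_hom R X Y"
    and surj: "p ` carrier X = carrier Y" and f: "f \<in> mod_hom R M Y" by auto
  interpret X: left_module R X by fact
  have M: "left_module R M" using assms by (simp add: higman_def)
  interpret M: left_module R M by fact
  obtain \<phi> where \<phi>: "\<phi> \<in> mod_hom Fr M M"
    "\<And>m. m \<in> carrier M \<Longrightarrow> (\<Oplus>\<^bsub>M\<^esub>i\<in>{..<n}. r i \<odot>\<^bsub>M\<^esub> \<phi> (s i \<odot>\<^bsub>M\<^esub> m)) = m"
    using assms by (auto simp: higman_def)
  note res = left_module.restrict_scalars[OF _ F_subring] mod_hom_restrict[OF _ subringE(1)[OF F_subring]]
  obtain \<sigma> where \<sigma>: "\<sigma> \<in> mod_hom Fr Y X" "\<And>y. y \<in> carrier Y \<Longrightarrow> p (\<sigma> y) = y"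
    using F_section[OF res(1)[OF X] res(1)[OF Y] res(2)[OF p] surj] by blast
  have \<psi>: "(\<lambda>m. \<sigma> (f (\<phi> m))) \<in> mod_hom Fr M X"
    by (rule mod_hom_comp[OF mod_hom_comp[OF \<phi>(1) res(2)[OF f]] \<sigma>(1)])
  note cl = mod_homD(1)[OF \<psi>] mod_homD(1)[OF \<phi>(1)] mod_homD(1)[OF f]
  note [simp] = r_closed s_closed M.smult_closed X.smult_closed
  show ?case
  proof (intro bexI ballI)
    show "(\<lambda>m. \<Oplus>\<^bsub>X\<^esub>i\<in>{..<n}. r i \<odot>\<^bsub>X\<^esub> \<sigma> (f (\<phi> (s i \<odot>\<^bsub>M\<^esub> m)))) \<in> mod_hom R M X"
      by (rule trace_hom[OF M X \<psi>])
    fix m assume m: "m \<in> carrier M"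
    have "p (\<Oplus>\<^bsub>X\<^esub>i\<in>{..<n}. r i \<odot>\<^bsub>X\<^esub> \<sigma> (f (\<phi> (s i \<odot>\<^bsub>M\<^esub> m))))
        = (\<Oplus>\<^bsub>Y\<^esub>i\<in>{..<n}. p (r i \<odot>\<^bsub>X\<^esub> \<sigma> (f (\<phi> (s i \<odot>\<^bsub>M\<^esub> m)))))"
      by (rule mod_hom_finsum[OF X Y p]) (use m cl in auto)
    also have "\<dots> = (\<Oplus>\<^bsub>Y\<^esub>i\<in>{..<n}. f (r i \<odot>\<^bsub>M\<^esub> \<phi> (s i \<odot>\<^bsub>M\<^esub> m)))"
      by (rule abelian_monoid.finsum_cong'[OF abelian_group.axioms(1)[OF left_moduleD(2)[OF Y]]])
         (use m cl \<sigma>(2) mod_homD(3)[OF p] mod_homD(3)[OF f] left_moduleD(3)[OF Y] in auto)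
    also have "\<dots> = f (\<Oplus>\<^bsub>M\<^esub>i\<in>{..<n}. r i \<odot>\<^bsub>M\<^esub> \<phi> (s i \<odot>\<^bsub>M\<^esub> m))"
      by (rule mod_hom_finsum[OF M Y f, symmetric]) (use m cl in auto)
    finally show "p (\<Oplus>\<^bsub>X\<^esub>i\<in>{..<n}. r i \<odot>\<^bsub>X\<^esub> \<sigma> (f (\<phi> (s i \<odot>\<^bsub>M\<^esub> m)))) = f m"
      using \<phi>(2)[OF m] by simp
  qed
qed

end

text \<open>Pure tensors generate, so a left inverse on them is a left inverse.\<close>

lemma tensor_map_inj:
  assumes "tensor_pair R X Y" "tensor_pair R X' Y'"
    and f: "f \<in> mod_hom (opp R) X X'" and g: "g \<in> mod_hom R Y Y'"
    and h: "h \<in> hom (tensor R X' Y') (tensor R X Y)"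
    and eq: "\<And>x y. \<lbrakk>x \<in> carrier X; y \<in> carrier Y\<rbrakk>
      \<Longrightarrow> h (pure_tensor R X' Y' (f x) (g y)) = pure_tensor R X Y x y"
  shows "inj_on (tensor_map R X' Y' f g) (carrier (tensor R X Y))"
proof -
  interpret A: tensor_pair R X Y by fact
  note tm = tensor_map_hom[OF assms(1-4)]
  have "h (tensor_map R X' Y' f g u) = u" if "u \<in> carrier A.T" for u
  proof (rule A.tensor_hom_eqI[OF _ _ _ that])
    show "(\<lambda>u. h (tensor_map R X' Y' f g u)) \<in> hom A.T A.T"
      using Group.hom_compose[OF tm(1) h] by (simp add: comp_def)
  qed (use tm(2) eq in \<open>auto simp: hom_def\<close>)
  then show ?thesis by (rule inj_on_inverseI)
qed

context frobenius_ring
begin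

text \<open>\<alpha> and \<beta> are linear over \<open>F\<close> only, so \<alpha> (x) \<beta> does
  not make sense over \<open>R\<close>. Inserting the sum of the r_k (x) s_k between p and q repairs
  this: \<open>casimir\<close> makes the result balanced over \<open>R\<close>. As \<open>P\<close>
  is a right module, r_k acting on p means p r_k.\<close>

lemma casimir_tensor:
  assumes PQ: "tensor_pair R P Q" and XM: "tensor_pair R X M"
    and \<alpha>: "\<alpha> \<in> mod_hom ((opp R)\<lparr>carrier := F\<rparr>) P X" and \<beta>: "\<beta> \<in> mod_hom Fr Q M"
  obtains h where "h \<in> hom (tensor R P Q) (tensor R X M)"
    "\<And>p q. \<lbrakk>p \<in> carrier P; q \<in> carrier Q\<rbrakk> \<Longrightarrow> h (pure_tensor R P Q p q) =
       (\<Otimes>\<^bsub>tensor R X M\<^esub>k\<in>{..<n}. pure_tensor R X M (\<alpha> (r k \<odot>\<^bsub>P\<^esub> p)) (\<beta> (s k \<odot>\<^bsub>Q\<^esub> q)))"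
proof -
  interpret A: tensor_pair R P Q by fact
  interpret B: tensor_pair R X M by fact
  note \<alpha>' = mod_homD[OF \<alpha>, simplified] and \<beta>' = mod_homD[OF \<beta>, simplified]
  note [simp] = r_closed s_closed A.smultX_closed B.smultX_closed A.Y.smult_closed B.Y.smult_closed F_sub
  interpret T: comm_group B.T by (rule B.comm_T)
  have XA: "(a \<otimes> b) \<odot>\<^bsub>P\<^esub> p = b \<odot>\<^bsub>P\<^esub> (a \<odot>\<^bsub>P\<^esub> p)" if "a \<in> carrier R" "b \<in> carrier R" "p \<in> carrier P" for a b p
    using A.X.smult_assoc[of b a p] that by simp
  have XD: "(a \<oplus> b) \<odot>\<^bsub>P\<^esub> p = a \<odot>\<^bsub>P\<^esub> p \<oplus>\<^bsub>P\<^esub> b \<odot>\<^bsub>P\<^esub> p" if "a \<in> carrier R" "b \<in> carrier R" "p \<in> carrier P" for a b p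
    using A.X.smult_l_distr[of a b p] that by simp
  have XR: "a \<odot>\<^bsub>P\<^esub> (p \<oplus>\<^bsub>P\<^esub> q) = a \<odot>\<^bsub>P\<^esub> p \<oplus>\<^bsub>P\<^esub> a \<odot>\<^bsub>P\<^esub> q" if "a \<in> carrier R" "p \<in> carrier P" "q \<in> carrier P" for a p q
    using A.X.smult_r_distr[of a p q] that by simp
  define b where "b p q u v = B.pure (\<alpha> (u \<odot>\<^bsub>P\<^esub> p)) (\<beta> (v \<odot>\<^bsub>Q\<^esub> q))" for p q u v
  have bcl: "b p q u v \<in> carrier B.T" if "p \<in> carrier P" "q \<in> carrier Q" "u \<in> carrier R" "v \<in> carrier R" for p q u v
    using that \<alpha>' \<beta>' by (simp add: b_def B.pure_closed)
  have cas: "(\<Otimes>\<^bsub>B.T\<^esub>k\<in>{..<n}. b p q (t \<otimes> r k) (s k)) = (\<Otimes>\<^bsub>B.T\<^esub>k\<in>{..<n}. b p q (r k) (s k \<otimes> t))"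
    if "p \<in> carrier P" "q \<in> carrier Q" "t \<in> carrier R" for p q t
  proof (rule casimir[OF B.comm_T])
    fix u v c assume u: "u \<in> carrier R" and v: "v \<in> carrier R" and c: "c \<in> F"
    have "b p q (u \<otimes> c) v = B.pure (c \<odot>\<^bsub>X\<^esub> \<alpha> (u \<odot>\<^bsub>P\<^esub> p)) (\<beta> (v \<odot>\<^bsub>Q\<^esub> q))"
      using u v c that \<alpha>'(3)[of c "u \<odot>\<^bsub>P\<^esub> p"] by (simp add: b_def XA)
    also have "\<dots> = B.pure (\<alpha> (u \<odot>\<^bsub>P\<^esub> p)) (c \<odot>\<^bsub>M\<^esub> \<beta> (v \<odot>\<^bsub>Q\<^esub> q))"
      using u v c that \<alpha>' \<beta>' by (intro B.pure_balanced) auto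
    also have "\<dots> = b p q u (c \<otimes> v)"
      using u v c that \<beta>'(3)[of c "v \<odot>\<^bsub>Q\<^esub> q"] by (simp add: b_def A.Y.smult_assoc)
    finally show "b p q (u \<otimes> c) v = b p q u (c \<otimes> v)" .
  qed (use that bcl \<alpha>' \<beta>' in \<open>auto simp: b_def XD A.Y.smult_l_distr B.pure_add_left B.pure_add_right\<close>)
  show thesis
  proof (rule A.tensor_universal[OF B.comm_T, of "\<lambda>p q. \<Otimes>\<^bsub>B.T\<^esub>k\<in>{..<n}. b p q (r k) (s k)"])
    fix p q assume p: "p \<in> carrier P" and q: "q \<in> carrier Q"
    show "(\<Otimes>\<^bsub>B.T\<^esub>k\<in>{..<n}. b p q (r k) (s k)) \<in> carrier B.T"
      using p q bcl by (auto intro!: T.finprod_closed)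
    fix t assume t: "t \<in> carrier R"
    have "(\<Otimes>\<^bsub>B.T\<^esub>k\<in>{..<n}. b (t \<odot>\<^bsub>P\<^esub> p) q (r k) (s k)) = (\<Otimes>\<^bsub>B.T\<^esub>k\<in>{..<n}. b p q (t \<otimes> r k) (s k))"
      using p q t bcl by (intro T.finprod_cong') (auto simp: b_def XA)
    also have "\<dots> = (\<Otimes>\<^bsub>B.T\<^esub>k\<in>{..<n}. b p (t \<odot>\<^bsub>Q\<^esub> q) (r k) (s k))"
      unfolding cas[OF p q t] using p q t bcl by (intro T.finprod_cong') (auto simp: b_def A.Y.smult_assoc)
    finally show "(\<Otimes>\<^bsub>B.T\<^esub>k\<in>{..<n}. b (t \<odot>\<^bsub>P\<^esub> p) q (r k) (s k)) = \<dots>" .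
  next
    fix p p' q assume p: "p \<in> carrier P" "p' \<in> carrier P" and q: "q \<in> carrier Q"
    have "(\<Otimes>\<^bsub>B.T\<^esub>k\<in>{..<n}. b (p \<oplus>\<^bsub>P\<^esub> p') q (r k) (s k)) =
        (\<Otimes>\<^bsub>B.T\<^esub>k\<in>{..<n}. b p q (r k) (s k) \<otimes>\<^bsub>B.T\<^esub> b p' q (r k) (s k))"
      using p q bcl \<alpha>' \<beta>' by (intro T.finprod_cong') (auto simp: b_def XR B.pure_add_left)
    also have "\<dots> = (\<Otimes>\<^bsub>B.T\<^esub>k\<in>{..<n}. b p q (r k) (s k)) \<otimes>\<^bsub>B.T\<^esub> (\<Otimes>\<^bsub>B.T\<^esub>k\<in>{..<n}. b p' q (r k) (s k))"
      using p q bcl by (intro T.finprod_multf) auto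
    finally show "(\<Otimes>\<^bsub>B.T\<^esub>k\<in>{..<n}. b (p \<oplus>\<^bsub>P\<^esub> p') q (r k) (s k)) = \<dots>" .
  next
    fix p q q' assume p: "p \<in> carrier P" and q: "q \<in> carrier Q" "q' \<in> carrier Q"
    have "(\<Otimes>\<^bsub>B.T\<^esub>k\<in>{..<n}. b p (q \<oplus>\<^bsub>Q\<^esub> q') (r k) (s k)) =
        (\<Otimes>\<^bsub>B.T\<^esub>k\<in>{..<n}. b p q (r k) (s k) \<otimes>\<^bsub>B.T\<^esub> b p q' (r k) (s k))"
      using p q bcl \<alpha>' \<beta>' by (intro T.finprod_cong') (auto simp: b_def A.Y.smult_r_distr B.pure_add_right)
    also have "\<dots> = (\<Otimes>\<^bsub>B.T\<^esub>k\<in>{..<n}. b p q (r k) (s k)) \<otimes>\<^bsub>B.T\<^esub> (\<Otimes>\<^bsub>B.T\<^esub>k\<in>{..<n}. b p q' (r k) (s k))"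
      using p q bcl by (intro T.finprod_multf) auto
    finally show "(\<Otimes>\<^bsub>B.T\<^esub>k\<in>{..<n}. b p (q \<oplus>\<^bsub>Q\<^esub> q') (r k) (s k)) = \<dots>" .
  qed (rule that, auto simp: b_def)
qed

text \<open>Over \<open>F\<close> every injection splits; the splitting need not be R-linear and is
  meant to be averaged.\<close>

lemma F_retraction:
  assumes "left_module R X" "left_module R Y" "i \<in> mod_hom R X Y" "inj_on i (carrier X)"
  obtains j where "j \<in> mod_hom Fr Y X" "\<And>x. x \<in> carrier X \<Longrightarrow> j (i x) = x"
proof -
  note res = left_module.restrict_scalars[OF _ F_subring] mod_hom_restrict[OF _ subringE(1)[OF F_subring]]
  have "(\<lambda>x. x) \<in> mod_hom Fr X X" by (auto simp: mod_hom_def)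
  then show thesis
    using baer_extension_inj[OF res(1)[OF assms(1)] res(1)[OF assms(2)] res(1)[OF assms(1)]
        baer_F[OF res(1)[OF assms(1)]] res(2)[OF assms(3)] assms(4)] that by blast
qed

text \<open>Split \<open>i\<close> over \<open>F\<close> by j and send y (x) m to the sum of j(y
  r_k) (x) \<phi>(s_k m). At i(x) (x) m one has j(i(x) r_k) = x r_k, and moving the r_k across the
  tensor sign rebuilds the trace of \<phi> at m, which is m. So this is a left inverse of i (x)
  id.\<close>

lemma higman_flat_left:
  assumes "higman M"
  shows "flat_left_module TX TY R M"
  unfolding flat_left_module_def
proof (intro conjI allI impI, goal_cases)
  case 1
  then show ?case using assms by (simp add: higman_def)
next
  case (2 X Y i)
  interpret O: frobenius_ring "opp R" F \<theta> n s r by (rule frobenius_ring_opp)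
  have M: "left_module R M" using assms by (simp add: higman_def)
  interpret M: left_module R M by fact
  obtain \<phi> where \<phi>: "\<phi> \<in> mod_hom Fr M M"
    "\<And>m. m \<in> carrier M \<Longrightarrow> (\<Oplus>\<^bsub>M\<^esub>i\<in>{..<n}. r i \<odot>\<^bsub>M\<^esub> \<phi> (s i \<odot>\<^bsub>M\<^esub> m)) = m"
    using assms by (auto simp: higman_def)
  obtain j where j: "j \<in> mod_hom O.Fr Y X" "\<And>x. x \<in> carrier X \<Longrightarrow> j (i x) = x"
    using O.F_retraction[of X Y i] 2 by blast
  have XM: "tensor_pair R X M" and YM: "tensor_pair R Y M"
    using 2 M by (auto simp: tensor_pair_def)
  interpret XM: tensor_pair R X M by fact
  note [simp] = r_closed s_closed XM.smultX_closed M.smult_closed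
  note cl = mod_homD(1)[OF \<phi>(1)]
  obtain h where h: "h \<in> hom (tensor R Y M) (tensor R X M)"
    "\<And>p q. \<lbrakk>p \<in> carrier Y; q \<in> carrier M\<rbrakk> \<Longrightarrow> h (pure_tensor R Y M p q) =
       (\<Otimes>\<^bsub>XM.T\<^esub>k\<in>{..<n}. XM.pure (j (r k \<odot>\<^bsub>Y\<^esub> p)) (\<phi> (s k \<odot>\<^bsub>M\<^esub> q)))"
    using casimir_tensor[OF YM XM j(1) \<phi>(1)] by blast
  interpret T: comm_group XM.T by (rule XM.comm_T)
  show ?case
  proof (rule tensor_map_inj[OF XM YM _ _ h(1)])
    show "i \<in> mod_hom (opp R) X Y" using 2 by simp
    note i = mod_homD[OF this]
    show "(\<lambda>m. m) \<in> mod_hom R M M" by (auto simp: mod_hom_def)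
    fix x m assume x: "x \<in> carrier X" and m: "m \<in> carrier M"
    have "h (pure_tensor R Y M (i x) m) = (\<Otimes>\<^bsub>XM.T\<^esub>k\<in>{..<n}. XM.pure x (r k \<odot>\<^bsub>M\<^esub> \<phi> (s k \<odot>\<^bsub>M\<^esub> m)))"
      unfolding h(2)[OF i(1)[OF x] m]
    proof (rule T.finprod_cong')
      fix k assume k: "k \<in> {..<n}"
      then have "j (r k \<odot>\<^bsub>Y\<^esub> i x) = r k \<odot>\<^bsub>X\<^esub> x" using x i(3)[of "r k" x] j(2)[of "r k \<odot>\<^bsub>X\<^esub> x"] by simp
      then show "XM.pure (j (r k \<odot>\<^bsub>Y\<^esub> i x)) (\<phi> (s k \<odot>\<^bsub>M\<^esub> m)) = XM.pure x (r k \<odot>\<^bsub>M\<^esub> \<phi> (s k \<odot>\<^bsub>M\<^esub> m))"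
        using x m k cl by (simp add: XM.pure_balanced)
    qed (use x m cl in \<open>auto intro!: XM.pure_closed\<close>)
    also have "\<dots> = XM.pure x (\<Oplus>\<^bsub>M\<^esub>k\<in>{..<n}. r k \<odot>\<^bsub>M\<^esub> \<phi> (s k \<odot>\<^bsub>M\<^esub> m))"
      unfolding finsum_def
      by (rule hom_finprod[OF M.M.a_comm_group XM.comm_T XM.pure_hom_right[OF x], symmetric])
         (use m cl in auto)
    finally show "h (pure_tensor R Y M (i x) m) = XM.pure x m" using \<phi>(2)[OF m] by simp
  qed
qed

text \<open>The mirror image: \<phi> now acts on the first factor, where the sum of \<phi>(m r_k)
  s_k is m, and the splitting of \<open>i\<close> acts on the second. The tensor product is still
  over \<open>R\<close>, so the same element, the sum of the r_k (x) s_k, is inserted.\<close>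

lemma higman_flat_right:
  assumes "frobenius_ring.higman (opp R) F n s r M"
  shows "flat_right_module TX TY R M"
  unfolding flat_right_module_def
proof (intro conjI allI impI, goal_cases)
  interpret O: frobenius_ring "opp R" F \<theta> n s r by (rule frobenius_ring_opp)
  case 1
  then show ?case using assms by (simp add: O.higman_def)
next
  interpret O: frobenius_ring "opp R" F \<theta> n s r by (rule frobenius_ring_opp)
  case (2 X Y i)
  have M: "right_module R M" using assms by (simp add: O.higman_def)
  obtain \<phi> where \<phi>: "\<phi> \<in> mod_hom O.Fr M M"
    "\<And>m. m \<in> carrier M \<Longrightarrow> (\<Oplus>\<^bsub>M\<^esub>i\<in>{..<n}. s i \<odot>\<^bsub>M\<^esub> \<phi> (r i \<odot>\<^bsub>M\<^esub> m)) = m"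
    using assms by (auto simp: O.higman_def)
  obtain j where j: "j \<in> mod_hom Fr Y X" "\<And>x. x \<in> carrier X \<Longrightarrow> j (i x) = x"
    using F_retraction[of X Y i] 2 by blast
  have XM: "tensor_pair R M X" and YM: "tensor_pair R M Y"
    using 2 M by (auto simp: tensor_pair_def)
  interpret XM: tensor_pair R M X by fact
  note [simp] = r_closed s_closed XM.smultX_closed XM.Y.smult_closed
  note cl = mod_homD(1)[OF \<phi>(1)]
  obtain h where h: "h \<in> hom (tensor R M Y) (tensor R M X)"
    "\<And>p q. \<lbrakk>p \<in> carrier M; q \<in> carrier Y\<rbrakk> \<Longrightarrow> h (pure_tensor R M Y p q) =
       (\<Otimes>\<^bsub>XM.T\<^esub>k\<in>{..<n}. XM.pure (\<phi> (r k \<odot>\<^bsub>M\<^esub> p)) (j (s k \<odot>\<^bsub>Y\<^esub> q)))"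
    using casimir_tensor[OF YM XM \<phi>(1) j(1)] by blast
  interpret T: comm_group XM.T by (rule XM.comm_T)
  show ?case
  proof (rule tensor_map_inj[OF XM YM _ _ h(1)])
    show "i \<in> mod_hom R X Y" using 2 by simp
    note i = mod_homD[OF this]
    show "(\<lambda>m. m) \<in> mod_hom (opp R) M M" by (auto simp: mod_hom_def)
    fix m x assume x: "x \<in> carrier X" and m: "m \<in> carrier M"
    have "h (pure_tensor R M Y m (i x)) = (\<Otimes>\<^bsub>XM.T\<^esub>k\<in>{..<n}. XM.pure (s k \<odot>\<^bsub>M\<^esub> \<phi> (r k \<odot>\<^bsub>M\<^esub> m)) x)"
      unfolding h(2)[OF m i(1)[OF x]]
    proof (rule T.finprod_cong')
      fix k assume k: "k \<in> {..<n}"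
      then have "j (s k \<odot>\<^bsub>Y\<^esub> i x) = s k \<odot>\<^bsub>X\<^esub> x" using x i(3)[of "s k" x] j(2)[of "s k \<odot>\<^bsub>X\<^esub> x"] by simp
      then show "XM.pure (\<phi> (r k \<odot>\<^bsub>M\<^esub> m)) (j (s k \<odot>\<^bsub>Y\<^esub> i x)) = XM.pure (s k \<odot>\<^bsub>M\<^esub> \<phi> (r k \<odot>\<^bsub>M\<^esub> m)) x"
        using x m k cl by (simp add: XM.pure_balanced)
    qed (use x m cl in \<open>auto intro!: XM.pure_closed\<close>)
    also have "\<dots> = XM.pure (\<Oplus>\<^bsub>M\<^esub>k\<in>{..<n}. s k \<odot>\<^bsub>M\<^esub> \<phi> (r k \<odot>\<^bsub>M\<^esub> m)) x"
      unfolding finsum_def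
      by (rule hom_finprod[OF XM.X.M.a_comm_group XM.comm_T XM.pure_hom_left[OF x], symmetric])
         (use m cl in auto)
    finally show "h (pure_tensor R M Y m (i x)) = XM.pure m x" using \<phi>(2)[OF m] by simp
  qed
qed

end

section \<open>Finite generation and dual bases\<close>

text \<open>A form of finite generation without coefficients: no proper submodule contains
  \<open>X\<close>. A property of all elements is then proved by showing that it defines a submodule
  and holds on \<open>X\<close>. The converse applies this to the set \<open>L\<close> of linear
  combinations of \<open>X\<close>.\<close>

lemma fin_gen_iff:
  assumes "left_module R M"
  shows "fin_gen R M \<longleftrightarrow> (\<exists>X. finite X \<and> X \<subseteq> carrier M \<and> (\<forall>H. submodule H R M \<and> X \<subseteq> H \<longrightarrow> H = carrier M))"
proof -
  interpret left_module R M by fact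
  show ?thesis
  proof
    assume "fin_gen R M"
    then obtain X where X: "finite X" "X \<subseteq> carrier M"
      "\<And>m. m \<in> carrier M \<Longrightarrow> \<exists>c\<in>X \<rightarrow> carrier R. m = (\<Oplus>\<^bsub>M\<^esub>x\<in>X. c x \<odot>\<^bsub>M\<^esub> x)"
      unfolding fin_gen_def by blast
    have "H = carrier M" if H: "submodule H R M" "X \<subseteq> H" for H
    proof
      show "carrier M \<subseteq> H"
      proof
        fix m assume "m \<in> carrier M"
        then obtain c where c: "c \<in> X \<rightarrow> carrier R" "m = (\<Oplus>\<^bsub>M\<^esub>x\<in>X. c x \<odot>\<^bsub>M\<^esub> x)" using X(3) by blast
        show "m \<in> H"
          unfolding c(2) by (rule submodule_finsum[OF H(1)]) (use c(1) H submoduleD(4)[OF H(1)] in auto)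
      qed
    qed (rule submoduleD(1)[OF H(1)])
    then show "\<exists>X. finite X \<and> X \<subseteq> carrier M \<and> (\<forall>H. submodule H R M \<and> X \<subseteq> H \<longrightarrow> H = carrier M)"
      using X by blast
  next
    assume "\<exists>X. finite X \<and> X \<subseteq> carrier M \<and> (\<forall>H. submodule H R M \<and> X \<subseteq> H \<longrightarrow> H = carrier M)"
    then obtain X where X: "finite X" "X \<subseteq> carrier M" "\<And>H. submodule H R M \<Longrightarrow> X \<subseteq> H \<Longrightarrow> H = carrier M"
      by blast
    define L where "L = {(\<Oplus>\<^bsub>M\<^esub>x\<in>X. c x \<odot>\<^bsub>M\<^esub> x) | c. c \<in> X \<rightarrow> carrier R}"
    have LI: "(\<Oplus>\<^bsub>M\<^esub>x\<in>X. c x \<odot>\<^bsub>M\<^esub> x) \<in> L" if "c \<in> X \<rightarrow> carrier R" for c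
      using that by (auto simp: L_def)
    have cl: "(\<lambda>x. c x \<odot>\<^bsub>M\<^esub> x) \<in> X \<rightarrow> carrier M" if "c \<in> X \<rightarrow> carrier R" for c
      using that X(2) by (auto simp: smult_closed subset_iff Pi_iff)
    have "submodule L R M"
    proof (rule submoduleI')
      show "L \<subseteq> carrier M" using cl by (auto simp: L_def intro!: M.finsum_closed)
      have "\<zero>\<^bsub>M\<^esub> = (\<Oplus>\<^bsub>M\<^esub>x\<in>X. \<zero>\<^bsub>R\<^esub> \<odot>\<^bsub>M\<^esub> x)"
        using X(2) by (subst M.add.finprod_one_eqI) (auto simp: smult_zero_left subset_iff)
      then show "\<zero>\<^bsub>M\<^esub> \<in> L" using LI[of "\<lambda>x. \<zero>\<^bsub>R\<^esub>"] by simp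
    next
      fix a b assume "a \<in> L" "b \<in> L"
      then obtain c d where cd: "c \<in> X \<rightarrow> carrier R" "a = (\<Oplus>\<^bsub>M\<^esub>x\<in>X. c x \<odot>\<^bsub>M\<^esub> x)"
        "d \<in> X \<rightarrow> carrier R" "b = (\<Oplus>\<^bsub>M\<^esub>x\<in>X. d x \<odot>\<^bsub>M\<^esub> x)" by (auto simp: L_def)
      have "a \<oplus>\<^bsub>M\<^esub> b = (\<Oplus>\<^bsub>M\<^esub>x\<in>X. c x \<odot>\<^bsub>M\<^esub> x \<oplus>\<^bsub>M\<^esub> d x \<odot>\<^bsub>M\<^esub> x)"
        using cl cd by (simp add: M.finsum_addf)
      also have "\<dots> = (\<Oplus>\<^bsub>M\<^esub>x\<in>X. (c x \<oplus>\<^bsub>R\<^esub> d x) \<odot>\<^bsub>M\<^esub> x)"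
        using cd X(2) by (intro M.finsum_cong') (auto simp: smult_l_distr smult_closed subset_iff Pi_iff)
      finally show "a \<oplus>\<^bsub>M\<^esub> b \<in> L" using LI[of "\<lambda>x. c x \<oplus>\<^bsub>R\<^esub> d x"] cd by auto
    next
      fix t a assume t: "t \<in> carrier R" and "a \<in> L"
      then obtain c where c: "c \<in> X \<rightarrow> carrier R" "a = (\<Oplus>\<^bsub>M\<^esub>x\<in>X. c x \<odot>\<^bsub>M\<^esub> x)" by (auto simp: L_def)
      have "t \<odot>\<^bsub>M\<^esub> a = (\<Oplus>\<^bsub>M\<^esub>x\<in>X. t \<odot>\<^bsub>M\<^esub> (c x \<odot>\<^bsub>M\<^esub> x))"
        unfolding c(2) by (rule smult_finsum[OF t cl[OF c(1)]])
      also have "\<dots> = (\<Oplus>\<^bsub>M\<^esub>x\<in>X. (t \<otimes>\<^bsub>R\<^esub> c x) \<odot>\<^bsub>M\<^esub> x)"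
        using c t X(2) by (intro M.finsum_cong') (auto simp: smult_assoc smult_closed subset_iff Pi_iff)
      finally show "t \<odot>\<^bsub>M\<^esub> a \<in> L" using LI[of "\<lambda>x. t \<otimes>\<^bsub>R\<^esub> c x"] c t by auto
    qed
    moreover have "X \<subseteq> L"
    proof
      fix y assume y: "y \<in> X"
      have "(\<Oplus>\<^bsub>M\<^esub>x\<in>X. (if x = y then \<one>\<^bsub>R\<^esub> else \<zero>\<^bsub>R\<^esub>) \<odot>\<^bsub>M\<^esub> x) = (\<Oplus>\<^bsub>M\<^esub>x\<in>X. if y = x then x else \<zero>\<^bsub>M\<^esub>)"
        using X(2) by (intro M.finsum_cong') (auto simp: smult_one smult_zero_left)
      also have "\<dots> = y"
        using M.finsum_singleton[OF y X(1), of "\<lambda>x. x"] X(2) by auto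
      finally show "y \<in> L" using LI[of "\<lambda>x. if x = y then \<one>\<^bsub>R\<^esub> else \<zero>\<^bsub>R\<^esub>"] by (simp add: Pi_iff)
    qed
    ultimately have "L = carrier M" using X(3) by blast
    then have "\<forall>m\<in>carrier M. \<exists>c\<in>X \<rightarrow> carrier R. m = (\<Oplus>\<^bsub>M\<^esub>x\<in>X. c x \<odot>\<^bsub>M\<^esub> x)"
      unfolding L_def by blast
    then show "fin_gen R M" unfolding fin_gen_def using X by blast
  qed
qed

lemma fin_gen_image:
  assumes "left_module R M" "left_module R N" "p \<in> mod_hom R M N" "p ` carrier M = carrier N" "fin_gen R M"
  shows "fin_gen R N"
proof -
  interpret M: left_module R M by fact
  interpret N: left_module R N by fact
  note p = mod_homD[OF assms(3)]
  obtain X where X: "finite X" "X \<subseteq> carrier M" "\<And>H. submodule H R M \<Longrightarrow> X \<subseteq> H \<Longrightarrow> H = carrier M"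
    using assms(5) fin_gen_iff[OF assms(1)] by auto
  have "H = carrier N" if H: "submodule H R N" "p ` X \<subseteq> H" for H
  proof -
    note H' = N.submoduleD[OF H(1)]
    have "{x \<in> carrier M. p x \<in> H} = carrier M"
    proof (rule X(3))
      show "submodule {x \<in> carrier M. p x \<in> H} R M"
        by (rule M.submoduleI') (auto simp: p H' mod_hom_zero[OF assms(1-3)] M.smult_closed)
      show "X \<subseteq> {x \<in> carrier M. p x \<in> H}" using H(2) X(2) by auto
    qed
    then have "carrier N \<subseteq> H" unfolding assms(4)[symmetric] by auto
    then show ?thesis using H'(1) by auto
  qed
  then show ?thesis
    using fin_gen_iff[OF assms(2)] X(1,2) p(1) by (intro iffD2[OF fin_gen_iff[OF assms(2)]] exI[of _ "p ` X"]) auto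
qed

text \<open>A subspace is the image of the whole space under a retraction, hence finitely generated;
  no dimension is counted.\<close>

lemma (in frobenius_ring) fin_gen_F_submodule:
  assumes "left_module Fr V" "fin_gen Fr V" "submodule Z Fr V"
  shows "fin_gen Fr (V\<lparr>carrier := Z\<rparr>)"
proof -
  interpret V: left_module Fr V by fact
  obtain \<pi> where \<pi>: "\<pi> \<in> mod_hom Fr V (V\<lparr>carrier := Z\<rparr>)" "\<And>x. x \<in> Z \<Longrightarrow> \<pi> x = x"
    using retraction[OF assms(1,3)] by blast
  have "\<pi> ` carrier V = Z"
  proof
    show "\<pi> ` carrier V \<subseteq> Z" using mod_homD(1)[OF \<pi>(1)] by auto
    show "Z \<subseteq> \<pi> ` carrier V"
    proof
      fix z assume z: "z \<in> Z"
      then show "z \<in> \<pi> ` carrier V" using V.submoduleD(1)[OF assms(3)] \<pi>(2)[OF z] by (metis imageI subsetD)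
    qed
  qed
  then show ?thesis
    using fin_gen_image[OF assms(1) V.submodule_left_module[OF assms(3)] \<pi>(1) _ assms(2)] by simp
qed

lemma (in frobenius_ring) fin_gen_F: "fin_gen Fr (lmod (\<lambda>x. x) R)"
proof -
  interpret L: left_module Fr "lmod (\<lambda>x. x) R" by (rule lmod_F)
  show ?thesis
  proof (rule iffD2[OF fin_gen_iff[OF lmod_F]], intro exI[of _ "s ` {..<n}"] conjI allI impI)
    fix H assume H: "submodule H Fr (lmod (\<lambda>x. x) R) \<and> s ` {..<n} \<subseteq> H"
    note H' = L.submoduleD[OF conjunct1[OF H], simplified]
    have "x \<in> H" if x: "x \<in> carrier R" for x
    proof -
      have "(\<Oplus>\<^bsub>lmod (\<lambda>x. x) R\<^esub>i\<in>{..<n}. \<theta> (x \<otimes> r i) \<otimes> s i) \<in> H"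
        by (rule L.submodule_finsum) (use H H' x r_closed form_closed in auto)
      then show ?thesis using dual_left[OF x] by simp
    qed
    then show "H = carrier (lmod (\<lambda>x. x) R)" using H'(1) by auto
  qed (use s_closed in auto)
qed

lemma (in module) module_left_module: "left_module R M"
  using R.ring_axioms M.abelian_group_axioms
  by (intro left_moduleI) (auto simp: smult_l_distr smult_r_distr smult_assoc1)

text \<open>Gram--Schmidt: if \<open>P\<close> is the projection \<open>x \<mapsto> \<Sum>\<^sub>i \<theta>(x r\<^sub>i) s\<^sub>i\<close> and \<open>w = v - P v \<noteq> 0\<close>, then \<open>w\<close> is added to
  the \<open>s\<^sub>i\<close>, and its dual element is corrected so that it pairs to zero with everything fixed by \<open>P\<close>.\<close>

lemma (in k_algebra) frobenius_dual_basis: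
  assumes form: "frobenius_form K A \<theta>" and fg: "fin_gen K A"
  shows "\<exists>(n :: nat) r s. r \<in> {..<n} \<rightarrow> carrier A \<and> s \<in> {..<n} \<rightarrow> carrier A \<and>
    (\<forall>x\<in>carrier A. (\<Oplus>\<^bsub>A\<^esub>i\<in>{..<n}. \<theta> (x \<otimes>\<^bsub>A\<^esub> r i) \<odot>\<^bsub>A\<^esub> s i) = x) \<and>
    (\<forall>x\<in>carrier A. (\<Oplus>\<^bsub>A\<^esub>i\<in>{..<n}. \<theta> (s i \<otimes>\<^bsub>A\<^esub> x) \<odot>\<^bsub>A\<^esub> r i) = x)"
proof -
  have LM: "left_module K A" by (rule module_left_module)
  interpret L: left_module K A by fact
  have LK: "left_module K (lmod (\<lambda>c. c) K)" by (rule K.lmod_self)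
  have \<theta>: "\<theta> \<in> mod_hom K A (lmod (\<lambda>c. c) K)" using form by (simp add: frobenius_form_def)
  note t = mod_homD[OF \<theta>, simplified]
  have nd1: "x = \<zero>\<^bsub>A\<^esub>" if "x \<in> carrier A" "\<And>y. y \<in> carrier A \<Longrightarrow> \<theta> (x \<otimes>\<^bsub>A\<^esub> y) = \<zero>\<^bsub>K\<^esub>" for x
    using form that unfolding frobenius_form_def by blast
  have nd2: "y = \<zero>\<^bsub>A\<^esub>" if "y \<in> carrier A" "\<And>x. x \<in> carrier A \<Longrightarrow> \<theta> (x \<otimes>\<^bsub>A\<^esub> y) = \<zero>\<^bsub>K\<^esub>" for y
    using form that unfolding frobenius_form_def by blast
  have \<theta>minus: "\<theta> (\<ominus>\<^bsub>A\<^esub> x) = \<ominus>\<^bsub>K\<^esub> \<theta> x" if "x \<in> carrier A" for x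
    by (rule add_hom_minus[OF M.abelian_group_axioms K.abelian_group_axioms _ that]) (auto simp: hom_def t)
  note [simp] = t(1) L.smult_closed
  define P where "P n r s x = (\<Oplus>\<^bsub>A\<^esub>i\<in>{..<n}. \<theta> (x \<otimes>\<^bsub>A\<^esub> r i) \<odot>\<^bsub>A\<^esub> s i)" for n :: nat and r s and x
  have P: "P n r s \<in> mod_hom K A A" if rs: "r \<in> {..<n} \<rightarrow> carrier A" "s \<in> {..<n} \<rightarrow> carrier A" for n r s
  proof (rule mod_homI)
    fix x assume x: "x \<in> carrier A"
    show "P n r s x \<in> carrier A" using x rs by (auto simp: P_def Pi_iff intro!: M.finsum_closed)
    fix y assume y: "y \<in> carrier A"
    have "P n r s (x \<oplus>\<^bsub>A\<^esub> y) = (\<Oplus>\<^bsub>A\<^esub>i\<in>{..<n}. \<theta> (x \<otimes>\<^bsub>A\<^esub> r i) \<odot>\<^bsub>A\<^esub> s i \<oplus>\<^bsub>A\<^esub> \<theta> (y \<otimes>\<^bsub>A\<^esub> r i) \<odot>\<^bsub>A\<^esub> s i)"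
      unfolding P_def using x y rs by (intro M.finsum_cong') (auto simp: Pi_iff A.l_distr t L.smult_l_distr)
    also have "\<dots> = P n r s x \<oplus>\<^bsub>A\<^esub> P n r s y"
      unfolding P_def using x y rs by (intro M.finsum_addf) (auto simp: Pi_iff)
    finally show "P n r s (x \<oplus>\<^bsub>A\<^esub> y) = \<dots>" .
  next
    fix c x assume c: "c \<in> carrier K" and x: "x \<in> carrier A"
    have "P n r s (c \<odot>\<^bsub>A\<^esub> x) = (\<Oplus>\<^bsub>A\<^esub>i\<in>{..<n}. c \<odot>\<^bsub>A\<^esub> (\<theta> (x \<otimes>\<^bsub>A\<^esub> r i) \<odot>\<^bsub>A\<^esub> s i))"
      unfolding P_def using x c rs by (intro M.finsum_cong') (auto simp: Pi_iff smult_mult_left t L.smult_assoc)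
    also have "\<dots> = c \<odot>\<^bsub>A\<^esub> P n r s x"
      unfolding P_def by (rule L.smult_finsum[symmetric]) (use x c rs in \<open>auto simp: Pi_iff\<close>)
    finally show "P n r s (c \<odot>\<^bsub>A\<^esub> x) = \<dots>" .
  qed
  \<comment> \<open>The vectors of \<open>X\<close> are absorbed one at a time. Keeping every s_i
    fixed as well makes \<open>P\<close> idempotent, which the next round relies on.\<close>
  have step: "\<exists>(n::nat) r s. r \<in> {..<n} \<rightarrow> carrier A \<and> s \<in> {..<n} \<rightarrow> carrier A \<and> (\<forall>x\<in>X \<union> s ` {..<n}. P n r s x = x)"
    if "finite X" "X \<subseteq> carrier A" for X
    using that
  proof (induction X rule: finite_induct)
    case empty
    show ?case by (rule exI[of _ 0]) auto
  next
    case (insert v X)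
    then obtain n :: nat and r s where rs: "r \<in> {..<n} \<rightarrow> carrier A" "s \<in> {..<n} \<rightarrow> carrier A"
      and fix_X: "\<And>x. x \<in> X \<Longrightarrow> P n r s x = x" and fix_s: "\<And>i. i < n \<Longrightarrow> P n r s (s i) = s i" by auto
    have v: "v \<in> carrier A" using insert by auto
    note PH = P[OF rs]
    note P' = mod_homD[OF PH]
    note [simp] = P'(1)
    define w where "w = v \<oplus>\<^bsub>A\<^esub> \<ominus>\<^bsub>A\<^esub> P n r s v"
    have w: "w \<in> carrier A" using v by (simp add: w_def)
    have PP: "P n r s (P n r s x) = P n r s x" if x: "x \<in> carrier A" for x
    proof -
      have "P n r s (P n r s x) = (\<Oplus>\<^bsub>A\<^esub>i\<in>{..<n}. P n r s (\<theta> (x \<otimes>\<^bsub>A\<^esub> r i) \<odot>\<^bsub>A\<^esub> s i))"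
        unfolding P_def[of n r s x] by (rule mod_hom_finsum[OF LM LM PH]) (use rs x in \<open>auto simp: Pi_iff\<close>)
      also have "\<dots> = P n r s x"
        unfolding P_def[of n r s x] by (rule M.finsum_cong') (use rs x fix_s P'(3) in \<open>auto simp: Pi_iff\<close>)
      finally show ?thesis .
    qed
    have Pw: "P n r s w = \<zero>\<^bsub>A\<^esub>"
      using v by (simp add: w_def P'(2) mod_hom_minus[OF LM LM PH] PP M.r_neg)
    have vw: "v = P n r s v \<oplus>\<^bsub>A\<^esub> w"
      using v by (simp add: w_def M.a_lcomm[of "P n r s v" v] M.r_neg)
    show ?case
    proof (cases "w = \<zero>\<^bsub>A\<^esub>")
      case True
      then have "P n r s v = v" using vw v by simp
      then show ?thesis using rs fix_X fix_s by (intro exI[of _ n] exI[of _ r] exI[of _ s]) auto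
    next
      case False
      \<comment> \<open>Some y pairs nontrivially with w, and rescaling it to u makes the pairing
        equal to one.\<close>
      then obtain y where y: "y \<in> carrier A" "\<theta> (w \<otimes>\<^bsub>A\<^esub> y) \<noteq> \<zero>\<^bsub>K\<^esub>" using nd1[OF w] by blast
      then have "\<theta> (w \<otimes>\<^bsub>A\<^esub> y) \<in> Units K" using K.field_Units w by auto
      then have iv: "inv\<^bsub>K\<^esub> \<theta> (w \<otimes>\<^bsub>A\<^esub> y) \<in> carrier K" "inv\<^bsub>K\<^esub> \<theta> (w \<otimes>\<^bsub>A\<^esub> y) \<otimes>\<^bsub>K\<^esub> \<theta> (w \<otimes>\<^bsub>A\<^esub> y) = \<one>\<^bsub>K\<^esub>" by auto
      define u where "u = inv\<^bsub>K\<^esub> \<theta> (w \<otimes>\<^bsub>A\<^esub> y) \<odot>\<^bsub>A\<^esub> y"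
      have u: "u \<in> carrier A" "\<theta> (w \<otimes>\<^bsub>A\<^esub> u) = \<one>\<^bsub>K\<^esub>"
        using iv y w t(3)[OF iv(1), of "w \<otimes>\<^bsub>A\<^esub> y"] by (auto simp: u_def smult_mult_right)
      \<comment> \<open>z represents the form sending x to \<theta>(P x u). Thus r0 = u - z pairs
        with x as u pairs with x - P x: to zero if \<open>P\<close> fixes x, and to one for x = w,
        since P w = 0.\<close>
      define z where "z = (\<Oplus>\<^bsub>A\<^esub>i\<in>{..<n}. \<theta> (s i \<otimes>\<^bsub>A\<^esub> u) \<odot>\<^bsub>A\<^esub> r i)"
      have z: "z \<in> carrier A" unfolding z_def using rs u by (auto simp: Pi_iff intro!: M.finsum_closed)
      have \<theta>z: "\<theta> (x \<otimes>\<^bsub>A\<^esub> z) = \<theta> (P n r s x \<otimes>\<^bsub>A\<^esub> u)" if x: "x \<in> carrier A" for x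
      proof -
        have h1: "(\<lambda>z. \<theta> (x \<otimes>\<^bsub>A\<^esub> z)) \<in> hom (add_monoid A) (add_monoid K)"
          using x by (auto simp: hom_def A.r_distr t)
        have h2: "(\<lambda>z. \<theta> (z \<otimes>\<^bsub>A\<^esub> u)) \<in> hom (add_monoid A) (add_monoid K)"
          using u by (auto simp: hom_def A.l_distr t)
        have "\<theta> (x \<otimes>\<^bsub>A\<^esub> z) = (\<Oplus>\<^bsub>K\<^esub>i\<in>{..<n}. \<theta> (x \<otimes>\<^bsub>A\<^esub> (\<theta> (s i \<otimes>\<^bsub>A\<^esub> u) \<odot>\<^bsub>A\<^esub> r i)))"
          unfolding z_def by (rule add_hom_finsum[OF M.abelian_group_axioms K.abelian_group_axioms h1])
            (use rs u in \<open>auto simp: Pi_iff\<close>)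
        also have "\<dots> = (\<Oplus>\<^bsub>K\<^esub>i\<in>{..<n}. \<theta> ((\<theta> (x \<otimes>\<^bsub>A\<^esub> r i) \<odot>\<^bsub>A\<^esub> s i) \<otimes>\<^bsub>A\<^esub> u))"
          by (rule K.finsum_cong') (use rs u x in \<open>auto simp: Pi_iff smult_mult_right smult_mult_left t K.m_comm\<close>)
        also have "\<dots> = \<theta> (P n r s x \<otimes>\<^bsub>A\<^esub> u)"
          unfolding P_def by (rule add_hom_finsum[OF M.abelian_group_axioms K.abelian_group_axioms h2, symmetric])
            (use rs x in \<open>auto simp: Pi_iff\<close>)
        finally show ?thesis .
      qed
      define r0 where "r0 = u \<oplus>\<^bsub>A\<^esub> \<ominus>\<^bsub>A\<^esub> z"
      have r0: "r0 \<in> carrier A" using u z by (simp add: r0_def)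
      have \<theta>r0: "\<theta> (x \<otimes>\<^bsub>A\<^esub> r0) = \<theta> (x \<otimes>\<^bsub>A\<^esub> u) \<oplus>\<^bsub>K\<^esub> \<ominus>\<^bsub>K\<^esub> \<theta> (P n r s x \<otimes>\<^bsub>A\<^esub> u)" if x: "x \<in> carrier A" for x
        using x u z by (simp add: r0_def A.r_distr t A.r_minus \<theta>minus \<theta>z)
      have \<theta>fix: "\<theta> (x \<otimes>\<^bsub>A\<^esub> r0) = \<zero>\<^bsub>K\<^esub>" if "x \<in> carrier A" "P n r s x = x" for x
        using \<theta>r0[OF that(1)] that u by (simp add: K.r_neg)
      have \<theta>w: "\<theta> (w \<otimes>\<^bsub>A\<^esub> r0) = \<one>\<^bsub>K\<^esub>"
        using \<theta>r0[OF w] u w Pw t(1) mod_hom_zero[OF LM LK \<theta>] by simp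
      define r' where "r' = r(n := r0)"
      define s' where "s' = s(n := w)"
      have rs': "r' \<in> {..<Suc n} \<rightarrow> carrier A" "s' \<in> {..<Suc n} \<rightarrow> carrier A"
        using rs r0 w by (auto simp: r'_def s'_def Pi_iff less_Suc_eq)
      have P'': "P (Suc n) r' s' x = \<theta> (x \<otimes>\<^bsub>A\<^esub> r0) \<odot>\<^bsub>A\<^esub> w \<oplus>\<^bsub>A\<^esub> P n r s x" if x: "x \<in> carrier A" for x
      proof -
        have "P (Suc n) r' s' x = \<theta> (x \<otimes>\<^bsub>A\<^esub> r' n) \<odot>\<^bsub>A\<^esub> s' n \<oplus>\<^bsub>A\<^esub> (\<Oplus>\<^bsub>A\<^esub>i\<in>{..<n}. \<theta> (x \<otimes>\<^bsub>A\<^esub> r' i) \<odot>\<^bsub>A\<^esub> s' i)"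
          unfolding P_def lessThan_Suc by (rule M.finsum_insert) (use rs' x in \<open>auto simp: Pi_iff\<close>)
        also have "(\<Oplus>\<^bsub>A\<^esub>i\<in>{..<n}. \<theta> (x \<otimes>\<^bsub>A\<^esub> r' i) \<odot>\<^bsub>A\<^esub> s' i) = P n r s x"
          unfolding P_def by (rule M.finsum_cong') (use rs x in \<open>auto simp: Pi_iff r'_def s'_def\<close>)
        moreover have "r' n = r0" "s' n = w" by (simp_all add: r'_def s'_def)
        ultimately show ?thesis by simp
      qed
      have fx: "P (Suc n) r' s' x = x" if "x \<in> carrier A" "P n r s x = x" for x
        using P''[OF that(1)] \<theta>fix[OF that] that w by (simp add: L.smult_zero_left)
      have fw: "P (Suc n) r' s' w = w"
        using P''[OF w] \<theta>w Pw w by (simp add: L.smult_one)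
      have fv: "P (Suc n) r' s' v = v"
      proof -
        have "P (Suc n) r' s' (P n r s v \<oplus>\<^bsub>A\<^esub> w) = P n r s v \<oplus>\<^bsub>A\<^esub> w"
          using mod_homD(2)[OF P[OF rs']] v w fx[OF _ PP] fw by simp
        then show ?thesis using vw by simp
      qed
      have "\<forall>x\<in>insert v X \<union> s' ` {..<Suc n}. P (Suc n) r' s' x = x"
      proof
        fix x assume "x \<in> insert v X \<union> s' ` {..<Suc n}"
        then consider "x = v" | "x \<in> X" | "x = w" | i where "i < n" "x = s i"
          by (auto simp: s'_def less_Suc_eq split: if_splits)
        then show "P (Suc n) r' s' x = x"
          by cases (use fv fw fx fix_X fix_s insert rs in \<open>auto simp: Pi_iff\<close>)
      qed
      then show ?thesis using rs' by blast
    qed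
  qed
  obtain X where X: "finite X" "X \<subseteq> carrier A" "\<And>H. submodule H K A \<Longrightarrow> X \<subseteq> H \<Longrightarrow> H = carrier A"
    using fg fin_gen_iff[OF LM] by auto
  obtain n :: nat and r s where rs: "r \<in> {..<n} \<rightarrow> carrier A" "s \<in> {..<n} \<rightarrow> carrier A"
    and fix_X: "\<And>x. x \<in> X \<Longrightarrow> P n r s x = x" using step[OF X(1,2)] by auto
  note P' = mod_homD[OF P[OF rs]]
  have "{x \<in> carrier A. P n r s x = x} = carrier A"
  proof (rule X(3))
    show "submodule {x \<in> carrier A. P n r s x = x} K A"
      by (rule L.submoduleI') (use P' mod_hom_zero[OF LM LM P[OF rs]] in auto)
  qed (use X fix_X in auto)
  then have 1: "P n r s x = x" if "x \<in> carrier A" for x using that by auto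
  \<comment> \<open>The second expansion is adjoint to the first: \<theta>(u z) = \<theta>(P u x) =
    \<theta>(u x) for all u, where z is the left-hand side, and nondegeneracy in the other variable
    gives z = x.\<close>
  have 2: "(\<Oplus>\<^bsub>A\<^esub>i\<in>{..<n}. \<theta> (s i \<otimes>\<^bsub>A\<^esub> x) \<odot>\<^bsub>A\<^esub> r i) = x" (is "?z = x") if x: "x \<in> carrier A" for x
  proof -
    have z: "?z \<in> carrier A" using rs x by (auto simp: Pi_iff intro!: M.finsum_closed)
    have "?z \<oplus>\<^bsub>A\<^esub> \<ominus>\<^bsub>A\<^esub> x = \<zero>\<^bsub>A\<^esub>"
    proof (rule nd2)
      fix u assume u: "u \<in> carrier A"
      have h1: "(\<lambda>z. \<theta> (u \<otimes>\<^bsub>A\<^esub> z)) \<in> hom (add_monoid A) (add_monoid K)"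
        using u by (auto simp: hom_def A.r_distr t)
      have h2: "(\<lambda>z. \<theta> (z \<otimes>\<^bsub>A\<^esub> x)) \<in> hom (add_monoid A) (add_monoid K)"
        using x by (auto simp: hom_def A.l_distr t)
      have "\<theta> (u \<otimes>\<^bsub>A\<^esub> ?z) = (\<Oplus>\<^bsub>K\<^esub>i\<in>{..<n}. \<theta> (u \<otimes>\<^bsub>A\<^esub> (\<theta> (s i \<otimes>\<^bsub>A\<^esub> x) \<odot>\<^bsub>A\<^esub> r i)))"
        by (rule add_hom_finsum[OF M.abelian_group_axioms K.abelian_group_axioms h1])
          (use rs x in \<open>auto simp: Pi_iff\<close>)
      also have "\<dots> = (\<Oplus>\<^bsub>K\<^esub>i\<in>{..<n}. \<theta> ((\<theta> (u \<otimes>\<^bsub>A\<^esub> r i) \<odot>\<^bsub>A\<^esub> s i) \<otimes>\<^bsub>A\<^esub> x))"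
        by (rule K.finsum_cong') (use rs u x in \<open>auto simp: Pi_iff smult_mult_right smult_mult_left t K.m_comm\<close>)
      also have "\<dots> = \<theta> (P n r s u \<otimes>\<^bsub>A\<^esub> x)"
        unfolding P_def by (rule add_hom_finsum[OF M.abelian_group_axioms K.abelian_group_axioms h2, symmetric])
          (use rs u in \<open>auto simp: Pi_iff\<close>)
      finally have "\<theta> (u \<otimes>\<^bsub>A\<^esub> ?z) = \<theta> (u \<otimes>\<^bsub>A\<^esub> x)" using 1[OF u] by simp
      then show "\<theta> (u \<otimes>\<^bsub>A\<^esub> (?z \<oplus>\<^bsub>A\<^esub> \<ominus>\<^bsub>A\<^esub> x)) = \<zero>\<^bsub>K\<^esub>"
        using u x z add_hom_minus[OF M.abelian_group_axioms K.abelian_group_axioms h1 x]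
        by (simp add: A.r_distr t K.r_neg)
    qed (use z x in auto)
    then show ?thesis using z x by (metis M.minus_equality M.minus_minus M.a_inv_closed)
  qed
  have "\<forall>x\<in>carrier A. (\<Oplus>\<^bsub>A\<^esub>i\<in>{..<n}. \<theta> (x \<otimes>\<^bsub>A\<^esub> r i) \<odot>\<^bsub>A\<^esub> s i) = x"
    using 1 unfolding P_def by blast
  moreover have "\<forall>x\<in>carrier A. (\<Oplus>\<^bsub>A\<^esub>i\<in>{..<n}. \<theta> (s i \<otimes>\<^bsub>A\<^esub> x) \<odot>\<^bsub>A\<^esub> r i) = x"
    using 2 by blast
  ultimately show ?thesis using rs by blast
qed

section \<open>Directed unions of Frobenius extensions\<close>

text \<open>The bimodule map and the dual elements of \<open>frobenius_extension\<close> for two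
  subsets of one ring. Sums and products are those of \<open>A\<close>, so elements of different
  stages combine without a change of record.\<close>

definition frobenius_data ::
    "('a, 's) ring_scheme \<Rightarrow> 'a set \<Rightarrow> 'a set \<Rightarrow> ('a \<Rightarrow> 'a) \<Rightarrow> nat \<Rightarrow> (nat \<Rightarrow> 'a) \<Rightarrow> (nat \<Rightarrow> 'a) \<Rightarrow> bool" where
  "frobenius_data A B C \<Phi> n x y \<longleftrightarrow>
     (\<forall>c\<in>C. \<Phi> c \<in> B) \<and> (\<forall>c\<in>C. \<forall>d\<in>C. \<Phi> (c \<oplus>\<^bsub>A\<^esub> d) = \<Phi> c \<oplus>\<^bsub>A\<^esub> \<Phi> d) \<and>
     (\<forall>b\<in>B. \<forall>c\<in>C. \<Phi> (b \<otimes>\<^bsub>A\<^esub> c) = b \<otimes>\<^bsub>A\<^esub> \<Phi> c) \<and>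
     (\<forall>b\<in>B. \<forall>c\<in>C. \<Phi> (c \<otimes>\<^bsub>A\<^esub> b) = \<Phi> c \<otimes>\<^bsub>A\<^esub> b) \<and>
     (\<forall>i\<in>{1..n}. x i \<in> C) \<and> (\<forall>i\<in>{1..n}. y i \<in> C) \<and>
     (\<forall>c\<in>C. (\<Oplus>\<^bsub>A\<^esub>i\<in>{1..n}. y i \<otimes>\<^bsub>A\<^esub> \<Phi> (x i \<otimes>\<^bsub>A\<^esub> c)) = c) \<and>
     (\<forall>c\<in>C. (\<Oplus>\<^bsub>A\<^esub>i\<in>{1..n}. \<Phi> (c \<otimes>\<^bsub>A\<^esub> y i) \<otimes>\<^bsub>A\<^esub> x i) = c)"

lemma frobenius_dataD:
  assumes "frobenius_data A B C \<Phi> n x y"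
  shows "\<And>c. c \<in> C \<Longrightarrow> \<Phi> c \<in> B"
    "\<And>c d. \<lbrakk>c \<in> C; d \<in> C\<rbrakk> \<Longrightarrow> \<Phi> (c \<oplus>\<^bsub>A\<^esub> d) = \<Phi> c \<oplus>\<^bsub>A\<^esub> \<Phi> d"
    "\<And>b c. \<lbrakk>b \<in> B; c \<in> C\<rbrakk> \<Longrightarrow> \<Phi> (b \<otimes>\<^bsub>A\<^esub> c) = b \<otimes>\<^bsub>A\<^esub> \<Phi> c"
    "\<And>b c. \<lbrakk>b \<in> B; c \<in> C\<rbrakk> \<Longrightarrow> \<Phi> (c \<otimes>\<^bsub>A\<^esub> b) = \<Phi> c \<otimes>\<^bsub>A\<^esub> b"
    "\<And>i. i \<in> {1..n} \<Longrightarrow> x i \<in> C" "\<And>i. i \<in> {1..n} \<Longrightarrow> y i \<in> C"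
    "\<And>c. c \<in> C \<Longrightarrow> (\<Oplus>\<^bsub>A\<^esub>i\<in>{1..n}. y i \<otimes>\<^bsub>A\<^esub> \<Phi> (x i \<otimes>\<^bsub>A\<^esub> c)) = c"
    "\<And>c. c \<in> C \<Longrightarrow> (\<Oplus>\<^bsub>A\<^esub>i\<in>{1..n}. \<Phi> (c \<otimes>\<^bsub>A\<^esub> y i) \<otimes>\<^bsub>A\<^esub> x i) = c"
  using assms unfolding frobenius_data_def by simp_all

text \<open>Passing to the opposite ring exchanges the two linearity conditions and the two
  expansions, hence also \<open>x\<close> and \<open>y\<close>.\<close>

lemma frobenius_data_opp:
  "frobenius_data A B C \<Phi> n x y \<Longrightarrow> frobenius_data (opp A) B C \<Phi> n y x"
  by (simp add: frobenius_data_def)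

text \<open>The directed system in a form that is stable under passing to the opposite ring: each
  stage has dual bases, and it has Frobenius data in some larger stage containing prescribed
  elements.\<close>

locale frobenius_tower = ring A for A (structure) +
  fixes F :: "'a set" and \<S> :: "'a set set"
  assumes stages: "\<S> \<noteq> {}"
    and stage_subring: "B \<in> \<S> \<Longrightarrow> subring B A"
    and stage_dual: "B \<in> \<S> \<Longrightarrow> \<exists>\<theta> n r s. frobenius_ring (A\<lparr>carrier := B\<rparr>) F \<theta> n r s"
    and stage_ext: "\<lbrakk>B \<in> \<S>; finite X; X \<subseteq> carrier A\<rbrakk>
      \<Longrightarrow> \<exists>C\<in>\<S>. B \<subseteq> C \<and> X \<subseteq> C \<and> (\<exists>\<Phi> n x y. frobenius_data A B C \<Phi> n x y)"
begin

lemma frobenius_tower_opp: "frobenius_tower (opp A) F \<S>"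
proof (intro frobenius_tower.intro frobenius_tower_axioms.intro)
  show "ring (opp A)" by (rule ring_opp)
  show "\<S> \<noteq> {}" by (rule stages)
  fix B assume B: "B \<in> \<S>"
  show "subring B (opp A)" by (rule subring_opp[OF stage_subring[OF B]])
  show "\<exists>\<theta> n r s. frobenius_ring ((opp A)\<lparr>carrier := B\<rparr>) F \<theta> n r s"
    using stage_dual[OF B] frobenius_ring.frobenius_ring_opp unfolding opp_carrier[symmetric] by blast
  fix X :: "'a set" assume "finite X" "X \<subseteq> carrier (opp A)"
  then show "\<exists>C\<in>\<S>. B \<subseteq> C \<and> X \<subseteq> C \<and> (\<exists>\<Phi> n x y. frobenius_data (opp A) B C \<Phi> n x y)"
    using stage_ext[OF B, of X] frobenius_data_opp[of A B] unfolding opp_simps by meson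
qed

lemma stage_baer:
  assumes B: "B \<in> \<S>"
  shows "baer (A\<lparr>carrier := B\<rparr>) (lmod (\<lambda>x. x) A)"
  unfolding baer_def
proof (intro allI impI, elim conjE)
  let ?R = "A\<lparr>carrier := B\<rparr>"
  note Bs = subringE[OF stage_subring[OF B]]
  obtain \<theta> n r s where fr: "frobenius_ring ?R F \<theta> n r s" using stage_dual[OF B] by blast
  interpret R: frobenius_ring ?R F \<theta> n r s by fact
  let ?L = "lmod (\<lambda>x. x) ?R"
  fix I f assume I: "submodule I ?R ?L" and f: "f \<in> mod_hom ?R (?L\<lparr>carrier := I\<rparr>) (lmod (\<lambda>x. x) A)"
  have L: "left_module ?R ?L" by (rule R.lmod_self)
  note I' = left_module.submoduleD[OF L I, simplified]
  have f': "\<And>u. u \<in> I \<Longrightarrow> f u \<in> carrier A"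
    "\<And>u v. \<lbrakk>u \<in> I; v \<in> I\<rbrakk> \<Longrightarrow> f (u \<oplus> v) = f u \<oplus> f v"
    "\<And>b u. \<lbrakk>b \<in> B; u \<in> I\<rbrakk> \<Longrightarrow> f (b \<otimes> u) = b \<otimes> f u"
    using mod_homD[OF f, simplified] by (auto simp: lmod_def)
  have F_B: "F \<subseteq> B" using subringE(1)[OF R.F_subring] by simp
  have IF: "submodule I R.Fr ?L"
    by (rule left_module.submoduleI'[OF R.lmod_F]) (use I' F_B in auto)
  have LI: "left_module R.Fr (?L\<lparr>carrier := I\<rparr>)"
    by (rule left_module.submodule_left_module[OF R.lmod_F IF])
  \<comment> \<open>Generators of \<open>I\<close> over the ground field. There are finitely many,
    so some stage \<open>C\<close> above \<open>B\<close> contains their images; it then contains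
    all of f(I), because it also contains \<open>F\<close>.\<close>
  obtain X where X: "finite X" "X \<subseteq> I" "\<And>H. submodule H R.Fr (?L\<lparr>carrier := I\<rparr>) \<Longrightarrow> X \<subseteq> H \<Longrightarrow> H = I"
    using R.fin_gen_F_submodule[OF R.lmod_F R.fin_gen_F IF] fin_gen_iff[OF LI] by auto
  obtain C \<Phi> m x y where C: "C \<in> \<S>" "B \<subseteq> C" "f ` X \<subseteq> C" and P: "frobenius_data A B C \<Phi> m x y"
  proof -
    have "finite (f ` X)" "f ` X \<subseteq> carrier A" using X(1,2) f'(1) by auto
    from stage_ext[OF B this] that show thesis by blast
  qed
  note Cs = subringE[OF stage_subring[OF C(1)]]
  note P = frobenius_dataD[OF P]
  have fz: "f \<zero> = \<zero>"
  proof -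
    have "f \<zero> = f (\<zero> \<otimes> \<zero>)" by simp
    also have "\<dots> = \<zero> \<otimes> f \<zero>" by (rule f'(3)[OF Bs(2) I'(2)])
    also have "\<dots> = \<zero>" using f'(1)[OF I'(2)] by simp
    finally show ?thesis .
  qed
  have "{u \<in> I. f u \<in> C} = I"
  proof (rule X(3))
    show "submodule {u \<in> I. f u \<in> C} R.Fr (?L\<lparr>carrier := I\<rparr>)"
      by (rule left_module.submoduleI'[OF LI]) (use I' F_B C(2) Cs f' fz Bs in \<open>auto simp: lmod_def subset_iff\<close>)
    show "X \<subseteq> {u \<in> I. f u \<in> C}" using X C(3) by auto
  qed
  then have fC: "f u \<in> C" if "u \<in> I" for u using that by auto
  \<comment> \<open>The i-th component of \<open>f\<close> along C : B. It has values in
    \<open>B\<close> and is linear on the left, so the self-injectivity of \<open>B\<close> makes it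
    a right multiplication by some b_i.\<close>
  have "\<exists>b\<in>carrier ?L. \<forall>u\<in>I. \<Phi> (f u \<otimes> y i) = u \<odot>\<^bsub>?L\<^esub> b" if i: "i \<in> {1..m}" for i
  proof (rule baerD[OF R.self_injective L])
    have yi: "y i \<in> C" "y i \<in> carrier A" using P(6)[OF i] Cs(1) by auto
    show "I \<subseteq> carrier ?R" "\<zero>\<^bsub>?R\<^esub> \<in> I" using I' by auto
    show "a \<oplus>\<^bsub>?R\<^esub> b \<in> I" if "a \<in> I" "b \<in> I" for a b using I' that by auto
    show "a \<otimes>\<^bsub>?R\<^esub> b \<in> I" if "a \<in> carrier ?R" "b \<in> I" for a b using I' that by auto
    fix a assume a: "a \<in> I"
    show "\<Phi> (f a \<otimes> y i) \<in> carrier ?L" using P(1) Cs(6) fC[OF a] yi by simp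
    fix b assume b: "b \<in> I"
    have "\<Phi> (f (a \<oplus> b) \<otimes> y i) = \<Phi> (f a \<otimes> y i \<oplus> f b \<otimes> y i)"
      using f'(1)[OF a] f'(1)[OF b] f'(2)[OF a b] yi by (simp add: l_distr)
    then show "\<Phi> (f (a \<oplus>\<^bsub>?R\<^esub> b) \<otimes> y i) = \<Phi> (f a \<otimes> y i) \<oplus>\<^bsub>?L\<^esub> \<Phi> (f b \<otimes> y i)"
      using P(2) Cs(6) fC a b yi by simp
  next
    have yi: "y i \<in> C" "y i \<in> carrier A" using P(6)[OF i] Cs(1) by auto
    fix a b assume a: "a \<in> carrier ?R" and b: "b \<in> I"
    have "\<Phi> (f (a \<otimes> b) \<otimes> y i) = \<Phi> (a \<otimes> (f b \<otimes> y i))"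
      using f'(1)[OF b] f'(3)[OF _ b, of a] a Bs(1) yi by (simp add: m_assoc subset_iff)
    then show "\<Phi> (f (a \<otimes>\<^bsub>?R\<^esub> b) \<otimes> y i) = a \<odot>\<^bsub>?L\<^esub> \<Phi> (f b \<otimes> y i)"
      using P(3) Cs(6) fC a b yi by simp
  qed
  then obtain b where b: "\<And>i. i \<in> {1..m} \<Longrightarrow> b i \<in> B \<and> (\<forall>u\<in>I. \<Phi> (f u \<otimes> y i) = u \<otimes> b i)"
    by simp metis
  have cl: "x i \<in> carrier A" "b i \<in> carrier A" if "i \<in> {1..m}" for i
    using b[OF that] P(5)[OF that] Cs(1) Bs(1) by auto
  show "\<exists>x\<in>carrier (lmod (\<lambda>x. x) A). \<forall>u\<in>I. f u = u \<odot>\<^bsub>lmod (\<lambda>x. x) A\<^esub> x"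
  proof (intro bexI ballI)
    \<comment> \<open>The components reassemble as f u = sum of \<Phi>(f u y_i) x_i, and each
      coefficient is u b_i; this is where the multiplier comes from.\<close>
    show "(\<Oplus>i\<in>{1..m}. b i \<otimes> x i) \<in> carrier (lmod (\<lambda>x. x) A)"
      using cl by (auto intro!: finsum_closed)
    fix u assume u: "u \<in> I"
    then have uA: "u \<in> carrier A" using I' Bs(1) by auto
    have "f u = (\<Oplus>i\<in>{1..m}. \<Phi> (f u \<otimes> y i) \<otimes> x i)" using P(8)[OF fC[OF u]] by simp
    also have "\<dots> = (\<Oplus>i\<in>{1..m}. u \<otimes> (b i \<otimes> x i))"
      by (rule finsum_cong') (use b u uA cl in \<open>auto simp: m_assoc\<close>)
    also have "\<dots> = u \<otimes> (\<Oplus>i\<in>{1..m}. b i \<otimes> x i)"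
      using left_module.smult_finsum[OF lmod_self uA, of "\<lambda>i. b i \<otimes> x i" "{1..m}"] cl by (simp add: Pi_iff)
    finally show "f u = u \<odot>\<^bsub>lmod (\<lambda>x. x) A\<^esub> (\<Oplus>i\<in>{1..m}. b i \<otimes> x i)" by simp
  qed
qed

lemma stage_left:
  assumes B: "B \<in> \<S>"
  shows "injective_module TX TY (A\<lparr>carrier := B\<rparr>) (lmod (\<lambda>x. x) A)"
    and "projective_module TX TY (A\<lparr>carrier := B\<rparr>) (lmod (\<lambda>x. x) A)"
    and "flat_left_module TX TY (A\<lparr>carrier := B\<rparr>) (lmod (\<lambda>x. x) A)"
proof -
  obtain \<theta> n r s where fr: "frobenius_ring (A\<lparr>carrier := B\<rparr>) F \<theta> n r s" using stage_dual[OF B] by blast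
  interpret R: frobenius_ring "A\<lparr>carrier := B\<rparr>" F \<theta> n r s by fact
  have L: "left_module (A\<lparr>carrier := B\<rparr>) (lmod (\<lambda>x. x) A)"
    by (rule lmod_left_module[OF stage_subring[OF B]])
  note h = R.baer_higman[OF L stage_baer[OF B]]
  show "injective_module TX TY (A\<lparr>carrier := B\<rparr>) (lmod (\<lambda>x. x) A)"
    by (rule baer_injective[OF L stage_baer[OF B]])
  show "projective_module TX TY (A\<lparr>carrier := B\<rparr>) (lmod (\<lambda>x. x) A)"
    by (rule R.higman_projective[OF h])
  show "flat_left_module TX TY (A\<lparr>carrier := B\<rparr>) (lmod (\<lambda>x. x) A)"
    by (rule R.higman_flat_left[OF h])
qed

lemma stage_right:
  assumes B: "B \<in> \<S>"
  shows "injective_module TX TY (opp (A\<lparr>carrier := B\<rparr>)) (rmod (\<lambda>x. x) A)"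
    and "projective_module TX TY (opp (A\<lparr>carrier := B\<rparr>)) (rmod (\<lambda>x. x) A)"
    and "flat_right_module TX TY (A\<lparr>carrier := B\<rparr>) (rmod (\<lambda>x. x) A)"
proof -
  obtain \<theta> n r s where fr: "frobenius_ring (A\<lparr>carrier := B\<rparr>) F \<theta> n r s" using stage_dual[OF B] by blast
  interpret R: frobenius_ring "A\<lparr>carrier := B\<rparr>" F \<theta> n r s by fact
  interpret O: frobenius_ring "opp (A\<lparr>carrier := B\<rparr>)" F \<theta> n s r by (rule R.frobenius_ring_opp)
  have L: "left_module (opp (A\<lparr>carrier := B\<rparr>)) (rmod (\<lambda>x. x) A)"
    by (rule rmod_right_module[OF stage_subring[OF B]])
  \<comment> \<open>\<open>baer\<close> looks at the carrier, the addition and the action of its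
    module, and in these \<open>rmod\<close> over \<open>A\<close> agrees with \<open>lmod\<close>
    over the opposite ring.\<close>
  have b: "baer (opp (A\<lparr>carrier := B\<rparr>)) (rmod (\<lambda>x. x) A)"
    using frobenius_tower.stage_baer[OF frobenius_tower_opp B]
    by (simp add: baer_def mod_hom_def opp_carrier)
  note h = O.baer_higman[OF L b]
  show "injective_module TX TY (opp (A\<lparr>carrier := B\<rparr>)) (rmod (\<lambda>x. x) A)"
    by (rule baer_injective[OF L b])
  show "projective_module TX TY (opp (A\<lparr>carrier := B\<rparr>)) (rmod (\<lambda>x. x) A)"
    by (rule O.higman_projective[OF h])
  show "flat_right_module TX TY (A\<lparr>carrier := B\<rparr>) (rmod (\<lambda>x. x) A)"
    by (rule R.higman_flat_right[OF h])
qed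

end

section \<open>From a locally Frobenius algebra to a tower of Frobenius rings\<close>

lemma (in ring) subring_carrier_update:
  assumes "subring H R" "subring B R" "H \<subseteq> B"
  shows "subring H (R\<lparr>carrier := B\<rparr>)"
  using ring.ring_incl_imp_subring[OF subring_is_ring[OF assms(2)], of H] subring_is_ring[OF assms(1)] assms(3)
  by simp

context locally_frobenius
begin

lemma mono: "(l, l') \<in> rel \<Longrightarrow> S l \<subseteq> S l'"
  using proper by (cases "l = l'") auto

lemma rel_props:
  "trans rel" "antisym rel" "(l, l') \<in> rel \<Longrightarrow> l \<in> \<Lambda> \<and> l' \<in> \<Lambda>" "l \<in> \<Lambda> \<Longrightarrow> (l, l) \<in> rel"
  using shape by (auto simp: shape_def partial_order_on_def preorder_on_def refl_on_def)

lemma initial_le: "l \<in> \<Lambda> \<Longrightarrow> S l0 \<subseteq> S l"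
  using shape by (intro mono) (auto simp: shape_def)

text \<open>Upper bounds are taken one element at a time; starting from \<open>l\<close> keeps the
  resulting stage above it.\<close>

lemma finite_in_stage:
  assumes "finite X" "X \<subseteq> carrier A" "l \<in> \<Lambda>"
  shows "\<exists>u\<in>\<Lambda>. (l, u) \<in> rel \<and> X \<subseteq> S u"
  using assms(1,2)
proof (induction X rule: finite_induct)
  case empty
  then show ?case using assms(3) rel_props(4) by auto
next
  case (insert x X)
  then obtain u where u: "u \<in> \<Lambda>" "(l, u) \<in> rel" "X \<subseteq> S u" by auto
  obtain l' where l': "l' \<in> \<Lambda>" "x \<in> S l'" using insert union by auto
  obtain v where v: "v \<in> \<Lambda>" "(u, v) \<in> rel" "(l', v) \<in> rel"
    using shape u(1) l'(1) unfolding shape_def by blast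
  then have "(l, v) \<in> rel" using u(2) rel_props(1) by (auto dest: transD)
  then show ?case using v mono[OF v(2)] mono[OF v(3)] u l' by blast
qed

lemma stage_frobenius_ring:
  assumes l: "l \<in> \<Lambda>"
  shows "\<exists>\<theta> n r s. frobenius_ring (A\<lparr>carrier := S l\<rparr>) (S l0) \<theta> n r s"
proof -
  let ?B = "A\<lparr>carrier := S l\<rparr>"
  note Sl = subringE[OF subring[OF l]]
  have l0: "l0 \<in> \<Lambda>" using shape by (auto simp: shape_def)
  obtain \<theta> where B: "k_algebra K ?B" "fin_gen K ?B" "frobenius_form K ?B \<theta>"
    using symmetric[OF l] by (auto simp: symmetric_frobenius_def)
  obtain n :: nat and r s where rs: "r \<in> {..<n} \<rightarrow> carrier ?B" "s \<in> {..<n} \<rightarrow> carrier ?B"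
    "\<forall>x\<in>carrier ?B. (\<Oplus>\<^bsub>?B\<^esub>i\<in>{..<n}. \<theta> (x \<otimes>\<^bsub>?B\<^esub> r i) \<odot>\<^bsub>?B\<^esub> s i) = x"
    "\<forall>x\<in>carrier ?B. (\<Oplus>\<^bsub>?B\<^esub>i\<in>{..<n}. \<theta> (s i \<otimes>\<^bsub>?B\<^esub> x) \<odot>\<^bsub>?B\<^esub> r i) = x"
    using k_algebra.frobenius_dual_basis[OF B(1,3,2)] by blast
  interpret B: ring ?B by (rule subring_is_ring[OF subring[OF l]])
  have "\<theta> \<in> mod_hom K ?B (lmod (\<lambda>c. c) K)" using B(3) by (simp add: frobenius_form_def)
  note t = mod_homD[OF this, simplified]
  have SA: "x \<in> S l \<Longrightarrow> x \<in> carrier A" for x using Sl(1) by auto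
  have sc: "(c \<odot>\<^bsub>A\<^esub> \<one>\<^bsub>A\<^esub>) \<otimes>\<^bsub>A\<^esub> x = c \<odot>\<^bsub>A\<^esub> x" "x \<otimes>\<^bsub>A\<^esub> (c \<odot>\<^bsub>A\<^esub> \<one>\<^bsub>A\<^esub>) = c \<odot>\<^bsub>A\<^esub> x"
    if "c \<in> carrier K" "x \<in> carrier A" for c x
    using that by (simp_all add: smult_mult_left smult_mult_right)
  have F: "\<exists>d\<in>carrier K. c = d \<odot>\<^bsub>A\<^esub> \<one>\<^bsub>A\<^esub>" if "c \<in> S l0" for c
    using that initial by auto
  have FI: "c \<odot>\<^bsub>A\<^esub> \<one>\<^bsub>A\<^esub> \<in> S l0" if "c \<in> carrier K" for c
    using that initial by auto
  \<comment> \<open>The given form has values in \<open>K\<close>. The unit map moves them into the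
    subring \<open>S l0\<close> of \<open>A\<close>, the copy of k over which the stages are
    algebras.\<close>
  define \<theta>' where "\<theta>' x = \<theta> x \<odot>\<^bsub>A\<^esub> \<one>\<^bsub>A\<^esub>" for x
  have "frobenius_ring ?B (S l0) \<theta>' n r s"
  proof (intro frobenius_ring.intro frobenius_ring_axioms.intro)
    show "ring ?B" by (rule B.ring_axioms)
    show "subring (S l0) ?B"
      by (rule subring_carrier_update[OF subring[OF l0] subring[OF l] initial_le[OF l]])
  next
    fix c x assume c: "c \<in> S l0" and x: "x \<in> carrier ?B"
    obtain d where d: "d \<in> carrier K" "c = d \<odot>\<^bsub>A\<^esub> \<one>\<^bsub>A\<^esub>" using F[OF c] by blast
    show "c \<otimes>\<^bsub>?B\<^esub> x = x \<otimes>\<^bsub>?B\<^esub> c" using x d sc SA by simp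
    show "\<theta>' (c \<otimes>\<^bsub>?B\<^esub> x) = c \<otimes>\<^bsub>?B\<^esub> \<theta>' x"
    proof -
      have "c \<otimes>\<^bsub>A\<^esub> \<theta>' x = d \<odot>\<^bsub>A\<^esub> \<theta>' x"
        unfolding d(2) by (rule sc(1)) (use d x t(1)[of x] in \<open>auto simp: \<theta>'_def\<close>)
      then show ?thesis using x d sc SA t(1)[of x] t(3)[of d x] by (simp add: \<theta>'_def smult_assoc1)
    qed
  next
    fix c assume c: "c \<in> S l0" "c \<noteq> \<zero>\<^bsub>?B\<^esub>"
    obtain d where d: "d \<in> carrier K" "c = d \<odot>\<^bsub>A\<^esub> \<one>\<^bsub>A\<^esub>" using F[OF c(1)] by blast
    then have "d \<noteq> \<zero>\<^bsub>K\<^esub>" using c(2) by auto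
    then have "d \<in> Units K" using d(1) K.field_Units by auto
    then have i: "inv\<^bsub>K\<^esub> d \<in> carrier K" "inv\<^bsub>K\<^esub> d \<otimes>\<^bsub>K\<^esub> d = \<one>\<^bsub>K\<^esub>" by auto
    have "(inv\<^bsub>K\<^esub> d \<odot>\<^bsub>A\<^esub> \<one>\<^bsub>A\<^esub>) \<otimes>\<^bsub>A\<^esub> c = (inv\<^bsub>K\<^esub> d \<otimes>\<^bsub>K\<^esub> d) \<odot>\<^bsub>A\<^esub> \<one>\<^bsub>A\<^esub>"
    proof -
      have "(inv\<^bsub>K\<^esub> d \<odot>\<^bsub>A\<^esub> \<one>\<^bsub>A\<^esub>) \<otimes>\<^bsub>A\<^esub> c = inv\<^bsub>K\<^esub> d \<odot>\<^bsub>A\<^esub> c"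
        by (rule sc(1)) (use d i in auto)
      then show ?thesis using d i(1) by (simp add: smult_assoc1)
    qed
    then show "\<exists>e\<in>S l0. e \<otimes>\<^bsub>?B\<^esub> c = \<one>\<^bsub>?B\<^esub>"
      using i FI[OF i(1)] by (intro bexI[of _ "inv\<^bsub>K\<^esub> d \<odot>\<^bsub>A\<^esub> \<one>\<^bsub>A\<^esub>"]) simp_all
  next
    fix x assume x: "x \<in> carrier ?B"
    show "\<theta>' x \<in> S l0" using x t(1) FI by (simp add: \<theta>'_def)
    have "(\<Oplus>\<^bsub>?B\<^esub>i\<in>{..<n}. \<theta>' (x \<otimes>\<^bsub>?B\<^esub> r i) \<otimes>\<^bsub>?B\<^esub> s i) = (\<Oplus>\<^bsub>?B\<^esub>i\<in>{..<n}. \<theta> (x \<otimes>\<^bsub>?B\<^esub> r i) \<odot>\<^bsub>?B\<^esub> s i)"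
      by (rule B.finsum_cong') (use x rs Sl(6) SA t(1) smult_sub[OF l, simplified] in \<open>auto simp: \<theta>'_def sc Pi_iff\<close>)
    then show "(\<Oplus>\<^bsub>?B\<^esub>i\<in>{..<n}. \<theta>' (x \<otimes>\<^bsub>?B\<^esub> r i) \<otimes>\<^bsub>?B\<^esub> s i) = x" using rs(3) x by simp
    have "(\<Oplus>\<^bsub>?B\<^esub>i\<in>{..<n}. r i \<otimes>\<^bsub>?B\<^esub> \<theta>' (s i \<otimes>\<^bsub>?B\<^esub> x)) = (\<Oplus>\<^bsub>?B\<^esub>i\<in>{..<n}. \<theta> (s i \<otimes>\<^bsub>?B\<^esub> x) \<odot>\<^bsub>?B\<^esub> r i)"
      by (rule B.finsum_cong') (use x rs Sl(6) SA t(1) smult_sub[OF l, simplified] in \<open>auto simp: \<theta>'_def sc Pi_iff\<close>)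
    then show "(\<Oplus>\<^bsub>?B\<^esub>i\<in>{..<n}. r i \<otimes>\<^bsub>?B\<^esub> \<theta>' (s i \<otimes>\<^bsub>?B\<^esub> x)) = x" using rs(4) x by simp
    fix y assume y: "y \<in> carrier ?B"
    show "\<theta>' (x \<oplus>\<^bsub>?B\<^esub> y) = \<theta>' x \<oplus>\<^bsub>?B\<^esub> \<theta>' y"
      using x y t by (simp add: \<theta>'_def smult_l_distr)
  qed (use rs in \<open>auto simp: Pi_iff\<close>)
  then show ?thesis by blast
qed

lemma stage_frobenius_data:
  assumes "(l, l') \<in> rel" "l \<noteq> l'"
  shows "\<exists>\<Phi> n x y. frobenius_data A (S l) (S l') \<Phi> n x y"
proof -
  let ?B = "A\<lparr>carrier := S l\<rparr>" and ?C = "A\<lparr>carrier := S l'\<rparr>"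
  have ll: "l \<in> \<Lambda>" "l' \<in> \<Lambda>" using rel_props(3)[OF assms(1)] by auto
  note Cs = subringE[OF subring[OF ll(2)]]
  note BC = mono[OF assms(1)]
  obtain \<Phi> and n :: nat and x y where *: "\<Phi> \<in> mod_hom ?B (lmod (\<lambda>x. x) ?C) (lmod (\<lambda>b. b) ?B)"
    "\<Phi> \<in> mod_hom (opp ?B) (rmod (\<lambda>x. x) ?C) (rmod (\<lambda>b. b) ?B)"
    "x \<in> {1..n} \<rightarrow> carrier ?C" "y \<in> {1..n} \<rightarrow> carrier ?C"
    "\<forall>c\<in>carrier ?C.
           (\<Oplus>\<^bsub>?C\<^esub>i\<in>{1..n}. y i \<otimes>\<^bsub>?C\<^esub> \<Phi> (x i \<otimes>\<^bsub>?C\<^esub> c)) = c \<and>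
           (\<Oplus>\<^bsub>?C\<^esub>i\<in>{1..n}. \<Phi> (c \<otimes>\<^bsub>?C\<^esub> y i) \<otimes>\<^bsub>?C\<^esub> x i) = c"
    using free_frobenius[OF assms] unfolding free_frobenius_extension_def frobenius_extension_def by blast
  note P = mod_homD[OF *(1), simplified] and P' = mod_homD(3)[OF *(2), simplified]
  have ab: "abelian_group A" "abelian_group ?C"
    using subring_is_ring[OF subring[OF ll(2)]] by (auto intro: abelian_group_axioms ring.is_abelian_group)
  have fs: "finsum ?C g {1..n} = finsum A g {1..n}" if "g \<in> {1..n} \<rightarrow> S l'" for g
    by (rule finsum_carrier_update[OF ab Cs(1) that])
  have PC: "\<Phi> c \<in> S l'" if "c \<in> S l'" for c using P(1)[OF that] BC by auto
  have xy: "x i \<in> S l'" "y i \<in> S l'" if "i \<in> {1..n}" for i using *(3,4) that by (auto simp: Pi_iff)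
  have "frobenius_data A (S l) (S l') \<Phi> n x y"
    unfolding frobenius_data_def
  proof (intro conjI ballI)
    fix c assume c: "c \<in> S l'"
    have "(\<lambda>i. y i \<otimes>\<^bsub>A\<^esub> \<Phi> (x i \<otimes>\<^bsub>A\<^esub> c)) \<in> {1..n} \<rightarrow> S l'" "(\<lambda>i. \<Phi> (c \<otimes>\<^bsub>A\<^esub> y i) \<otimes>\<^bsub>A\<^esub> x i) \<in> {1..n} \<rightarrow> S l'"
      using xy PC Cs(6) c by auto
    from fs[OF this(1)] fs[OF this(2)]
    show "(\<Oplus>\<^bsub>A\<^esub>i\<in>{1..n}. y i \<otimes>\<^bsub>A\<^esub> \<Phi> (x i \<otimes>\<^bsub>A\<^esub> c)) = c" "(\<Oplus>\<^bsub>A\<^esub>i\<in>{1..n}. \<Phi> (c \<otimes>\<^bsub>A\<^esub> y i) \<otimes>\<^bsub>A\<^esub> x i) = c"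
      using *(5) c by simp_all
  qed (use P P' xy in auto)
  then show ?thesis by blast
qed

lemma frobenius_tower: "frobenius_tower A (S l0) (S ` \<Lambda>)"
proof (intro frobenius_tower.intro frobenius_tower_axioms.intro)
  show "ring A" by (rule A.ring_axioms)
  show "S ` \<Lambda> \<noteq> {}" using shape by (auto simp: shape_def)
  fix B assume "B \<in> S ` \<Lambda>"
  then obtain l where l: "l \<in> \<Lambda>" "B = S l" by auto
  show "subring B A" unfolding l(2) by (rule subring[OF l(1)])
  show "\<exists>\<theta> n r s. frobenius_ring (A\<lparr>carrier := B\<rparr>) (S l0) \<theta> n r s"
    unfolding l(2) by (rule stage_frobenius_ring[OF l(1)])
  fix X :: "'a set" assume X: "finite X" "X \<subseteq> carrier A"
  obtain u where u: "u \<in> \<Lambda>" "(l, u) \<in> rel" "X \<subseteq> S u" using finite_in_stage[OF X l(1)] by blast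
  \<comment> \<open>u may equal l, but Frobenius data is provided only for distinct indices. A step
    strictly beyond u, together with antisymmetry, gives v different from l.\<close>
  obtain v where v: "v \<in> \<Lambda>" "(u, v) \<in> rel" "u \<noteq> v" using shape u(1) unfolding shape_def by blast
  have lv: "(l, v) \<in> rel" using u(2) v(2) rel_props(1) by (auto dest: transD)
  moreover have "l \<noteq> v" using u(2) v(2,3) rel_props(2) by (auto dest: antisymD)
  ultimately have "\<exists>\<Phi> n x y. frobenius_data A B (S v) \<Phi> n x y"
    unfolding l(2) by (rule stage_frobenius_data)
  then show "\<exists>C\<in>S ` \<Lambda>. B \<subseteq> C \<and> X \<subseteq> C \<and> (\<exists>\<Phi> n x y. frobenius_data A B C \<Phi> n x y)"
    using mono[OF lv] mono[OF v(2)] u(3) v(1) l(2) by blast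
qed

end

section \<open>Free modules, quotients and base change\<close>

lemma std_free_simps [simp]:
  "carrier (std_free R n) = {..<n} \<rightarrow>\<^sub>E carrier R"
  "ring.zero (std_free R n) = (\<lambda>i\<in>{..<n}. \<zero>\<^bsub>R\<^esub>)"
  "add (std_free R n) x y = (\<lambda>i\<in>{..<n}. x i \<oplus>\<^bsub>R\<^esub> y i)"
  "smult (std_free R n) r x = (\<lambda>i\<in>{..<n}. r \<otimes>\<^bsub>R\<^esub> x i)"
  by (simp_all add: std_free_def)

lemma (in ring) std_free_left_module: "left_module R (std_free R n)"
proof (rule left_moduleI)
  show "ring R" by (rule ring_axioms)
  show "abelian_group (std_free R n)"
  proof (rule abelian_groupI)
    fix f assume "f \<in> carrier (std_free R n)"
    then show "\<exists>g\<in>carrier (std_free R n). g \<oplus>\<^bsub>std_free R n\<^esub> f = \<zero>\<^bsub>std_free R n\<^esub>"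
      by (intro bexI[of _ "\<lambda>s\<in>{..<n}. \<ominus> f s"]) (auto simp: PiE_iff l_neg intro!: restrict_ext)
  next
    fix f assume "f \<in> carrier (std_free R n)"
    then show "\<zero>\<^bsub>std_free R n\<^esub> \<oplus>\<^bsub>std_free R n\<^esub> f = f"
      by (auto intro!: ext simp: PiE_iff extensional_def)
  qed (auto simp: PiE_iff a_ac intro!: restrict_ext)
next
  fix f assume "f \<in> carrier (std_free R n)"
  then show "\<one> \<odot>\<^bsub>std_free R n\<^esub> f = f"
    by (auto intro!: ext simp: PiE_iff extensional_def)
qed (auto simp: PiE_iff m_assoc l_distr r_distr intro!: restrict_ext)

lemma (in ring) std_vec_closed: "std_vec R n i \<in> carrier (std_free R n)"
  by (auto simp: std_vec_def)

lemma (in ring) std_free_expand: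
  assumes "v \<in> carrier (std_free R n)"
  shows "(\<Oplus>\<^bsub>std_free R n\<^esub>i\<in>{..<n}. v i \<odot>\<^bsub>std_free R n\<^esub> std_vec R n i) = v"
proof
  interpret S: left_module R "std_free R n" by (rule std_free_left_module)
  have v: "v i \<in> carrier R" if "i < n" for i using assms that by auto
  have cl: "(\<lambda>i. v i \<odot>\<^bsub>std_free R n\<^esub> std_vec R n i) \<in> {..<n} \<rightarrow> carrier (std_free R n)"
    using v std_vec_closed by (auto intro!: S.smult_closed simp del: std_free_simps)
  fix j
  show "(\<Oplus>\<^bsub>std_free R n\<^esub>i\<in>{..<n}. v i \<odot>\<^bsub>std_free R n\<^esub> std_vec R n i) j = v j"
  proof (cases "j < n")
    case True
    have "(\<Oplus>\<^bsub>std_free R n\<^esub>i\<in>{..<n}. v i \<odot>\<^bsub>std_free R n\<^esub> std_vec R n i) j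
        = (\<Oplus>i\<in>{..<n}. (v i \<odot>\<^bsub>std_free R n\<^esub> std_vec R n i) j)"
      by (rule add_hom_finsum[OF S.M.abelian_group_axioms abelian_group_axioms _ cl, of "\<lambda>f. f j"])
         (use True in \<open>auto simp: hom_def\<close>)
    also have "\<dots> = (\<Oplus>i\<in>{..<n}. if j = i then v i else \<zero>)"
      by (rule finsum_cong') (use True v in \<open>auto simp: std_vec_def\<close>)
    also have "\<dots> = v j"
      using finsum_singleton[of j "{..<n}" v] True v by (auto simp: Pi_iff)
    finally show ?thesis .
  next
    case False
    have "(\<Oplus>\<^bsub>std_free R n\<^esub>i\<in>{..<n}. v i \<odot>\<^bsub>std_free R n\<^esub> std_vec R n i) \<in> carrier (std_free R n)"
      using cl by (rule S.M.finsum_closed)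
    then show ?thesis using False assms by (auto simp: PiE_iff extensional_def)
  qed
qed

lemma std_free_hom_expand:
  assumes "left_module R M" "g \<in> mod_hom R (std_free R n) M" "v \<in> carrier (std_free R n)"
  shows "g v = (\<Oplus>\<^bsub>M\<^esub>i\<in>{..<n}. v i \<odot>\<^bsub>M\<^esub> g (std_vec R n i))"
proof -
  interpret M: left_module R M by fact
  have S: "left_module R (std_free R n)" by (rule M.R.std_free_left_module)
  interpret S: left_module R "std_free R n" by fact
  have v: "v i \<in> carrier R" if "i < n" for i using assms that by auto
  note g = mod_homD[OF assms(2)]
  note sv = M.R.std_vec_closed[of n]
  have cl: "(\<lambda>i. v i \<odot>\<^bsub>std_free R n\<^esub> std_vec R n i) \<in> {..<n} \<rightarrow> carrier (std_free R n)"
    using v sv by (auto intro!: S.smult_closed simp del: std_free_simps)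
  have "g v = g (\<Oplus>\<^bsub>std_free R n\<^esub>i\<in>{..<n}. v i \<odot>\<^bsub>std_free R n\<^esub> std_vec R n i)"
    using M.R.std_free_expand[OF assms(3)] by simp
  also have "\<dots> = (\<Oplus>\<^bsub>M\<^esub>i\<in>{..<n}. g (v i \<odot>\<^bsub>std_free R n\<^esub> std_vec R n i))"
    by (rule mod_hom_finsum[OF S assms(1,2) cl])
  also have "\<dots> = (\<Oplus>\<^bsub>M\<^esub>i\<in>{..<n}. v i \<odot>\<^bsub>M\<^esub> g (std_vec R n i))"
    by (rule M.M.finsum_cong') (use v g sv M.smult_closed in \<open>auto simp del: std_free_simps\<close>)
  finally show ?thesis .
qed

lemma std_free_hom_eqI:
  assumes "left_module R M" "g \<in> mod_hom R (std_free R n) M" "g' \<in> mod_hom R (std_free R n) M"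
    and "\<And>i. i < n \<Longrightarrow> g (std_vec R n i) = g' (std_vec R n i)" and "v \<in> carrier (std_free R n)"
  shows "g v = g' v"
proof -
  interpret M: left_module R M by fact
  show ?thesis
    unfolding std_free_hom_expand[OF assms(1,2,5)] std_free_hom_expand[OF assms(1,3,5)]
    by (rule M.M.finsum_cong')
       (use assms(4,5) mod_homD(1)[OF assms(3) M.R.std_vec_closed] in \<open>auto intro!: M.smult_closed\<close>)
qed

lemma std_free_hom:
  assumes "left_module R M" "\<And>i. i < n \<Longrightarrow> x i \<in> carrier M"
  shows "(\<lambda>v. \<Oplus>\<^bsub>M\<^esub>i\<in>{..<n}. v i \<odot>\<^bsub>M\<^esub> x i) \<in> mod_hom R (std_free R n) M"
    and "\<And>j. j < n \<Longrightarrow> (\<Oplus>\<^bsub>M\<^esub>i\<in>{..<n}. std_vec R n j i \<odot>\<^bsub>M\<^esub> x i) = x j"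
proof -
  interpret M: left_module R M by fact
  show "(\<lambda>v. \<Oplus>\<^bsub>M\<^esub>i\<in>{..<n}. v i \<odot>\<^bsub>M\<^esub> x i) \<in> mod_hom R (std_free R n) M"
  proof (rule mod_homI)
    fix v assume "v \<in> carrier (std_free R n)"
    then have v: "\<And>i. i < n \<Longrightarrow> v i \<in> carrier R" by auto
    show "(\<Oplus>\<^bsub>M\<^esub>i\<in>{..<n}. v i \<odot>\<^bsub>M\<^esub> x i) \<in> carrier M"
      using v assms(2) by (auto intro!: M.M.finsum_closed M.smult_closed)
    fix w assume "w \<in> carrier (std_free R n)"
    then have w: "\<And>i. i < n \<Longrightarrow> w i \<in> carrier R" by auto
    have "(\<Oplus>\<^bsub>M\<^esub>i\<in>{..<n}. (v \<oplus>\<^bsub>std_free R n\<^esub> w) i \<odot>\<^bsub>M\<^esub> x i) = (\<Oplus>\<^bsub>M\<^esub>i\<in>{..<n}. v i \<odot>\<^bsub>M\<^esub> x i \<oplus>\<^bsub>M\<^esub> w i \<odot>\<^bsub>M\<^esub> x i)"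
      using v w assms(2) by (intro M.M.finsum_cong') (auto simp: M.smult_l_distr M.smult_closed)
    also have "\<dots> = (\<Oplus>\<^bsub>M\<^esub>i\<in>{..<n}. v i \<odot>\<^bsub>M\<^esub> x i) \<oplus>\<^bsub>M\<^esub> (\<Oplus>\<^bsub>M\<^esub>i\<in>{..<n}. w i \<odot>\<^bsub>M\<^esub> x i)"
      using v w assms(2) by (intro M.M.finsum_addf) (auto simp: M.smult_closed)
    finally show "(\<Oplus>\<^bsub>M\<^esub>i\<in>{..<n}. (v \<oplus>\<^bsub>std_free R n\<^esub> w) i \<odot>\<^bsub>M\<^esub> x i) = \<dots>" .
  next
    fix a v assume a: "a \<in> carrier R" and "v \<in> carrier (std_free R n)"
    then have v: "\<And>i. i < n \<Longrightarrow> v i \<in> carrier R" by auto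
    have "(\<Oplus>\<^bsub>M\<^esub>i\<in>{..<n}. (a \<odot>\<^bsub>std_free R n\<^esub> v) i \<odot>\<^bsub>M\<^esub> x i) = (\<Oplus>\<^bsub>M\<^esub>i\<in>{..<n}. a \<odot>\<^bsub>M\<^esub> (v i \<odot>\<^bsub>M\<^esub> x i))"
      using v a assms(2) by (intro M.M.finsum_cong') (auto simp: M.smult_assoc M.smult_closed)
    also have "\<dots> = a \<odot>\<^bsub>M\<^esub> (\<Oplus>\<^bsub>M\<^esub>i\<in>{..<n}. v i \<odot>\<^bsub>M\<^esub> x i)"
      using v a assms(2) by (intro M.smult_finsum[symmetric]) (auto simp: M.smult_closed)
    finally show "(\<Oplus>\<^bsub>M\<^esub>i\<in>{..<n}. (a \<odot>\<^bsub>std_free R n\<^esub> v) i \<odot>\<^bsub>M\<^esub> x i) = \<dots>" .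
  qed
  fix j assume j: "j < n"
  have "(\<Oplus>\<^bsub>M\<^esub>i\<in>{..<n}. std_vec R n j i \<odot>\<^bsub>M\<^esub> x i) = (\<Oplus>\<^bsub>M\<^esub>i\<in>{..<n}. if j = i then x i else \<zero>\<^bsub>M\<^esub>)"
    using assms(2) by (intro M.M.finsum_cong') (auto simp: std_vec_def M.smult_one M.smult_zero_left)
  also have "\<dots> = x j" using M.M.finsum_singleton[of j "{..<n}" x] j assms(2) by auto
  finally show "(\<Oplus>\<^bsub>M\<^esub>i\<in>{..<n}. std_vec R n j i \<odot>\<^bsub>M\<^esub> x i) = x j" .
qed

text \<open>\<open>Q\<close> is at first only a record with operations; a surjection that respects
  them carries the axioms over from \<open>P\<close>, negatives included.\<close>

lemma left_module_image:
  assumes "left_module R P" "\<pi> ` carrier P = carrier Q"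
    and add: "\<And>x y. \<lbrakk>x \<in> carrier P; y \<in> carrier P\<rbrakk> \<Longrightarrow> \<pi> (x \<oplus>\<^bsub>P\<^esub> y) = \<pi> x \<oplus>\<^bsub>Q\<^esub> \<pi> y"
    and zero: "\<pi> \<zero>\<^bsub>P\<^esub> = \<zero>\<^bsub>Q\<^esub>"
    and smult: "\<And>r x. \<lbrakk>r \<in> carrier R; x \<in> carrier P\<rbrakk> \<Longrightarrow> \<pi> (r \<odot>\<^bsub>P\<^esub> x) = r \<odot>\<^bsub>Q\<^esub> \<pi> x"
  shows "left_module R Q"
proof -
  interpret P: left_module R P by fact
  show ?thesis
  proof (rule left_moduleI)
    show "ring R" by (rule P.R.ring_axioms)
    show "abelian_group Q"
    proof (rule abelian_groupI)
      fix x assume "x \<in> carrier Q"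
      then obtain x' where x': "x' \<in> carrier P" "x = \<pi> x'" using assms(2) by auto
      have "\<pi> (\<ominus>\<^bsub>P\<^esub> x') \<oplus>\<^bsub>Q\<^esub> x = \<zero>\<^bsub>Q\<^esub>"
        using x' by (simp add: zero P.M.l_neg flip: add)
      then show "\<exists>y\<in>carrier Q. y \<oplus>\<^bsub>Q\<^esub> x = \<zero>\<^bsub>Q\<^esub>" using x' assms(2) by blast
    qed (auto simp flip: assms(2) add zero simp: P.M.a_ac)
  qed (auto simp flip: assms(2) add smult simp: P.smult_closed P.smult_l_distr P.smult_r_distr P.smult_assoc P.smult_one)
qed

section \<open>Quotient modules\<close>

definition cls :: "('r, 'm, 't) module_scheme \<Rightarrow> 'm set \<Rightarrow> 'm \<Rightarrow> 'm set" where
  "cls P N v = {w \<in> carrier P. w \<ominus>\<^bsub>P\<^esub> v \<in> N}"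

definition rep :: "('r, 'm, 't) module_scheme \<Rightarrow> 'm set \<Rightarrow> 'm set \<Rightarrow> 'm" where
  "rep P N U = (SOME v. v \<in> carrier P \<and> U = cls P N v)"

text \<open>The operations go through representatives chosen by \<open>rep\<close>. Classes are sets
  of elements of \<open>P\<close>, so quotients of standard free modules have elements of type
  \<open>(nat \<Rightarrow> 'a) set\<close>, the type of the descended modules in the
  theorem.\<close>

definition quot_mod :: "('r, 'm, 't) module_scheme \<Rightarrow> 'm set \<Rightarrow> ('r, 'm set) module" where
  "quot_mod P N = \<lparr>carrier = cls P N ` carrier P, monoid.mult = undefined, monoid.one = undefined,
     ring.zero = cls P N \<zero>\<^bsub>P\<^esub>, add = \<lambda>U V. cls P N (rep P N U \<oplus>\<^bsub>P\<^esub> rep P N V),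
     smult = \<lambda>r U. cls P N (r \<odot>\<^bsub>P\<^esub> rep P N U)\<rparr>"

locale quotient_module = left_module R P for R :: "('r, 's) ring_scheme" (structure)
    and P :: "('r, 'm, 't) module_scheme" (structure) +
  fixes N :: "'m set"
  assumes N: "submodule N R P"
begin

abbreviation "\<pi> \<equiv> cls P N"
abbreviation "Q \<equiv> quot_mod P N"

lemmas N' = submoduleD[OF N]

lemma cls_eq_iff:
  assumes "v \<in> carrier P" "w \<in> carrier P"
  shows "\<pi> v = \<pi> w \<longleftrightarrow> v \<ominus>\<^bsub>P\<^esub> w \<in> N"
proof
  assume "\<pi> v = \<pi> w"
  moreover have "v \<in> \<pi> v" using assms N'(2) by (simp add: cls_def M.minus_eq M.r_neg)
  ultimately show "v \<ominus>\<^bsub>P\<^esub> w \<in> N" by (simp add: cls_def)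
next
  have *: "\<pi> v \<subseteq> \<pi> w" if "v \<in> carrier P" "w \<in> carrier P" "v \<ominus>\<^bsub>P\<^esub> w \<in> N" for v w
  proof
    fix u assume u: "u \<in> \<pi> v"
    then have "(u \<ominus>\<^bsub>P\<^esub> v) \<oplus>\<^bsub>P\<^esub> (v \<ominus>\<^bsub>P\<^esub> w) \<in> N" using that N'(3) by (simp add: cls_def)
    moreover have "(u \<ominus>\<^bsub>P\<^esub> v) \<oplus>\<^bsub>P\<^esub> (v \<ominus>\<^bsub>P\<^esub> w) = u \<ominus>\<^bsub>P\<^esub> w"
      using that u by (simp add: cls_def M.minus_eq M.a_assoc M.l_neg M.a_lcomm[of "\<ominus>\<^bsub>P\<^esub> v" v] M.r_neg1 M.r_neg2)
    ultimately show "u \<in> \<pi> w" using u by (simp add: cls_def)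
  qed
  assume vw: "v \<ominus>\<^bsub>P\<^esub> w \<in> N"
  then have "w \<ominus>\<^bsub>P\<^esub> v \<in> N"
    using N'(5)[OF vw] assms by (simp add: M.minus_eq M.minus_add M.a_comm)
  then show "\<pi> v = \<pi> w" using * assms vw by blast
qed

lemma rep_prop: "U \<in> carrier Q \<Longrightarrow> rep P N U \<in> carrier P \<and> \<pi> (rep P N U) = U"
  unfolding rep_def quot_mod_def by (rule someI2_ex) auto

lemma carrier_Q: "carrier Q = \<pi> ` carrier P"
  by (simp add: quot_mod_def)

lemma rep_cls:
  assumes "v \<in> carrier P"
  shows "rep P N (\<pi> v) \<in> carrier P" "rep P N (\<pi> v) \<ominus>\<^bsub>P\<^esub> v \<in> N"
  using rep_prop[of "\<pi> v"] cls_eq_iff[of "rep P N (\<pi> v)" v] assms by (auto simp: carrier_Q)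

lemma cls_add:
  assumes "v \<in> carrier P" "w \<in> carrier P"
  shows "\<pi> (v \<oplus>\<^bsub>P\<^esub> w) = \<pi> v \<oplus>\<^bsub>Q\<^esub> \<pi> w"
proof -
  let ?v = "rep P N (\<pi> v)" and ?w = "rep P N (\<pi> w)"
  note r = rep_cls[OF assms(1)] rep_cls[OF assms(2)]
  have "(?v \<oplus>\<^bsub>P\<^esub> ?w) \<ominus>\<^bsub>P\<^esub> (v \<oplus>\<^bsub>P\<^esub> w) = (?v \<ominus>\<^bsub>P\<^esub> v) \<oplus>\<^bsub>P\<^esub> (?w \<ominus>\<^bsub>P\<^esub> w)"
    using r assms by (simp add: M.minus_eq M.minus_add M.a_ac)
  then have "\<pi> (?v \<oplus>\<^bsub>P\<^esub> ?w) = \<pi> (v \<oplus>\<^bsub>P\<^esub> w)"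
    using r assms N'(3) by (subst cls_eq_iff) auto
  then show ?thesis by (simp add: quot_mod_def)
qed

lemma cls_smult:
  assumes "r \<in> carrier R" "v \<in> carrier P"
  shows "\<pi> (r \<odot>\<^bsub>P\<^esub> v) = r \<odot>\<^bsub>Q\<^esub> \<pi> v"
proof -
  let ?v = "rep P N (\<pi> v)"
  note r = rep_cls[OF assms(2)]
  have "(r \<odot>\<^bsub>P\<^esub> ?v) \<ominus>\<^bsub>P\<^esub> (r \<odot>\<^bsub>P\<^esub> v) = r \<odot>\<^bsub>P\<^esub> (?v \<ominus>\<^bsub>P\<^esub> v)"
    using r assms by (simp add: M.minus_eq smult_r_distr smult_minus_right)
  then have "\<pi> (r \<odot>\<^bsub>P\<^esub> ?v) = \<pi> (r \<odot>\<^bsub>P\<^esub> v)"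
    using r assms N'(4) by (subst cls_eq_iff) (auto simp: smult_closed)
  then show ?thesis by (simp add: quot_mod_def)
qed

lemma quot_left_module: "left_module R Q"
  using carrier_Q cls_add cls_smult
  by (intro left_module_image[OF left_module_axioms, of \<pi>]) (auto simp: quot_mod_def)

lemma cls_hom: "\<pi> \<in> mod_hom R P Q"
  by (rule mod_homI) (auto simp: carrier_Q cls_add cls_smult)

lemma cls_zero_iff: "v \<in> carrier P \<Longrightarrow> \<pi> v = \<zero>\<^bsub>Q\<^esub> \<longleftrightarrow> v \<in> N"
proof -
  assume v: "v \<in> carrier P"
  have "v \<ominus>\<^bsub>P\<^esub> \<zero>\<^bsub>P\<^esub> = v"
    using v unfolding a_minus_def by (metis M.r_neg M.l_zero M.r_zero M.zero_closed M.a_inv_closed)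
  then show ?thesis using cls_eq_iff[OF v M.zero_closed] by (simp add: quot_mod_def)
qed

text \<open>The induced map is \<open>g\<close> of a representative; two representatives differ by
  an element of \<open>N\<close>, which \<open>g\<close> kills.\<close>

lemma quot_universal:
  assumes X: "left_module R X" and g: "g \<in> mod_hom R P X" and N0: "\<And>v. v \<in> N \<Longrightarrow> g v = \<zero>\<^bsub>X\<^esub>"
  shows "\<exists>h\<in>mod_hom R Q X. \<forall>v\<in>carrier P. h (\<pi> v) = g v"
proof
  interpret X: left_module R X by fact
  note g' = mod_homD[OF g]
  let ?h = "\<lambda>U. g (rep P N U)"
  have h: "?h (\<pi> v) = g v" if v: "v \<in> carrier P" for v
  proof -
    note r = rep_cls[OF v]
    have "g (rep P N (\<pi> v)) \<oplus>\<^bsub>X\<^esub> \<ominus>\<^bsub>X\<^esub> g v = \<zero>\<^bsub>X\<^esub>"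
      using N0[OF r(2)] r v g'(2)[of _ "\<ominus>\<^bsub>P\<^esub> v"] mod_hom_minus[OF left_module_axioms X g v] by (simp add: M.minus_eq)
    then show ?thesis using r v g'(1) by (metis X.M.minus_equality X.M.minus_minus X.M.a_inv_closed)
  qed
  show "?h \<in> mod_hom R Q X"
    by (rule mod_homI) (auto simp: carrier_Q h g' smult_closed simp flip: cls_add cls_smult)
  show "\<forall>v\<in>carrier P. ?h (\<pi> v) = g v" using h by auto
qed

end

section \<open>Extension of scalars from a subring\<close>

locale base_change_module = A?: ring A + left_module "A\<lparr>carrier := B\<rparr>" M
  for A :: "('a, 's) ring_scheme" (structure) and B :: "'a set" and M :: "('a, 'm, 't) module_scheme" +
  assumes subring: "subring B A"
begin

abbreviation "AM \<equiv> base_change (A\<lparr>carrier := B\<rparr>) A (\<lambda>x. x) M"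
abbreviation "A\<^sub>B \<equiv> rmod (\<lambda>x. x) A"

lemma pair: "tensor_pair (A\<lparr>carrier := B\<rparr>) A\<^sub>B M"
  using A.rmod_right_module[OF subring] left_module_axioms by (simp add: tensor_pair_def)

sublocale TP: tensor_pair "A\<lparr>carrier := B\<rparr>" A\<^sub>B M
  by (rule pair)

lemma AM_simps [simp]:
  "carrier AM = carrier TP.T" "ring.zero AM = \<one>\<^bsub>TP.T\<^esub>" "add AM = monoid.mult TP.T"
  "smult AM a = tensor_map (A\<lparr>carrier := B\<rparr>) A\<^sub>B M (\<lambda>b. a \<otimes> b) (\<lambda>m. m)"
  by (simp_all add: base_change_def)

lemma B_sub: "b \<in> B \<Longrightarrow> b \<in> carrier A"
  using subringE(1)[OF subring] by auto

lemma mult_hom: "a \<in> carrier A \<Longrightarrow> (\<lambda>b. a \<otimes> b) \<in> mod_hom (opp (A\<lparr>carrier := B\<rparr>)) A\<^sub>B A\<^sub>B"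
  by (rule mod_homI) (auto simp: A.r_distr A.m_assoc B_sub)

lemma id_hom: "(\<lambda>m. m) \<in> mod_hom R M M"
  by (auto simp: mod_hom_def)

lemma smult_T_hom: "a \<in> carrier A \<Longrightarrow> smult AM a \<in> hom TP.T TP.T"
  using tensor_map_hom(1)[OF pair pair mult_hom id_hom] by simp

lemma smult_pure:
  "\<lbrakk>a \<in> carrier A; b \<in> carrier A; m \<in> carrier M\<rbrakk> \<Longrightarrow> a \<odot>\<^bsub>AM\<^esub> TP.pure b m = TP.pure (a \<otimes> b) m"
  using tensor_map_hom(2)[OF pair pair mult_hom id_hom, of a b m] by simp

lemma AM_abelian: "abelian_group AM"
proof -
  interpret T: comm_group TP.T by (rule TP.comm_T)
  show ?thesis
    by (rule abelian_groupI) (auto simp: T.m_ac intro!: bexI[of _ "inv\<^bsub>TP.T\<^esub> _"])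
qed

text \<open>Each axiom for the action equates two maps that are additive in the element of the
  tensor product, so the axioms can be verified on pure tensors.\<close>

lemma AM_left_module: "left_module A AM"
proof (rule left_moduleI)
  interpret T: comm_group TP.T by (rule TP.comm_T)
  show "ring A" by (rule A.ring_axioms)
  show "abelian_group AM" by (rule AM_abelian)
  fix a x assume a: "a \<in> carrier A" and x: "x \<in> carrier AM"
  have x': "x \<in> carrier TP.T" using x by simp
  show "a \<odot>\<^bsub>AM\<^esub> x \<in> carrier AM"
    using hom_in_carrier[OF smult_T_hom[OF a] x'] by simp
  show "a \<odot>\<^bsub>AM\<^esub> (x \<oplus>\<^bsub>AM\<^esub> y) = a \<odot>\<^bsub>AM\<^esub> x \<oplus>\<^bsub>AM\<^esub> a \<odot>\<^bsub>AM\<^esub> y" if "y \<in> carrier AM" for y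
    using hom_mult[OF smult_T_hom[OF a] x', of y] that by simp
  fix b assume b: "b \<in> carrier A"
  have cl: "c \<odot>\<^bsub>AM\<^esub> u \<in> carrier TP.T" if "c \<in> carrier A" "u \<in> carrier TP.T" for c u
    using hom_in_carrier[OF smult_T_hom that(2)] that(1) by blast
  have dist: "c \<odot>\<^bsub>AM\<^esub> (u \<otimes>\<^bsub>TP.T\<^esub> v) = (c \<odot>\<^bsub>AM\<^esub> u) \<otimes>\<^bsub>TP.T\<^esub> (c \<odot>\<^bsub>AM\<^esub> v)"
    if "c \<in> carrier A" "u \<in> carrier TP.T" "v \<in> carrier TP.T" for c u v
    using hom_mult[OF smult_T_hom[OF that(1)] that(2,3)] .
  show "(a \<otimes> b) \<odot>\<^bsub>AM\<^esub> x = a \<odot>\<^bsub>AM\<^esub> (b \<odot>\<^bsub>AM\<^esub> x)"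
    using x'
  proof (induction x rule: TP.tensor_induct)
    case (pure x y)
    then show ?case using a b smult_pure[of a] smult_pure[of b] smult_pure[of "a \<otimes> b"] by (simp add: A.m_assoc del: AM_simps)
  next
    case (add u v)
    then show ?case using a b by (simp add: dist cl del: AM_simps)
  qed
  show "(a \<oplus> b) \<odot>\<^bsub>AM\<^esub> x = a \<odot>\<^bsub>AM\<^esub> x \<oplus>\<^bsub>AM\<^esub> b \<odot>\<^bsub>AM\<^esub> x"
    using x' unfolding AM_simps(3)
  proof (induction x rule: TP.tensor_induct)
    case (pure x y)
    then show ?case using a b smult_pure[of a] smult_pure[of b] smult_pure[of "a \<oplus> b"]
        TP.pure_add_left[of "a \<otimes> x" "b \<otimes> x" y] by (simp add: A.l_distr del: AM_simps)
  next
    case (add u v)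
    then show ?case using a b by (simp add: dist cl T.m_ac del: AM_simps)
  qed
next
  fix x assume "x \<in> carrier AM"
  then have "x \<in> carrier TP.T" by simp
  then show "\<one> \<odot>\<^bsub>AM\<^esub> x = x"
  proof (induction x rule: TP.tensor_induct)
    case (pure x y)
    then show ?case using smult_pure[of \<one> x y] by (simp del: AM_simps)
  next
    case (add u v)
    then show ?case using hom_mult[OF smult_T_hom, of \<one> u v] by (simp del: AM_simps)
  qed
qed

lemma pure_in_AM: "\<lbrakk>a \<in> carrier A; m \<in> carrier M\<rbrakk> \<Longrightarrow> TP.pure a m \<in> carrier AM"
  using TP.pure_closed by simp

text \<open>The adjunction between extension and restriction of scalars. The map exists by the
  universal property of the tensor product; its A-linearity is checked on pure tensors.\<close>

lemma AM_universal:
  assumes X: "left_module A X" and \<psi>: "\<psi> \<in> mod_hom (A\<lparr>carrier := B\<rparr>) M X"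
  obtains \<alpha> where "\<alpha> \<in> mod_hom A AM X"
    "\<And>a m. \<lbrakk>a \<in> carrier A; m \<in> carrier M\<rbrakk> \<Longrightarrow> \<alpha> (TP.pure a m) = a \<odot>\<^bsub>X\<^esub> \<psi> m"
proof -
  interpret X: left_module A X by fact
  interpret AM: left_module A AM by (rule AM_left_module)
  note p = mod_homD[OF \<psi>, simplified]
  obtain \<alpha> where \<alpha>: "\<alpha> \<in> hom TP.T (add_monoid X)"
    "\<And>a m. \<lbrakk>a \<in> carrier A\<^sub>B; m \<in> carrier M\<rbrakk> \<Longrightarrow> \<alpha> (TP.pure a m) = a \<odot>\<^bsub>X\<^esub> \<psi> m"
    by (rule TP.tensor_universal[OF X.M.a_comm_group, of "\<lambda>a m. a \<odot>\<^bsub>X\<^esub> \<psi> m"])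
       (auto simp: p X.smult_closed X.smult_l_distr X.smult_r_distr X.smult_assoc B_sub)
  have cl: "\<alpha> u \<in> carrier X" if "u \<in> carrier TP.T" for u
    using hom_in_carrier[OF \<alpha>(1) that] by simp
  have \<alpha>_add: "\<alpha> (u \<otimes>\<^bsub>TP.T\<^esub> v) = \<alpha> u \<oplus>\<^bsub>X\<^esub> \<alpha> v" if "u \<in> carrier TP.T" "v \<in> carrier TP.T" for u v
    using hom_mult[OF \<alpha>(1) that] by simp
  have "\<alpha> (a \<odot>\<^bsub>AM\<^esub> u) = a \<odot>\<^bsub>X\<^esub> \<alpha> u" if a: "a \<in> carrier A" and u: "u \<in> carrier TP.T" for a u
    using u
  proof (induction u rule: TP.tensor_induct)
    case (pure x y)
    then show ?case using a by (simp add: smult_pure \<alpha>(2) X.smult_assoc p del: AM_simps)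
  next
    case (add u v)
    have "a \<odot>\<^bsub>AM\<^esub> (u \<otimes>\<^bsub>TP.T\<^esub> v) = (a \<odot>\<^bsub>AM\<^esub> u) \<otimes>\<^bsub>TP.T\<^esub> (a \<odot>\<^bsub>AM\<^esub> v)"
      by (rule hom_mult[OF smult_T_hom[OF a] add(1,2)])
    moreover have "a \<odot>\<^bsub>AM\<^esub> u \<in> carrier TP.T" "a \<odot>\<^bsub>AM\<^esub> v \<in> carrier TP.T"
      using hom_in_carrier[OF smult_T_hom[OF a]] add(1,2) by blast+
    ultimately show ?case
      using add a cl by (simp add: \<alpha>_add X.smult_r_distr del: AM_simps)
  qed
  then have "\<alpha> \<in> mod_hom A AM X"
    by (intro mod_homI) (simp_all add: cl \<alpha>_add del: AM_simps(4))
  then show thesis by (rule that) (use \<alpha>(2) in simp)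
qed

lemma AM_hom_eqI:
  assumes "\<alpha> \<in> mod_hom A AM X" "\<beta> \<in> mod_hom A AM X"
    and "\<And>a m. \<lbrakk>a \<in> carrier A; m \<in> carrier M\<rbrakk> \<Longrightarrow> \<alpha> (TP.pure a m) = \<beta> (TP.pure a m)"
    and "u \<in> carrier AM"
  shows "\<alpha> u = \<beta> u"
proof -
  have h: "f \<in> hom TP.T (add_monoid X)" if "f \<in> mod_hom A AM X" for f
    using mod_homD[OF that] by (auto simp: hom_def)
  show ?thesis
    by (rule TP.tensor_hom_eqI[OF h[OF assms(1)] h[OF assms(2)]]) (use assms(3,4) in auto)
qed

text \<open>The A-linear map from A^m to the base change of \<open>M\<close> that \<pi> induces,
  with A^m in place of the base change of B^m. For the identity of B^m it is
  \<open>base_change_free\<close>.\<close>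

definition ext_map :: "nat \<Rightarrow> ((nat \<Rightarrow> 'a) \<Rightarrow> 'm) \<Rightarrow> (nat \<Rightarrow> 'a) \<Rightarrow> ('a \<times> 'm \<Rightarrow>\<^sub>0 int) set" where
  "ext_map m \<pi> v = (\<Oplus>\<^bsub>AM\<^esub>i\<in>{..<m}. TP.pure (v i) (\<pi> (std_vec (A\<lparr>carrier := B\<rparr>) m i)))"

context
  fixes m :: nat and \<pi>
  assumes \<pi>: "\<pi> \<in> mod_hom (A\<lparr>carrier := B\<rparr>) (std_free (A\<lparr>carrier := B\<rparr>) m) M"
begin

lemma \<pi>_std_vec: "\<pi> (std_vec (A\<lparr>carrier := B\<rparr>) m i) \<in> carrier M"
  using mod_homD(1)[OF \<pi> R.std_vec_closed] .

lemma ext_map_eq: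
  assumes "v \<in> carrier (std_free A m)"
  shows "ext_map m \<pi> v = (\<Oplus>\<^bsub>AM\<^esub>i\<in>{..<m}. v i \<odot>\<^bsub>AM\<^esub> TP.pure \<one> (\<pi> (std_vec (A\<lparr>carrier := B\<rparr>) m i)))"
proof -
  interpret AM: left_module A AM by (rule AM_left_module)
  have v: "v i \<in> carrier A" if "i < m" for i using assms that by auto
  show ?thesis
    unfolding ext_map_def
    by (rule AM.M.finsum_cong')
       (use v \<pi>_std_vec AM.smult_closed pure_in_AM in \<open>auto simp: smult_pure simp del: AM_simps\<close>)
qed

lemma ext_map_hom: "ext_map m \<pi> \<in> mod_hom A (std_free A m) AM"
proof -
  interpret AM: left_module A AM by (rule AM_left_module)
  interpret S: left_module A "std_free A m" by (rule A.std_free_left_module)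
  have *: "(\<lambda>v. \<Oplus>\<^bsub>AM\<^esub>i\<in>{..<m}. v i \<odot>\<^bsub>AM\<^esub> TP.pure \<one> (\<pi> (std_vec (A\<lparr>carrier := B\<rparr>) m i))) \<in> mod_hom A (std_free A m) AM"
    by (rule std_free_hom(1)[OF AM_left_module]) (rule pure_in_AM[OF A.one_closed \<pi>_std_vec])
  show ?thesis
    by (rule mod_homI)
       (use mod_homD[OF *] S.M.a_closed S.smult_closed in \<open>simp_all add: ext_map_eq del: AM_simps std_free_simps\<close>)
qed

lemma ext_map_vec: "i < m \<Longrightarrow> ext_map m \<pi> (std_vec A m i) = TP.pure \<one> (\<pi> (std_vec (A\<lparr>carrier := B\<rparr>) m i))"
  unfolding ext_map_eq[OF A.std_vec_closed]
  by (rule std_free_hom(2)[OF AM_left_module]) (use pure_in_AM[OF A.one_closed \<pi>_std_vec] in auto)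

text \<open>Coordinates in \<open>B\<close> can be moved across the tensor sign, which collects the
  sum into \<pi> v. This makes relations over \<open>B\<close> visible after base change.\<close>

lemma ext_map_sub:
  assumes v: "v \<in> carrier (std_free (A\<lparr>carrier := B\<rparr>) m)"
  shows "ext_map m \<pi> v = TP.pure \<one> (\<pi> v)"
proof -
  interpret AM: left_module A AM by (rule AM_left_module)
  have vB: "v i \<in> B" if "i < m" for i using v that by auto
  have h: "TP.pure \<one> \<in> hom (add_monoid M) (add_monoid AM)"
    using TP.pure_hom_right[of \<one>] by (auto simp: hom_def)
  have "TP.pure \<one> (\<pi> v) = TP.pure \<one> (\<Oplus>\<^bsub>M\<^esub>i\<in>{..<m}. v i \<odot>\<^bsub>M\<^esub> \<pi> (std_vec (A\<lparr>carrier := B\<rparr>) m i))"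
    using std_free_hom_expand[OF left_module_axioms \<pi> v] by simp
  also have "\<dots> = (\<Oplus>\<^bsub>AM\<^esub>i\<in>{..<m}. TP.pure \<one> (v i \<odot>\<^bsub>M\<^esub> \<pi> (std_vec (A\<lparr>carrier := B\<rparr>) m i)))"
    by (rule add_hom_finsum[OF M.abelian_group_axioms AM.M.abelian_group_axioms h])
       (use vB \<pi>_std_vec in \<open>auto intro!: smult_closed\<close>)
  also have "\<dots> = ext_map m \<pi> v"
    unfolding ext_map_def
  proof (rule AM.M.finsum_cong')
    fix i assume i: "i \<in> {..<m}"
    show "TP.pure \<one> (v i \<odot>\<^bsub>M\<^esub> \<pi> (std_vec (A\<lparr>carrier := B\<rparr>) m i)) = TP.pure (v i) (\<pi> (std_vec (A\<lparr>carrier := B\<rparr>) m i))"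
      using TP.pure_balanced[of "v i" \<one> "\<pi> (std_vec (A\<lparr>carrier := B\<rparr>) m i)"] vB[of i] i \<pi>_std_vec B_sub by simp
  qed (use vB B_sub \<pi>_std_vec pure_in_AM in \<open>auto simp del: AM_simps\<close>)
  finally show ?thesis by simp
qed

text \<open>Every pure tensor x (x) \<pi> v is the image of x v, by \<open>ext_map_sub\<close>, and
  images of a homomorphism are closed under sums.\<close>

lemma ext_map_surj:
  assumes "\<pi> ` carrier (std_free (A\<lparr>carrier := B\<rparr>) m) = carrier M"
  shows "ext_map m \<pi> ` carrier (std_free A m) = carrier AM"
proof
  interpret AM: left_module A AM by (rule AM_left_module)
  interpret S: left_module A "std_free A m" by (rule A.std_free_left_module)
  note e = mod_homD[OF ext_map_hom]
  show "ext_map m \<pi> ` carrier (std_free A m) \<subseteq> carrier AM" using e(1) by blast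
  show "carrier AM \<subseteq> ext_map m \<pi> ` carrier (std_free A m)"
  proof
    fix u assume "u \<in> carrier AM"
    then have "u \<in> carrier TP.T" by simp
    then show "u \<in> ext_map m \<pi> ` carrier (std_free A m)"
    proof (induction u rule: TP.tensor_induct)
      case (pure x y)
      then obtain v where v: "v \<in> carrier (std_free (A\<lparr>carrier := B\<rparr>) m)" "y = \<pi> v" using assms by blast
      have vA: "v \<in> carrier (std_free A m)" using v(1) B_sub by (auto simp: PiE_iff)
      have x: "x \<in> carrier A" using pure by simp
      have "TP.pure x y = ext_map m \<pi> (x \<odot>\<^bsub>std_free A m\<^esub> v)"
        using e(3)[OF x vA] ext_map_sub[OF v(1)] smult_pure[of x \<one> y] x v(2) pure(2)
        by (simp del: AM_simps std_free_simps)
      then show ?case using S.smult_closed[OF x vA] by blast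
    next
      case (add u v)
      then obtain u' v' where "u' \<in> carrier (std_free A m)" "u = ext_map m \<pi> u'"
        "v' \<in> carrier (std_free A m)" "v = ext_map m \<pi> v'" by blast
      then show ?case using e(2)[of u' v'] S.M.a_closed[of u' v']
        by (metis AM_simps(3) imageI)
    qed
  qed
qed

end

end

lemma base_change_map_hom:
  assumes "base_change_module A B M" "base_change_module A B N" "\<phi> \<in> mod_hom (A\<lparr>carrier := B\<rparr>) M N"
  shows "base_change_map (A\<lparr>carrier := B\<rparr>) A (\<lambda>x. x) N \<phi>
      \<in> mod_hom A (base_change (A\<lparr>carrier := B\<rparr>) A (\<lambda>x. x) M) (base_change (A\<lparr>carrier := B\<rparr>) A (\<lambda>x. x) N)"
    and "\<And>a m. \<lbrakk>a \<in> carrier A; m \<in> carrier M\<rbrakk> \<Longrightarrow> base_change_map (A\<lparr>carrier := B\<rparr>) A (\<lambda>x. x) N \<phi>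
      (pure_tensor (A\<lparr>carrier := B\<rparr>) (rmod (\<lambda>x. x) A) M a m) = pure_tensor (A\<lparr>carrier := B\<rparr>) (rmod (\<lambda>x. x) A) N a (\<phi> m)"
proof -
  interpret M: base_change_module A B M by fact
  interpret N: base_change_module A B N by fact
  have i: "(\<lambda>b. b) \<in> mod_hom (opp (A\<lparr>carrier := B\<rparr>)) (rmod (\<lambda>x. x) A) (rmod (\<lambda>x. x) A)"
    by (auto simp: mod_hom_def)
  note t = tensor_map_hom[OF M.pair N.pair i assms(3)]
  let ?f = "base_change_map (A\<lparr>carrier := B\<rparr>) A (\<lambda>x. x) N \<phi>"
  show pure: "?f (M.TP.pure a m) = N.TP.pure a (\<phi> m)" if "a \<in> carrier A" "m \<in> carrier M" for a m
    using t(2)[of a m] that by (simp add: base_change_map_def)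
  have h: "?f \<in> hom M.TP.T N.TP.T" using t(1) by (simp add: base_change_map_def)
  have "?f (a \<odot>\<^bsub>M.AM\<^esub> u) = a \<odot>\<^bsub>N.AM\<^esub> ?f u" if a: "a \<in> carrier A" and u: "u \<in> carrier M.TP.T" for a u
  proof (rule M.TP.tensor_hom_eqI[OF _ _ _ u])
    show "(\<lambda>u. ?f (a \<odot>\<^bsub>M.AM\<^esub> u)) \<in> hom M.TP.T N.TP.T"
      using Group.hom_compose[OF M.smult_T_hom[OF a] h] by (simp add: comp_def del: M.AM_simps)
    show "(\<lambda>u. a \<odot>\<^bsub>N.AM\<^esub> ?f u) \<in> hom M.TP.T N.TP.T"
      using Group.hom_compose[OF h N.smult_T_hom[OF a]] by (simp add: comp_def del: N.AM_simps)
    show "?f (a \<odot>\<^bsub>M.AM\<^esub> M.TP.pure x y) = a \<odot>\<^bsub>N.AM\<^esub> ?f (M.TP.pure x y)" if "x \<in> carrier M.A\<^sub>B" "y \<in> carrier M" for x y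
      using that a pure mod_homD(1)[OF assms(3)]
      by (simp add: M.smult_pure N.smult_pure del: M.AM_simps N.AM_simps)
  qed
  then show "?f \<in> mod_hom A M.AM N.AM"
    using hom_in_carrier[OF h] hom_mult[OF h]
    by (intro mod_homI) (simp_all del: M.AM_simps(4) N.AM_simps(4))
qed

section \<open>Descent of presentations to subrings\<close>

lemma std_vec_carrier_update [simp]: "std_vec (A\<lparr>carrier := B\<rparr>) n i = std_vec A n i"
  by (auto simp: std_vec_def fun_eq_iff)

context
  fixes A :: "('a, 's) ring_scheme" (structure) and B :: "'a set"
  assumes ringA: "ring A" and B: "subring B A"
begin

interpretation A: ring A by (rule ringA)

lemma base_change_moduleI: "left_module (A\<lparr>carrier := B\<rparr>) M \<Longrightarrow> base_change_module A B M"
  using B ringA by (simp add: base_change_module_def base_change_module_axioms_def)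

lemma std_free_sub: "v \<in> carrier (std_free (A\<lparr>carrier := B\<rparr>) n) \<Longrightarrow> v \<in> carrier (std_free A n)"
  using subringE(1)[OF B] by (auto simp: PiE_iff)

lemma std_free_submodule:
  "submodule (carrier (std_free (A\<lparr>carrier := B\<rparr>) m)) (A\<lparr>carrier := B\<rparr>) (std_free A m)"
  by (rule left_module.submoduleI'[OF left_module.restrict_scalars[OF A.std_free_left_module B]])
     (use subringE[OF B] in \<open>auto simp: PiE_iff\<close>)

lemma std_free_hom_restrict:
  assumes M: "left_module A M" and G: "G \<in> mod_hom A (std_free A m) M"
  shows "G \<in> mod_hom (A\<lparr>carrier := B\<rparr>) (std_free (A\<lparr>carrier := B\<rparr>) m) M"
  using mod_homD[OF G] std_free_sub[of _ m] subringE(1)[OF B]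
  by (intro mod_homI) (auto simp del: std_free_simps simp: std_free_def)

text \<open>The values at the standard vectors are the entries of a matrix; if they lie in
  \<open>B\<close>, then so do their combinations with coefficients in \<open>B\<close>.\<close>

lemma std_free_hom_stage:
  assumes F: "F \<in> mod_hom A (std_free A n) (std_free A m)"
    and entries: "\<And>j. j < n \<Longrightarrow> F (std_vec A n j) \<in> carrier (std_free (A\<lparr>carrier := B\<rparr>) m)"
  shows "F \<in> mod_hom (A\<lparr>carrier := B\<rparr>) (std_free (A\<lparr>carrier := B\<rparr>) n) (std_free (A\<lparr>carrier := B\<rparr>) m)"
proof -
  let ?R = "A\<lparr>carrier := B\<rparr>"
  have S: "left_module A (std_free A m)" by (rule A.std_free_left_module)
  interpret SR: left_module ?R "std_free A m" by (rule left_module.restrict_scalars[OF S B])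
  have cl: "F v \<in> carrier (std_free ?R m)" if v: "v \<in> carrier (std_free ?R n)" for v
  proof -
    have vi: "v i \<in> B" if "i < n" for i using v that by auto
    have "F v = (\<Oplus>\<^bsub>std_free A m\<^esub>i\<in>{..<n}. v i \<odot>\<^bsub>std_free A m\<^esub> F (std_vec A n i))"
      by (rule std_free_hom_expand[OF S F std_free_sub[OF v]])
    also have "\<dots> \<in> carrier (std_free ?R m)"
      by (rule SR.submodule_finsum[OF std_free_submodule])
         (use vi entries SR.submoduleD(4)[OF std_free_submodule] in \<open>auto simp del: std_free_simps\<close>)
    finally show ?thesis .
  qed
  note F' = mod_homD[OF std_free_hom_restrict[OF S F]]
  show ?thesis
    by (rule mod_homI) (use cl F'(2,3) in \<open>auto simp del: std_free_simps simp: std_free_def\<close>)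
qed

lemma base_change_free_ext_map:
  "base_change_free (A\<lparr>carrier := B\<rparr>) A (\<lambda>x. x) n =
     base_change_module.ext_map A B (std_free (A\<lparr>carrier := B\<rparr>) n) n (\<lambda>v. v)"
proof -
  interpret S: base_change_module A B "std_free (A\<lparr>carrier := B\<rparr>) n"
    by (rule base_change_moduleI[OF ring.std_free_left_module[OF A.subring_is_ring[OF B]]])
  show ?thesis by (intro ext) (simp only: base_change_free_def S.ext_map_def)
qed

text \<open>The map sending a (x) v to a v, from the universal property, is a left inverse, as is
  seen on standard vectors. Surjectivity is \<open>ext_map_surj\<close> for the identity.\<close>

lemma base_change_free_iso:
  "base_change_free (A\<lparr>carrier := B\<rparr>) A (\<lambda>x. x) n
     \<in> mod_iso A (std_free A n) (base_change (A\<lparr>carrier := B\<rparr>) A (\<lambda>x. x) (std_free (A\<lparr>carrier := B\<rparr>) n))"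
proof -
  let ?R = "A\<lparr>carrier := B\<rparr>" and ?f = "base_change_free (A\<lparr>carrier := B\<rparr>) A (\<lambda>x. x) n"
  interpret S: base_change_module A B "std_free ?R n"
    by (rule base_change_moduleI[OF ring.std_free_left_module[OF A.subring_is_ring[OF B]]])
  have i: "(\<lambda>v. v) \<in> mod_hom ?R (std_free ?R n) (std_free ?R n)" by (auto simp: mod_hom_def)
  have f: "?f \<in> mod_hom A (std_free A n) S.AM"
    unfolding base_change_free_ext_map by (rule S.ext_map_hom[OF i])
  have surj: "?f ` carrier (std_free A n) = carrier S.AM"
    unfolding base_change_free_ext_map by (rule S.ext_map_surj[OF i]) simp
  have vec: "?f (std_vec A n j) = S.TP.pure \<one> (std_vec A n j)" if "j < n" for j
    unfolding base_change_free_ext_map using S.ext_map_vec[OF i that] by simp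
  have L: "left_module A (std_free A n)" by (rule A.std_free_left_module)
  have idA: "(\<lambda>v. v) \<in> mod_hom A (std_free A n) (std_free A n)" by (auto simp: mod_hom_def)
  obtain \<alpha> where \<alpha>: "\<alpha> \<in> mod_hom A S.AM (std_free A n)"
    "\<And>a v. \<lbrakk>a \<in> carrier A; v \<in> carrier (std_free ?R n)\<rbrakk> \<Longrightarrow> \<alpha> (S.TP.pure a v) = a \<odot>\<^bsub>std_free A n\<^esub> v"
    using S.AM_universal[OF L std_free_hom_restrict[OF L idA]] by blast
  have "\<alpha> (?f v) = v" if "v \<in> carrier (std_free A n)" for v
  proof (rule std_free_hom_eqI[OF L mod_hom_comp[OF f \<alpha>(1)] idA _ that])
    fix j assume j: "j < n"
    have "std_vec A n j \<in> carrier (std_free ?R n)"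
      using ring.std_vec_closed[OF A.subring_is_ring[OF B], of n j] by simp
    then show "\<alpha> (?f (std_vec A n j)) = std_vec A n j"
      using vec[OF j] \<alpha>(2) left_moduleD(7)[OF L A.std_vec_closed] by (simp del: std_free_simps)
  qed
  then have "inj_on ?f (carrier (std_free A n))" by (rule inj_on_inverseI)
  then show ?thesis using f surj by (simp add: mod_iso_def bij_betw_def del: S.AM_simps std_free_simps)
qed

text \<open>M' is the cokernel over \<open>B\<close> of the matrix \<open>F\<close>. That its base
  change is \<open>M\<close> is seen by comparing two surjections from A^m, namely \<open>G\<close>
  onto \<open>M\<close> and \<tau> onto the base change, with the same kernel. The last conclusion
  also records the isomorphism on pure tensors, so that it can be used to check squares of
  homomorphisms.\<close>

lemma descent:
  fixes M :: "('a, 'm, 't) module_scheme"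
  assumes M: "left_module A M" and pres: "fin_presentation A M m n G F"
    and entries: "\<forall>j<n. F (std_vec A n j) \<in> carrier (std_free (A\<lparr>carrier := B\<rparr>) m)"
  defines "R \<equiv> A\<lparr>carrier := B\<rparr>"
  defines "N \<equiv> F ` carrier (std_free R n)"
  defines "M' \<equiv> quot_mod (std_free R m) N"
  shows "left_module R M'" "quotient_module R (std_free R m) N"
    and "fin_presentation R M' m n (cls (std_free R m) N) F"
    and "\<exists>G'. induced_presentation R A (\<lambda>x. x) M' m n (cls (std_free R m) N) F G' F \<and>
      fin_presentation A (base_change R A (\<lambda>x. x) M') m n G' F"
    and "\<exists>\<alpha>\<in>mod_iso A (base_change R A (\<lambda>x. x) M') M. \<forall>a\<in>carrier A. \<forall>v\<in>carrier (std_free R m).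
      \<alpha> (pure_tensor R (rmod (\<lambda>x. x) A) M' a (cls (std_free R m) N v)) = a \<odot>\<^bsub>M\<^esub> G v"
proof -
  note entries = entries[rule_format]
  let ?\<pi> = "cls (std_free R m) N" and ?bc = "base_change R A (\<lambda>x. x)" and ?bf = "base_change_free R A (\<lambda>x. x)"
    and ?bm = "base_change_map R A (\<lambda>x. x)" and ?pt = "pure_tensor R (rmod (\<lambda>x. x) A) M'"
    and ?ptm = "pure_tensor R (rmod (\<lambda>x. x) A) (std_free R m)"
    and ?ptn = "pure_tensor R (rmod (\<lambda>x. x) A) (std_free R n)"
  have p: "G \<in> mod_hom A (std_free A m) M" "F \<in> mod_hom A (std_free A n) (std_free A m)"
    "G ` carrier (std_free A m) = carrier M"
    "F ` carrier (std_free A n) = {x \<in> carrier (std_free A m). G x = \<zero>\<^bsub>M\<^esub>}"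
    using pres by (auto simp: fin_presentation_def)
  have ringR: "ring R" unfolding R_def by (rule A.subring_is_ring[OF B])
  have Sm: "left_module R (std_free R m)" and Sn: "left_module R (std_free R n)"
    by (rule ring.std_free_left_module[OF ringR])+
  have SA: "left_module A (std_free A m)" "left_module A (std_free A n)" by (rule A.std_free_left_module)+
  have FR: "F \<in> mod_hom R (std_free R n) (std_free R m)"
    unfolding R_def by (rule std_free_hom_stage[OF p(2) entries])
  have sub: "v \<in> carrier (std_free A k)" if "v \<in> carrier (std_free R k)" for v k
    using std_free_sub that by (simp add: R_def)
  have vecR: "std_vec A k j \<in> carrier (std_free R k)" for k j
    using ring.std_vec_closed[OF ringR, of k j] by (simp add: R_def)
  show qm: "quotient_module R (std_free R m) N"
    unfolding quotient_module_def quotient_module_axioms_def N_def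
    using Sm mod_hom_image_submodule[OF Sn Sm FR] by blast
  interpret Q: quotient_module R "std_free R m" N by fact
  show LM': "left_module R M'" unfolding M'_def by (rule Q.quot_left_module)
  have \<pi>: "?\<pi> \<in> mod_hom R (std_free R m) M'" unfolding M'_def by (rule Q.cls_hom)
  have \<pi>_surj: "?\<pi> ` carrier (std_free R m) = carrier M'" unfolding M'_def by (rule Q.carrier_Q[symmetric])
  have \<pi>0: "?\<pi> v = \<zero>\<^bsub>M'\<^esub> \<longleftrightarrow> v \<in> N" if "v \<in> carrier (std_free R m)" for v
    unfolding M'_def by (rule Q.cls_zero_iff[OF that])
  show "fin_presentation R M' m n ?\<pi> F"
    unfolding fin_presentation_def
  proof (intro conjI)
    show "F ` carrier (std_free R n) = {x \<in> carrier (std_free R m). ?\<pi> x = \<zero>\<^bsub>M'\<^esub>}"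
      unfolding N_def[symmetric] using \<pi>0 Q.N'(1) by blast
  qed (rule \<pi> FR \<pi>_surj)+
  interpret T: base_change_module A B M'
    using base_change_moduleI[of M'] LM' by (simp add: R_def)
  note fold = R_def[symmetric]
  define \<tau> where "\<tau> = T.ext_map m ?\<pi>"
  have \<tau>: "\<tau> \<in> mod_hom A (std_free A m) (?bc M')"
    unfolding \<tau>_def using T.ext_map_hom[unfolded fold, OF \<pi>] .
  have \<tau>_vec: "\<tau> (std_vec A m i) = ?pt \<one> (?\<pi> (std_vec A m i))" if "i < m" for i
    unfolding \<tau>_def using T.ext_map_vec[unfolded fold, OF \<pi> that] by (simp add: R_def)
  have \<tau>_sub: "\<tau> v = ?pt \<one> (?\<pi> v)" if "v \<in> carrier (std_free R m)" for v
    unfolding \<tau>_def using T.ext_map_sub[unfolded fold, OF \<pi> that] by (simp add: R_def)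
  have \<tau>_surj: "\<tau> ` carrier (std_free A m) = carrier (?bc M')"
    unfolding \<tau>_def using T.ext_map_surj[unfolded fold, OF \<pi> \<pi>_surj] .
  have TL: "left_module A (?bc M')" using T.AM_left_module[unfolded fold] .
  have MR: "left_module R M" unfolding R_def by (rule left_module.restrict_scalars[OF M B])
  have GR: "G \<in> mod_hom R (std_free R m) M" unfolding R_def by (rule std_free_hom_restrict[OF M p(1)])
  have GF: "G (F w) = \<zero>\<^bsub>M\<^esub>" if "w \<in> carrier (std_free A n)" for w
    using p(4) that by blast
  \<comment> \<open>Relations over \<open>B\<close> are relations over \<open>A\<close>, so
    \<open>G\<close> vanishes on \<open>N\<close> and descends to M'.\<close>
  obtain \<psi> where \<psi>: "\<psi> \<in> mod_hom R M' M" "\<And>v. v \<in> carrier (std_free R m) \<Longrightarrow> \<psi> (?\<pi> v) = G v"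
    using Q.quot_universal[OF MR GR] GF sub unfolding M'_def N_def by blast
  obtain \<alpha> where \<alpha>: "\<alpha> \<in> mod_hom A (?bc M') M"
    "\<And>a x. \<lbrakk>a \<in> carrier A; x \<in> carrier M'\<rbrakk> \<Longrightarrow> \<alpha> (?pt a x) = a \<odot>\<^bsub>M\<^esub> \<psi> x"
    using T.AM_universal[unfolded fold, OF M \<psi>(1)] by blast
  have \<alpha>_pure: "\<alpha> (?pt a (?\<pi> v)) = a \<odot>\<^bsub>M\<^esub> G v" if "a \<in> carrier A" "v \<in> carrier (std_free R m)" for a v
    using \<alpha>(2)[OF that(1) mod_homD(1)[OF \<pi> that(2)]] \<psi>(2)[OF that(2)] by simp
  \<comment> \<open>Comparing \<alpha> \<tau> with \<open>G\<close> on standard vectors is enough;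
    it shows at once that \<alpha> is onto and that the kernel of \<tau> lies in that of
    \<open>G\<close>.\<close>
  have \<alpha>\<tau>: "\<alpha> (\<tau> v) = G v" if "v \<in> carrier (std_free A m)" for v
  proof (rule std_free_hom_eqI[OF M mod_hom_comp[OF \<tau> \<alpha>(1)] p(1) _ that])
    fix i assume "i < m"
    then show "\<alpha> (\<tau> (std_vec A m i)) = G (std_vec A m i)"
      using \<tau>_vec \<alpha>_pure[OF A.one_closed vecR] left_moduleD(7)[OF M mod_homD(1)[OF p(1) A.std_vec_closed]] by simp
  qed
  have zero_hom: "(\<lambda>w. \<zero>\<^bsub>?bc M'\<^esub>) \<in> mod_hom A (std_free A n) (?bc M')"
  proof -
    interpret TL: left_module A "?bc M'" by (rule TL)
    show ?thesis by (rule mod_homI) (simp_all only: TL.M.zero_closed TL.M.l_zero TL.smult_zero_right)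
  qed
  \<comment> \<open>On a standard vector the value of \<open>F\<close> is itself an element of
    \<open>N\<close>, so it becomes zero in M' already before base change.\<close>
  have \<tau>F: "\<tau> (F w) = \<zero>\<^bsub>?bc M'\<^esub>" if "w \<in> carrier (std_free A n)" for w
  proof (rule std_free_hom_eqI[OF TL mod_hom_comp[OF p(2) \<tau>] zero_hom _ that])
    fix j assume j: "j < n"
    have e: "F (std_vec A n j) \<in> carrier (std_free R m)" using entries[OF j] by (simp add: R_def)
    have "F (std_vec A n j) \<in> N" unfolding N_def using vecR by blast
    then have "\<tau> (F (std_vec A n j)) = ?pt \<one> \<zero>\<^bsub>M'\<^esub>" using \<tau>_sub[OF e] \<pi>0[OF e] by simp
    also have "\<dots> = \<zero>\<^bsub>?bc M'\<^esub>" using T.TP.pure_zero_right[of \<one>, unfolded fold] T.AM_simps(2)[unfolded fold] by simp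
    finally show "\<tau> (F (std_vec A n j)) = \<zero>\<^bsub>?bc M'\<^esub>" .
  qed
  have iso: "\<alpha> \<in> mod_iso A (?bc M') M"
    unfolding mod_iso_def bij_betw_def
  proof (intro CollectI conjI)
    show "\<alpha> \<in> mod_hom A (?bc M') M" by fact
    \<comment> \<open>Lift both elements to A^m. The difference of the lifts lies in the kernel of
      \<open>G\<close>, hence by exactness in the image of \<open>F\<close>, and \<tau> kills
      it.\<close>
    show "inj_on \<alpha> (carrier (?bc M'))"
    proof (rule inj_onI)
      fix u u' assume uu: "u \<in> carrier (?bc M')" "u' \<in> carrier (?bc M')" "\<alpha> u = \<alpha> u'"
      obtain v where v: "v \<in> carrier (std_free A m)" "u = \<tau> v" using uu(1) unfolding \<tau>_surj[symmetric] by blast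
      obtain v' where v': "v' \<in> carrier (std_free A m)" "u' = \<tau> v'" using uu(2) unfolding \<tau>_surj[symmetric] by blast
      interpret S: left_module A "std_free A m" by (rule SA)
      interpret M: left_module A M by (rule M)
      interpret TL: left_module A "?bc M'" by (rule TL)
      let ?d = "v \<oplus>\<^bsub>std_free A m\<^esub> \<ominus>\<^bsub>std_free A m\<^esub> v'"
      have d: "?d \<in> carrier (std_free A m)" by (rule S.M.a_closed[OF v(1) S.M.a_inv_closed[OF v'(1)]])
      have G: "G v = G v'" using uu(3) \<alpha>\<tau> v v' by simp
      have "G ?d = G v \<oplus>\<^bsub>M\<^esub> \<ominus>\<^bsub>M\<^esub> G v'"
        using mod_homD(2)[OF p(1) v(1) S.M.a_inv_closed[OF v'(1)]] mod_hom_minus[OF SA(1) M p(1) v'(1)] by simp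
      then have "G ?d = \<zero>\<^bsub>M\<^esub>" using G mod_homD(1)[OF p(1) v'(1)] by (simp add: M.M.r_neg)
      then obtain w where "w \<in> carrier (std_free A n)" "?d = F w" using p(4) d by blast
      then have "\<tau> ?d = \<zero>\<^bsub>?bc M'\<^esub>" using \<tau>F by simp
      moreover have "\<tau> ?d = \<tau> v \<oplus>\<^bsub>?bc M'\<^esub> \<ominus>\<^bsub>?bc M'\<^esub> \<tau> v'"
        using mod_homD(2)[OF \<tau> v(1) S.M.a_inv_closed[OF v'(1)]] mod_hom_minus[OF SA(1) TL \<tau> v'(1)] by simp
      ultimately have "u \<oplus>\<^bsub>?bc M'\<^esub> \<ominus>\<^bsub>?bc M'\<^esub> u' = \<zero>\<^bsub>?bc M'\<^esub>" using v v' by simp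
      then show "u = u'"
        using uu(1,2) by (metis TL.M.minus_equality TL.M.minus_minus TL.M.a_inv_closed)
    qed
    show "\<alpha> ` carrier (?bc M') = carrier M"
      unfolding \<tau>_surj[symmetric] p(3)[symmetric] image_image using \<alpha>\<tau> by auto
  qed
  then show "\<exists>\<alpha>\<in>mod_iso A (?bc M') M. \<forall>a\<in>carrier A. \<forall>v\<in>carrier (std_free R m).
      \<alpha> (pure_tensor R (rmod (\<lambda>x. x) A) M' a (?\<pi> v)) = a \<odot>\<^bsub>M\<^esub> G v"
    using \<alpha>_pure unfolding R_def by blast
  have bcm: "base_change_module A B (std_free R k)" for k
    using base_change_moduleI[OF ring.std_free_left_module[OF ringR, unfolded R_def], of k] by (simp add: R_def)
  interpret Tm: base_change_module A B "std_free R m" by (rule bcm)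
  interpret Tn: base_change_module A B "std_free R n" by (rule bcm)
  have idR: "(\<lambda>v. v) \<in> mod_hom R (std_free R k) (std_free R k)" for k by (auto simp: mod_hom_def)
  have bf: "?bf k \<in> mod_iso A (std_free A k) (?bc (std_free R k))" for k
    unfolding R_def by (rule base_change_free_iso)
  then have bf_hom: "?bf k \<in> mod_hom A (std_free A k) (?bc (std_free R k))" for k
    by (simp add: mod_iso_def)
  have bf_m: "?bf m v = ?ptm \<one> v" if "v \<in> carrier (std_free R m)" for v
    using Tm.ext_map_sub[unfolded fold, OF idR that] base_change_free_ext_map[of m] by (simp add: R_def)
  have bf_n: "?bf n v = ?ptn \<one> v" if "v \<in> carrier (std_free R n)" for v
    using Tn.ext_map_sub[unfolded fold, OF idR that] base_change_free_ext_map[of n] by (simp add: R_def)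
  note bmp = base_change_map_hom[where A = A and B = B, unfolded fold, OF bcm T.base_change_module_axioms \<pi>]
  note bmF = base_change_map_hom[where A = A and B = B, unfolded fold, OF bcm bcm FR]
  \<comment> \<open>The map that base change makes out of the projection is \<tau>, and below the
    one made out of \<open>F\<close> is \<open>F\<close> again; both are compared on standard
    vectors.\<close>
  have G': "\<tau> a = ?bm M' ?\<pi> (?bf m a)" if "a \<in> carrier (std_free A m)" for a
  proof (rule std_free_hom_eqI[OF TL \<tau> mod_hom_comp[OF bf_hom bmp(1)] _ that])
    fix i assume "i < m"
    then show "\<tau> (std_vec A m i) = ?bm M' ?\<pi> (?bf m (std_vec A m i))"
      using \<tau>_vec bf_m[OF vecR] bmp(2)[OF A.one_closed vecR] by (simp add: R_def)
  qed
  have F': "?bf m (F a) = ?bm (std_free R m) F (?bf n a)" if "a \<in> carrier (std_free A n)" for a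
  proof (rule std_free_hom_eqI[OF Tm.AM_left_module[unfolded fold] mod_hom_comp[OF p(2) bf_hom] mod_hom_comp[OF bf_hom bmF(1)] _ that])
    fix j assume "j < n"
    then have "F (std_vec A n j) \<in> carrier (std_free R m)" using entries by (simp add: R_def)
    then show "?bf m (F (std_vec A n j)) = ?bm (std_free R m) F (?bf n (std_vec A n j))"
      using bf_m bf_n[OF vecR] bmF(2)[OF A.one_closed vecR] by (simp add: R_def)
  qed
  have "induced_presentation R A (\<lambda>x. x) M' m n ?\<pi> F \<tau> F"
    unfolding induced_presentation_def using bf G' F' mod_homD(1)[OF p(2)] by blast
  moreover have "fin_presentation A (?bc M') m n \<tau> F"
    unfolding fin_presentation_def
  proof (intro conjI)
    show "F ` carrier (std_free A n) = {x \<in> carrier (std_free A m). \<tau> x = \<zero>\<^bsub>?bc M'\<^esub>}"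
    proof
      show "F ` carrier (std_free A n) \<subseteq> {x \<in> carrier (std_free A m). \<tau> x = \<zero>\<^bsub>?bc M'\<^esub>}"
        using mod_homD(1)[OF p(2)] \<tau>F by blast
      have "x \<in> F ` carrier (std_free A n)" if x: "x \<in> carrier (std_free A m)" "\<tau> x = \<zero>\<^bsub>?bc M'\<^esub>" for x
      proof -
        have "G x = \<zero>\<^bsub>M\<^esub>" using \<alpha>\<tau>[OF x(1)] x(2) mod_hom_zero[OF TL M \<alpha>(1)] by simp
        then show ?thesis using p(4) x(1) by blast
      qed
      then show "{x \<in> carrier (std_free A m). \<tau> x = \<zero>\<^bsub>?bc M'\<^esub>} \<subseteq> F ` carrier (std_free A n)"
        by blast
    qed
  qed (rule \<tau> p(2) \<tau>_surj)+
  ultimately show "\<exists>G'. induced_presentation R A (\<lambda>x. x) M' m n ?\<pi> F G' F \<and> fin_presentation A (?bc M') m n G' F"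
    by blast
qed

end

section \<open>Coherence\<close>

lemma fin_gen_std_free:
  assumes M: "left_module R M" and "fin_gen R M"
  obtains n :: nat and x where "\<And>i. i < n \<Longrightarrow> x i \<in> carrier M"
    "(\<lambda>v. \<Oplus>\<^bsub>M\<^esub>i\<in>{..<n}. v i \<odot>\<^bsub>M\<^esub> x i) ` carrier (std_free R n) = carrier M"
proof -
  interpret left_module R M by fact
  obtain X where X: "finite X" "X \<subseteq> carrier M" "\<And>H. submodule H R M \<Longrightarrow> X \<subseteq> H \<Longrightarrow> H = carrier M"
    using assms(2) fin_gen_iff[OF M] by auto
  obtain x where "bij_betw x {..<card X} X" using ex_bij_betw_nat_finite[OF X(1)] by (auto simp: atLeast0LessThan)
  then have xX: "x ` {..<card X} = X" by (simp add: bij_betw_def)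
  have x: "x i \<in> carrier M" if "i < card X" for i using xX X(2) that by blast
  note h = std_free_hom[where n = "card X" and x = x, OF M x]
  have "X \<subseteq> (\<lambda>v. \<Oplus>\<^bsub>M\<^esub>i\<in>{..<card X}. v i \<odot>\<^bsub>M\<^esub> x i) ` carrier (std_free R (card X))"
  proof
    fix y assume "y \<in> X"
    then obtain j where "j < card X" "y = x j" using xX by auto
    then have "y = (\<Oplus>\<^bsub>M\<^esub>i\<in>{..<card X}. std_vec R (card X) j i \<odot>\<^bsub>M\<^esub> x i)" using h(2)[of j] by simp
    then show "y \<in> (\<lambda>v. \<Oplus>\<^bsub>M\<^esub>i\<in>{..<card X}. v i \<odot>\<^bsub>M\<^esub> x i) ` carrier (std_free R (card X))"
      using R.std_vec_closed[of "card X" j] by (rule image_eqI)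
  qed
  then have "(\<lambda>v. \<Oplus>\<^bsub>M\<^esub>i\<in>{..<card X}. v i \<odot>\<^bsub>M\<^esub> x i) ` carrier (std_free R (card X)) = carrier M"
    using X(3)[OF mod_hom_image_submodule[OF R.std_free_left_module M h(1)]] by blast
  with x show thesis by (rule that)
qed

lemma std_free_fin_gen:
  assumes "ring R"
  shows "fin_gen R (std_free R n)"
proof -
  interpret R: ring R by fact
  have S: "left_module R (std_free R n)" by (rule R.std_free_left_module)
  interpret S: left_module R "std_free R n" by fact
  show ?thesis
  proof (rule iffD2[OF fin_gen_iff[OF S]], intro exI[of _ "std_vec R n ` {..<n}"] conjI allI impI)
    show "std_vec R n ` {..<n} \<subseteq> carrier (std_free R n)" using R.std_vec_closed by blast
    fix H assume H: "submodule H R (std_free R n) \<and> std_vec R n ` {..<n} \<subseteq> H"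
    note H' = S.submoduleD[OF conjunct1[OF H]]
    have "v \<in> H" if v: "v \<in> carrier (std_free R n)" for v
    proof -
      have vi: "v i \<in> carrier R" if "i < n" for i using v that by auto
      have "(\<Oplus>\<^bsub>std_free R n\<^esub>i\<in>{..<n}. v i \<odot>\<^bsub>std_free R n\<^esub> std_vec R n i) \<in> H"
        by (rule S.submodule_finsum[OF conjunct1[OF H]]) (use vi H H'(4) in \<open>auto simp del: std_free_simps\<close>)
      then show ?thesis using R.std_free_expand[OF v] by simp
    qed
    then show "H = carrier (std_free R n)" using H'(1) by blast
  qed simp
qed

lemma fin_presentation_fin_gen:
  assumes "left_module R M" "fin_presentation R M m n g f"
  shows "fin_gen R M"
  by (rule fin_gen_image[OF ring.std_free_left_module[OF left_moduleD(1)[OF assms(1)]] assms(1) _ _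
        std_free_fin_gen[OF left_moduleD(1)[OF assms(1)]]])
     (use assms(2) in \<open>auto simp: fin_presentation_def\<close>)

text \<open>The products s_i e_j span over \<open>F\<close>, since each coordinate is expanded in
  the s_i by \<open>dual_left\<close>.\<close>

lemma (in frobenius_ring) fin_gen_F_std_free: "fin_gen Fr (std_free R k)"
proof -
  have S: "left_module R (std_free R k)" by (rule std_free_left_module)
  interpret S: left_module R "std_free R k" by fact
  have SF: "left_module Fr (std_free R k)" by (rule S.restrict_scalars[OF F_subring])
  interpret SF: left_module Fr "std_free R k" by fact
  let ?b = "\<lambda>i j. s i \<odot>\<^bsub>std_free R k\<^esub> std_vec R k j"
  have b: "?b i j \<in> carrier (std_free R k)" if "i < n" for i j
    by (rule S.smult_closed[OF s_closed[OF that] std_vec_closed])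
  show ?thesis
  proof (rule iffD2[OF fin_gen_iff[OF SF]], intro exI[of _ "(\<lambda>(i, j). ?b i j) ` ({..<n} \<times> {..<k})"] conjI allI impI)
    show "(\<lambda>(i, j). ?b i j) ` ({..<n} \<times> {..<k}) \<subseteq> carrier (std_free R k)"
      using b by (auto simp del: std_free_simps)
    fix H assume H: "submodule H Fr (std_free R k) \<and> (\<lambda>(i, j). ?b i j) ` ({..<n} \<times> {..<k}) \<subseteq> H"
    note H' = SF.submoduleD[OF conjunct1[OF H]]
    have bH: "?b i j \<in> H" if "i < n" "j < k" for i j
    proof -
      have "?b i j \<in> (\<lambda>(i, j). ?b i j) ` ({..<n} \<times> {..<k})"
        by (rule image_eqI[of _ _ "(i, j)"]) (use that in simp_all)
      then show ?thesis using H by blast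
    qed
    have aH: "a \<odot>\<^bsub>std_free R k\<^esub> std_vec R k j \<in> H" if a: "a \<in> carrier R" and j: "j < k" for a j
    proof -
      have th: "\<theta> (a \<otimes> r i) \<in> F" if "i < n" for i using form_closed a r_closed[OF that] by simp
      have "a \<odot>\<^bsub>std_free R k\<^esub> std_vec R k j = (\<Oplus>i\<in>{..<n}. \<theta> (a \<otimes> r i) \<otimes> s i) \<odot>\<^bsub>std_free R k\<^esub> std_vec R k j"
        using dual_left[OF a] by simp
      also have "\<dots> = (\<Oplus>\<^bsub>std_free R k\<^esub>i\<in>{..<n}. (\<theta> (a \<otimes> r i) \<otimes> s i) \<odot>\<^bsub>std_free R k\<^esub> std_vec R k j)"
        by (rule S.finsum_smult[OF std_vec_closed]) (use th F_sub s_closed in auto)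
      also have "\<dots> = (\<Oplus>\<^bsub>std_free R k\<^esub>i\<in>{..<n}. \<theta> (a \<otimes> r i) \<odot>\<^bsub>std_free R k\<^esub> ?b i j)"
        by (rule S.M.finsum_cong')
           (use th F_sub s_closed std_vec_closed S.smult_closed S.smult_assoc in \<open>auto simp del: std_free_simps\<close>)
      also have "\<dots> \<in> H"
        by (rule SF.submodule_finsum[OF conjunct1[OF H]]) (use th bH[OF _ j] H'(4) in \<open>auto simp del: std_free_simps\<close>)
      finally show ?thesis .
    qed
    have "v \<in> H" if v: "v \<in> carrier (std_free R k)" for v
    proof -
      have vi: "v i \<in> carrier R" if "i < k" for i using v that by auto
      have "(\<Oplus>\<^bsub>std_free R k\<^esub>i\<in>{..<k}. v i \<odot>\<^bsub>std_free R k\<^esub> std_vec R k i) \<in> H"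
        by (rule SF.submodule_finsum[OF conjunct1[OF H]]) (use vi aH in \<open>auto simp del: std_free_simps\<close>)
      then show ?thesis using std_free_expand[OF v] by simp
    qed
    then show "H = carrier (std_free R k)" using H'(1) by blast
  qed simp
qed

section \<open>Relations between elements of a stage, and coherence of the ring\<close>

context frobenius_tower
begin

lemma stage_exists:
  assumes "finite X" "X \<subseteq> carrier A"
  shows "\<exists>B\<in>\<S>. X \<subseteq> B"
  using stages stage_ext[OF _ assms] by blast

text \<open>A relation \<open>\<Sum> v\<^sub>i x\<^sub>i = 0\<close> with \<open>x\<^sub>i \<in> B\<close> and \<open>v\<^sub>i \<in> C\<close> satisfies
  \<open>v = \<Sum>\<^sub>k y\<^sub>k (\<Phi>(x'\<^sub>k v\<^sub>i))\<^sub>i\<close>, so it is a combination of relations over \<open>B\<close>.\<close>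

lemma relation_descent:
  assumes B: "B \<in> \<S>" and x: "\<And>i. i < n \<Longrightarrow> x i \<in> B"
    and v: "v \<in> carrier (std_free A n)" and rel: "(\<Oplus>i\<in>{..<n}. v i \<otimes> x i) = \<zero>"
    and H: "submodule H A (std_free A n)"
    and HB: "\<And>u. \<lbrakk>u \<in> carrier (std_free (A\<lparr>carrier := B\<rparr>) n); (\<Oplus>i\<in>{..<n}. u i \<otimes> x i) = \<zero>\<rbrakk> \<Longrightarrow> u \<in> H"
  shows "v \<in> H"
proof -
  have S: "left_module A (std_free A n)" by (rule std_free_left_module)
  interpret S: left_module A "std_free A n" by fact
  have vA: "v i \<in> carrier A" if "i < n" for i using v that by auto
  have "finite (v ` {..<n})" "v ` {..<n} \<subseteq> carrier A" using vA by auto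
  from stage_ext[OF B this] obtain C \<Phi> k x' y where C: "C \<in> \<S>" "B \<subseteq> C" "v ` {..<n} \<subseteq> C"
    and P: "frobenius_data A B C \<Phi> k x' y" by blast
  note P = frobenius_dataD[OF P]
  note Bs = subringE[OF stage_subring[OF B]] and Cs = subringE[OF stage_subring[OF C(1)]]
  have vC: "v i \<in> C" if "i < n" for i using C(3) that by auto
  have BA: "b \<in> carrier A" if "b \<in> B" for b using Bs(1) that by auto
  have CA: "c \<in> carrier A" if "c \<in> C" for c using Cs(1) that by auto
  have PA: "\<Phi> c \<in> carrier A" if "c \<in> C" for c using BA P(1)[OF that] by simp
  define u where "u j = (\<lambda>i\<in>{..<n}. \<Phi> (x' j \<otimes> v i))" for j
  have x'v: "x' j \<otimes> v i \<in> C" if "j \<in> {1..k}" "i < n" for j i using P(5)[OF that(1)] vC[OF that(2)] Cs(6) by simp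
  have uB: "u j \<in> carrier (std_free (A\<lparr>carrier := B\<rparr>) n)" if "j \<in> {1..k}" for j
    using P(1)[OF x'v[OF that]] by (auto simp: u_def)
  have \<Phi>0: "\<Phi> \<zero> = \<zero>"
  proof -
    have "\<Phi> (\<zero> \<otimes> \<zero>) = \<zero> \<otimes> \<Phi> \<zero>" by (rule P(3)) (use Bs Cs in auto)
    then show ?thesis using PA[OF Cs(2)] by simp
  qed
  \<comment> \<open>Additivity of \<Phi> is known on \<open>C\<close> only, so the sum is first
    taken in the ring \<open>C\<close> and then compared with the sum in \<open>A\<close>.\<close>
  have \<Phi>_sum: "\<Phi> (finsum A g I) = (\<Oplus>i\<in>I. \<Phi> (g i))" if "g \<in> I \<rightarrow> C" for g and I :: "nat set"
  proof -
    interpret C: ring "A\<lparr>carrier := C\<rparr>" by (rule subring_is_ring[OF stage_subring[OF C(1)]])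
    have "\<Phi> (finsum (A\<lparr>carrier := C\<rparr>) g I) = (\<Oplus>i\<in>I. \<Phi> (g i))"
      by (rule add_hom_finsum[OF C.abelian_group_axioms abelian_group_axioms]) (use P(2) PA that in \<open>auto simp: hom_def\<close>)
    then show ?thesis
      using finsum_carrier_update[OF abelian_group_axioms C.abelian_group_axioms Cs(1) that] by simp
  qed
  have vxC: "v i \<otimes> x i \<in> C" if "i < n" for i
    using vC[OF that] subsetD[OF C(2) x[OF that]] Cs(6) by simp
  have uH: "u j \<in> H" if j: "j \<in> {1..k}" for j
  proof (rule HB[OF uB[OF j]])
    have xj: "x' j \<in> carrier A" using CA[OF P(5)[OF j]] .
    \<comment> \<open>Linearity of \<Phi> on the right over \<open>B\<close> takes x_i inside, so
      this sum is \<Phi> of x'_j times the given relation, hence \<Phi> of zero.\<close>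
    have "(\<Oplus>i\<in>{..<n}. u j i \<otimes> x i) = (\<Oplus>i\<in>{..<n}. \<Phi> (x' j \<otimes> (v i \<otimes> x i)))"
    proof (rule finsum_cong')
      fix i assume "i \<in> {..<n}"
      then have i: "i < n" by simp
      have "\<Phi> (x' j \<otimes> v i \<otimes> x i) = \<Phi> (x' j \<otimes> v i) \<otimes> x i" by (rule P(4)[OF x[OF i] x'v[OF j i]])
      then show "u j i \<otimes> x i = \<Phi> (x' j \<otimes> (v i \<otimes> x i))"
        using i xj vA[OF i] BA[OF x[OF i]] by (simp add: u_def m_assoc)
    qed (use vxC P(5)[OF j] Cs(6) PA in auto)
    also have "\<dots> = \<Phi> (\<Oplus>i\<in>{..<n}. x' j \<otimes> (v i \<otimes> x i))"
      by (rule \<Phi>_sum[symmetric]) (use vxC P(5)[OF j] Cs(6) in auto)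
    also have "(\<Oplus>i\<in>{..<n}. x' j \<otimes> (v i \<otimes> x i)) = x' j \<otimes> (\<Oplus>i\<in>{..<n}. v i \<otimes> x i)"
      using left_module.smult_finsum[OF lmod_self xj, of "\<lambda>i. v i \<otimes> x i" "{..<n}"] vA BA x by (simp add: Pi_iff)
    finally show "(\<Oplus>i\<in>{..<n}. u j i \<otimes> x i) = \<zero>" using rel xj \<Phi>0 by simp
  qed
  have yA: "y j \<in> carrier A" if "j \<in> {1..k}" for j using CA[OF P(6)[OF that]] .
  have uA: "u j \<in> carrier (std_free A n)" if "j \<in> {1..k}" for j
    using S.submoduleD(1)[OF H] uH[OF that] by blast
  have cl: "(\<lambda>j. y j \<odot>\<^bsub>std_free A n\<^esub> u j) \<in> {1..k} \<rightarrow> carrier (std_free A n)"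
    using S.smult_closed yA uA by (auto simp del: std_free_simps)
  have "(\<Oplus>\<^bsub>std_free A n\<^esub>j\<in>{1..k}. y j \<odot>\<^bsub>std_free A n\<^esub> u j) = v"
  proof
    fix i
    show "(\<Oplus>\<^bsub>std_free A n\<^esub>j\<in>{1..k}. y j \<odot>\<^bsub>std_free A n\<^esub> u j) i = v i"
    proof (cases "i < n")
      case True
      have "(\<Oplus>\<^bsub>std_free A n\<^esub>j\<in>{1..k}. y j \<odot>\<^bsub>std_free A n\<^esub> u j) i = (\<Oplus>j\<in>{1..k}. (y j \<odot>\<^bsub>std_free A n\<^esub> u j) i)"
        by (rule add_hom_finsum[OF S.M.abelian_group_axioms abelian_group_axioms _ cl, of "\<lambda>f. f i"])
           (use True in \<open>auto simp: hom_def\<close>)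
      also have "\<dots> = (\<Oplus>j\<in>{1..k}. y j \<otimes> \<Phi> (x' j \<otimes> v i))"
        by (rule finsum_cong') (use True yA PA[OF x'v] in \<open>auto simp: u_def\<close>)
      also have "\<dots> = v i" by (rule P(7)[OF vC[OF True]])
      finally show ?thesis .
    next
      case False
      have "(\<Oplus>\<^bsub>std_free A n\<^esub>j\<in>{1..k}. y j \<odot>\<^bsub>std_free A n\<^esub> u j) \<in> carrier (std_free A n)"
        using cl by (rule S.M.finsum_closed)
      then show ?thesis using False v by (auto simp: PiE_iff extensional_def)
    qed
  qed
  moreover have "(\<Oplus>\<^bsub>std_free A n\<^esub>j\<in>{1..k}. y j \<odot>\<^bsub>std_free A n\<^esub> u j) \<in> H"
    by (rule S.submodule_finsum[OF H]) (use S.submoduleD(4)[OF H] yA uH in \<open>auto simp del: std_free_simps\<close>)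
  ultimately show ?thesis by simp
qed

lemma coherent_left: "coherent_module A (lmod (\<lambda>x. x) A)"
  unfolding coherent_module_def pseudo_coherent_def
proof (intro conjI allI impI)
  let ?L = "lmod (\<lambda>x. x) A"
  show L: "left_module A ?L" by (rule lmod_self)
  interpret L: left_module A ?L by fact
  show "fin_gen A ?L"
  proof (rule iffD2[OF fin_gen_iff[OF L]], intro exI[of _ "{\<one>}"] conjI allI impI)
    fix H assume H: "submodule H A ?L \<and> {\<one>} \<subseteq> H"
    note H' = L.submoduleD[OF conjunct1[OF H]]
    have "a \<in> H" if "a \<in> carrier A" for a using H'(4)[OF that, of \<one>] H that by simp
    then show "H = carrier ?L" using H'(1) by auto
  qed auto
  fix N assume "submodule N A ?L \<and> fin_gen A (?L\<lparr>carrier := N\<rparr>)"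
  then have N: "submodule N A ?L" and fg: "fin_gen A (?L\<lparr>carrier := N\<rparr>)" by auto
  let ?N = "?L\<lparr>carrier := N\<rparr>"
  have LN: "left_module A ?N" by (rule L.submodule_left_module[OF N])
  interpret LN: left_module A ?N by fact
  note N' = L.submoduleD[OF N, simplified]
  obtain n :: nat and x where x: "\<And>i. i < n \<Longrightarrow> x i \<in> carrier ?N"
    and surj: "(\<lambda>v. \<Oplus>\<^bsub>?N\<^esub>i\<in>{..<n}. v i \<odot>\<^bsub>?N\<^esub> x i) ` carrier (std_free A n) = carrier ?N"
    using fin_gen_std_free[OF LN fg] by blast
  define g where "g v = (\<Oplus>\<^bsub>?N\<^esub>i\<in>{..<n}. v i \<odot>\<^bsub>?N\<^esub> x i)" for v
  have g: "g \<in> mod_hom A (std_free A n) ?N"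
    unfolding g_def by (rule std_free_hom(1)[OF LN x])
  have xA: "x i \<in> carrier A" "x i \<in> N" if "i < n" for i using x[OF that] N'(1) by auto
  have g_eq: "g v = (\<Oplus>i\<in>{..<n}. v i \<otimes> x i)" if "v \<in> carrier (std_free A n)" for v
  proof -
    have "finsum ?N (\<lambda>i. v i \<otimes> x i) {..<n} = finsum ?L (\<lambda>i. v i \<otimes> x i) {..<n}"
      by (rule finsum_carrier_update[OF L.M.abelian_group_axioms LN.M.abelian_group_axioms]) (use N'(1) N'(4) xA that in \<open>auto simp: PiE_iff\<close>)
    moreover have "g v = finsum ?N (\<lambda>i. v i \<otimes> x i) {..<n}" by (simp add: g_def lmod_def)
    ultimately show ?thesis by (simp only: finsum_lmod)
  qed
  have "finite (x ` {..<n})" "x ` {..<n} \<subseteq> carrier A" using xA by auto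
  from stage_exists[OF this] obtain B where B: "B \<in> \<S>" "\<And>i. i < n \<Longrightarrow> x i \<in> B" by auto
  let ?R = "A\<lparr>carrier := B\<rparr>"
  have BA: "b \<in> carrier A" if "b \<in> B" for b using subringE(1)[OF stage_subring[OF B(1)]] that by auto
  obtain \<theta> q r s where fr: "frobenius_ring ?R F \<theta> q r s" using stage_dual[OF B(1)] by blast
  interpret R: frobenius_ring ?R F \<theta> q r s by fact
  have SR: "left_module ?R (std_free ?R n)" by (rule R.std_free_left_module)
  have SF: "left_module R.Fr (std_free ?R n)" by (rule left_module.restrict_scalars[OF SR R.F_subring])
  interpret SF: left_module R.Fr "std_free ?R n" by (rule SF)
  have sub: "v \<in> carrier (std_free A n)" if "v \<in> carrier (std_free ?R n)" for v
    using that BA by (auto simp: PiE_iff)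
  \<comment> \<open>The relations over the stage. They are treated as a space over \<open>F\<close>,
    where subspaces of finitely generated spaces are finitely generated.\<close>
  define Z where "Z = {z \<in> carrier (std_free ?R n). g z = \<zero>}"
  note g' = mod_homD[OF g]
  have FA: "c \<in> carrier A" if "c \<in> F" for c using BA R.F_sub[OF that] by simp
  have g0: "g (\<lambda>i\<in>{..<n}. \<zero>) = \<zero>"
    using mod_hom_zero[OF std_free_left_module LN g] by simp
  have Z: "submodule Z R.Fr (std_free ?R n)"
  proof (rule SF.submoduleI')
    show "\<zero>\<^bsub>std_free ?R n\<^esub> \<in> Z" using SF.M.zero_closed g0 unfolding Z_def by simp
    show "Z \<subseteq> carrier (std_free ?R n)" unfolding Z_def by blast
    fix a b assume a: "a \<in> Z" and b: "b \<in> Z"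
    have "g (a \<oplus>\<^bsub>std_free A n\<^esub> b) = \<zero>"
      using g'(2)[OF sub sub, of a b] a b unfolding Z_def by simp
    then show "a \<oplus>\<^bsub>std_free ?R n\<^esub> b \<in> Z" using SF.M.a_closed a b unfolding Z_def by simp
  next
    fix c z assume c: "c \<in> carrier R.Fr" and z: "z \<in> Z"
    have "g (c \<odot>\<^bsub>std_free A n\<^esub> z) = \<zero>"
      using g'(3)[OF FA sub, of c z] c z FA unfolding Z_def by simp
    then show "c \<odot>\<^bsub>std_free ?R n\<^esub> z \<in> Z" using SF.smult_closed[OF c] z unfolding Z_def by simp
  qed
  have fgZ: "fin_gen R.Fr ((std_free ?R n)\<lparr>carrier := Z\<rparr>)"
    by (rule R.fin_gen_F_submodule[OF SF R.fin_gen_F_std_free Z])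
  have LZ: "left_module R.Fr ((std_free ?R n)\<lparr>carrier := Z\<rparr>)" by (rule SF.submodule_left_module[OF Z])
  obtain X where X: "finite X" "X \<subseteq> Z" "\<And>H. submodule H R.Fr ((std_free ?R n)\<lparr>carrier := Z\<rparr>) \<Longrightarrow> X \<subseteq> H \<Longrightarrow> H = Z"
    using fgZ fin_gen_iff[OF LZ] by auto
  obtain z where "bij_betw z {..<card X} X" using ex_bij_betw_nat_finite[OF X(1)] by (auto simp: atLeast0LessThan)
  then have zX: "z ` {..<card X} = X" by (simp add: bij_betw_def)
  have zZ: "z i \<in> Z" if "i < card X" for i using zX X(2) that by blast
  have zA: "z i \<in> carrier (std_free A n)" if "i < card X" for i using zZ[OF that] sub unfolding Z_def by blast
  let ?p = "card X"
  have S: "left_module A (std_free A n)" by (rule std_free_left_module)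
  interpret S: left_module A "std_free A n" by fact
  define f where "f w = (\<Oplus>\<^bsub>std_free A n\<^esub>i\<in>{..<?p}. w i \<odot>\<^bsub>std_free A n\<^esub> z i)" for w
  have f: "f \<in> mod_hom A (std_free A ?p) (std_free A n)"
    unfolding f_def by (rule std_free_hom(1)[OF S zA])
  have f_vec: "f (std_vec A ?p j) = z j" if "j < ?p" for j
    unfolding f_def by (rule std_free_hom(2)[OF S zA that])
  have im: "submodule (f ` carrier (std_free A ?p)) A (std_free A n)"
    by (rule mod_hom_image_submodule[OF std_free_left_module S f])
  note im' = S.submoduleD[OF im]
  \<comment> \<open>The part of \<open>Z\<close> reached by \<open>f\<close> is an F-subspace
    containing the generators \<open>X\<close>, so it is all of \<open>Z\<close>. Addition and
    action are the same functions in the free modules over \<open>A\<close> and over the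
    stage.\<close>
  have "f ` carrier (std_free A ?p) \<inter> Z = Z"
  proof (rule X(3))
    note Z' = SF.submoduleD[OF Z]
    show "submodule (f ` carrier (std_free A ?p) \<inter> Z) R.Fr ((std_free ?R n)\<lparr>carrier := Z\<rparr>)"
    proof (rule left_module.submoduleI'[OF LZ])
      show "\<zero>\<^bsub>(std_free ?R n)\<lparr>carrier := Z\<rparr>\<^esub> \<in> f ` carrier (std_free A ?p) \<inter> Z"
        using im'(2) Z'(2) by simp
      fix a b assume "a \<in> f ` carrier (std_free A ?p) \<inter> Z" "b \<in> f ` carrier (std_free A ?p) \<inter> Z"
      then have "a \<oplus>\<^bsub>std_free A n\<^esub> b \<in> f ` carrier (std_free A ?p)" "a \<oplus>\<^bsub>std_free ?R n\<^esub> b \<in> Z"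
        using im'(3) Z'(3) by blast+
      then show "a \<oplus>\<^bsub>(std_free ?R n)\<lparr>carrier := Z\<rparr>\<^esub> b \<in> f ` carrier (std_free A ?p) \<inter> Z"
        by (simp add: std_free_def)
    next
      fix c a assume c: "c \<in> carrier R.Fr" and "a \<in> f ` carrier (std_free A ?p) \<inter> Z"
      then have "c \<odot>\<^bsub>std_free A n\<^esub> a \<in> f ` carrier (std_free A ?p)" "c \<odot>\<^bsub>std_free ?R n\<^esub> a \<in> Z"
        using im'(4)[of c a] FA[of c] Z'(4)[OF c] by auto
      then show "c \<odot>\<^bsub>(std_free ?R n)\<lparr>carrier := Z\<rparr>\<^esub> a \<in> f ` carrier (std_free A ?p) \<inter> Z"
        by (simp add: std_free_def)
    qed simp
    show "X \<subseteq> f ` carrier (std_free A ?p) \<inter> Z"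
    proof
      fix a assume a: "a \<in> X"
      then obtain j where j: "j < ?p" "a = z j" using zX by auto
      then show "a \<in> f ` carrier (std_free A ?p) \<inter> Z"
        using f_vec[OF j(1)] std_vec_closed[of ?p j] a X(2) by (metis IntI imageI subsetD)
    qed
  qed
  then have Z_im: "Z \<subseteq> f ` carrier (std_free A ?p)" by blast
  have zero_hom: "(\<lambda>w. \<zero>\<^bsub>?N\<^esub>) \<in> mod_hom A (std_free A ?p) ?N"
    by (rule mod_homI) (simp_all only: LN.M.zero_closed LN.M.l_zero LN.smult_zero_right)
  have gf: "g (f w) = \<zero>\<^bsub>?N\<^esub>" if "w \<in> carrier (std_free A ?p)" for w
    by (rule std_free_hom_eqI[OF LN mod_hom_comp[OF f g] zero_hom _ that]) (use f_vec zZ in \<open>simp add: Z_def\<close>)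
  have "fin_presentation A ?N n ?p g f"
    unfolding fin_presentation_def
  proof (intro conjI)
    show "g ` carrier (std_free A n) = carrier ?N" using surj unfolding g_def .
    have "v \<in> f ` carrier (std_free A ?p)" if v: "v \<in> carrier (std_free A n)" "g v = \<zero>\<^bsub>?N\<^esub>" for v
    \<comment> \<open>The image of \<open>f\<close> is an A-submodule containing every relation over
      the stage, and is therefore the whole kernel of \<open>g\<close>.\<close>
    proof (rule relation_descent[OF B(1,2) v(1) _ im])
      show "(\<Oplus>i\<in>{..<n}. v i \<otimes> x i) = \<zero>" using v g_eq by simp
      fix u assume u: "u \<in> carrier (std_free ?R n)" "(\<Oplus>i\<in>{..<n}. u i \<otimes> x i) = \<zero>"
      then have "u \<in> Z" using g_eq[OF sub[OF u(1)]] unfolding Z_def by simp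
      then show "u \<in> f ` carrier (std_free A ?p)" using Z_im by blast
    qed
    then show "f ` carrier (std_free A ?p) = {v \<in> carrier (std_free A n). g v = \<zero>\<^bsub>?N\<^esub>}"
      using gf mod_homD(1)[OF f] by blast
  qed (rule f g)+
  then show "fin_presented A ?N" unfolding fin_presented_def by blast
qed

end

text \<open>The multiplication of a module record carries no information, but \<open>rmod\<close> over \<open>A\<close> and \<open>lmod\<close> over
  \<open>opp A\<close> fill it differently.\<close>

lemma left_module_mult_update: "left_module R (M\<lparr>monoid.mult := f\<rparr>) \<longleftrightarrow> left_module R M"
  by (simp add: left_module_def left_module_axioms_def abelian_group_def abelian_monoid_def abelian_group_axioms_def)

lemma coherent_mult_update:
  fixes R :: "('r, 's) ring_scheme" and M :: "('r, 'm, 't) module_scheme"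
  shows "coherent_module R (M\<lparr>monoid.mult := f\<rparr>) \<longleftrightarrow> coherent_module R M"
proof -
  have fs: "finsum (M\<lparr>monoid.mult := f\<rparr>) = finsum M" for M :: "('r, 'm, 't) module_scheme" and f
    by (rule finsum_fields) auto
  have fg: "fin_gen R (M\<lparr>monoid.mult := f\<rparr>) \<longleftrightarrow> fin_gen R M" for M :: "('r, 'm, 't) module_scheme" and f
    by (simp add: fin_gen_def fs)
  have fp: "fin_presented R (M\<lparr>monoid.mult := f\<rparr>) \<longleftrightarrow> fin_presented R M" for M :: "('r, 'm, 't) module_scheme" and f
    by (simp add: fin_presented_def fin_presentation_def mod_hom_def)
  have sm: "submodule N R (M\<lparr>monoid.mult := f\<rparr>) \<longleftrightarrow> submodule N R M" for N
    by (simp add: submodule_def submodule_axioms_def)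
  have up: "M\<lparr>monoid.mult := f, carrier := N\<rparr> = M\<lparr>carrier := N, monoid.mult := f\<rparr>" for N
    by simp
  show ?thesis
    unfolding coherent_module_def pseudo_coherent_def
    by (simp only: fg sm up fp left_module_mult_update)
qed

lemma (in frobenius_tower) coherent: "coherent_ring A"
proof -
  have "rmod (\<lambda>x. x) A = (lmod (\<lambda>x. x) (opp A))\<lparr>monoid.mult := monoid.mult A\<rparr>"
    by (simp add: rmod_def lmod_def)
  then show ?thesis
    using coherent_left frobenius_tower.coherent_left[OF frobenius_tower_opp]
    by (simp add: coherent_ring_def coherent_mult_update)
qed

text \<open>Pseudo-coherence is applied to the module as a finitely generated submodule of
  itself.\<close>

lemma coherent_presentation:
  assumes "coherent_module A M"
  obtains m n G F where "left_module A M" "fin_presentation A M m n G F"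
proof -
  have M: "left_module A M" using assms by (simp add: coherent_module_def pseudo_coherent_def)
  have "\<forall>N. submodule N A M \<and> fin_gen A (M\<lparr>carrier := N\<rparr>) \<longrightarrow> fin_presented A (M\<lparr>carrier := N\<rparr>)" "fin_gen A M"
    using assms by (simp_all add: coherent_module_def pseudo_coherent_def)
  from this(2) spec[OF this(1), of "carrier M"] have "fin_presented A M"
    using left_module.submodule_carrier[OF M] by simp
  then show thesis using that M by (auto simp: fin_presented_def)
qed

section \<open>Descent of coherent modules and of their homomorphisms\<close>

context frobenius_tower
begin

text \<open>Each vector is paired with its length, so that several matrices of different sizes can
  be placed in one stage at once.\<close>

lemma stage_vectors:
  assumes "finite V" "\<And>v k. (v, k) \<in> V \<Longrightarrow> v \<in> carrier (std_free A k)"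
  obtains B where "B \<in> \<S>" "\<And>v k. (v, k) \<in> V \<Longrightarrow> v \<in> carrier (std_free (A\<lparr>carrier := B\<rparr>) k)"
proof -
  let ?X = "\<Union>(v, k)\<in>V. v ` {..<k}"
  have "finite ?X" using assms(1) by auto
  moreover have "?X \<subseteq> carrier A" using assms(2) by fastforce
  ultimately obtain B where B: "B \<in> \<S>" "?X \<subseteq> B" using stage_exists by blast
  have "v \<in> carrier (std_free (A\<lparr>carrier := B\<rparr>) k)" if "(v, k) \<in> V" for v k
  proof -
    have "v ` {..<k} \<subseteq> B" using B(2) that by blast
    then show ?thesis using assms(2)[OF that] by (auto simp: PiE_iff)
  qed
  with B(1) show thesis by (rule that)
qed

text \<open>The stage has to contain the finitely many entries of the matrix \<open>F\<close>; the
  generators of \<open>M\<close> are not elements of \<open>A\<close> and put no condition on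
  it.\<close>

lemma coherent_descent:
  fixes M :: "('a, 'm, 't) module_scheme"
  assumes "coherent_module A M"
  shows "\<exists>B\<in>\<S>. \<exists>M' :: ('a, (nat \<Rightarrow> 'a) set) module. \<exists>m n g f G F.
     left_module (A\<lparr>carrier := B\<rparr>) M' \<and> fin_presentation (A\<lparr>carrier := B\<rparr>) M' m n g f \<and>
     induced_presentation (A\<lparr>carrier := B\<rparr>) A (\<lambda>x. x) M' m n g f G F \<and>
     fin_presentation A (base_change (A\<lparr>carrier := B\<rparr>) A (\<lambda>x. x) M') m n G F \<and>
     (\<exists>\<alpha>. \<alpha> \<in> mod_iso A (base_change (A\<lparr>carrier := B\<rparr>) A (\<lambda>x. x) M') M)"
proof -
  obtain m n G F where M: "left_module A M" and p: "fin_presentation A M m n G F"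
    using coherent_presentation[OF assms] by blast
  have F: "F \<in> mod_hom A (std_free A n) (std_free A m)" using p by (simp add: fin_presentation_def)
  obtain B where B: "B \<in> \<S>" "\<And>v k. (v, k) \<in> (\<lambda>j. (F (std_vec A n j), m)) ` {..<n} \<Longrightarrow> v \<in> carrier (std_free (A\<lparr>carrier := B\<rparr>) k)"
  proof (rule stage_vectors[of "(\<lambda>j. (F (std_vec A n j), m)) ` {..<n}"])
    fix v k assume "(v, k) \<in> (\<lambda>j. (F (std_vec A n j), m)) ` {..<n}"
    then show "v \<in> carrier (std_free A k)" using mod_homD(1)[OF F std_vec_closed] by blast
  qed blast+
  have e: "\<forall>j<n. F (std_vec A n j) \<in> carrier (std_free (A\<lparr>carrier := B\<rparr>) m)"
    using B(2) by blast
  note d = descent[OF ring_axioms stage_subring[OF B(1)] M p e]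
  show ?thesis
    using B(1) d(1,3,4,5) by blast
qed

text \<open>Lifting \<phi> to a matrix \<Psi> between the generators is not enough: \<Psi> sends
  relations to relations over \<open>A\<close>, but a preimage under F2 might have entries outside
  the chosen stage. The matrix \<Theta> records such preimages, so that its entries can be included
  in the stage.\<close>

lemma coherent_hom_descent:
  fixes M :: "('a, 'm, 't) module_scheme" and N :: "('a, 'n, 'u) module_scheme"
  assumes "coherent_module A M" "coherent_module A N" and \<phi>: "\<phi> \<in> mod_hom A M N"
  shows "\<exists>B\<in>\<S>. \<exists>(M'' :: ('a, (nat \<Rightarrow> 'a) set) module) (N'' :: ('a, (nat \<Rightarrow> 'a) set) module) \<phi>'' \<alpha> \<beta>.
     left_module (A\<lparr>carrier := B\<rparr>) M'' \<and> fin_gen (A\<lparr>carrier := B\<rparr>) M'' \<and>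
     left_module (A\<lparr>carrier := B\<rparr>) N'' \<and> fin_gen (A\<lparr>carrier := B\<rparr>) N'' \<and>
     \<phi>'' \<in> mod_hom (A\<lparr>carrier := B\<rparr>) M'' N'' \<and>
     \<alpha> \<in> mod_iso A (base_change (A\<lparr>carrier := B\<rparr>) A (\<lambda>x. x) M'') M \<and>
     \<beta> \<in> mod_iso A (base_change (A\<lparr>carrier := B\<rparr>) A (\<lambda>x. x) N'') N \<and>
     (\<forall>u\<in>carrier (base_change (A\<lparr>carrier := B\<rparr>) A (\<lambda>x. x) M'').
        \<beta> (base_change_map (A\<lparr>carrier := B\<rparr>) A (\<lambda>x. x) N'' \<phi>'' u) = \<phi> (\<alpha> u))"
proof -
  obtain m1 n1 G1 F1 where M: "left_module A M" and p1: "fin_presentation A M m1 n1 G1 F1"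
    using coherent_presentation[OF assms(1)] by blast
  obtain m2 n2 G2 F2 where N: "left_module A N" and p2: "fin_presentation A N m2 n2 G2 F2"
    using coherent_presentation[OF assms(2)] by blast
  have G1: "G1 \<in> mod_hom A (std_free A m1) M" and F1: "F1 \<in> mod_hom A (std_free A n1) (std_free A m1)"
    and ex1: "F1 ` carrier (std_free A n1) = {x \<in> carrier (std_free A m1). G1 x = \<zero>\<^bsub>M\<^esub>}"
    using p1 by (auto simp: fin_presentation_def)
  have G2: "G2 \<in> mod_hom A (std_free A m2) N" and F2: "F2 \<in> mod_hom A (std_free A n2) (std_free A m2)"
    and surj2: "G2 ` carrier (std_free A m2) = carrier N"
    and ex2: "F2 ` carrier (std_free A n2) = {x \<in> carrier (std_free A m2). G2 x = \<zero>\<^bsub>N\<^esub>}"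
    using p2 by (auto simp: fin_presentation_def)
  have SA: "left_module A (std_free A k)" for k by (rule std_free_left_module)
  \<comment> \<open>Lifts along G2 of the images of the generators; they are the entries of
    \<Psi>.\<close>
  have "\<exists>p\<in>carrier (std_free A m2). G2 p = \<phi> (G1 (std_vec A m1 i))" for i
  proof -
    have "\<phi> (G1 (std_vec A m1 i)) \<in> G2 ` carrier (std_free A m2)"
      unfolding surj2 by (rule mod_homD(1)[OF \<phi> mod_homD(1)[OF G1 std_vec_closed]])
    then show ?thesis by (metis imageE)
  qed
  then obtain p where p: "\<And>i. p i \<in> carrier (std_free A m2)" "\<And>i. G2 (p i) = \<phi> (G1 (std_vec A m1 i))"
    by metis
  define \<Psi> where "\<Psi> v = (\<Oplus>\<^bsub>std_free A m2\<^esub>i\<in>{..<m1}. v i \<odot>\<^bsub>std_free A m2\<^esub> p i)" for v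
  have \<Psi>: "\<Psi> \<in> mod_hom A (std_free A m1) (std_free A m2)"
    unfolding \<Psi>_def by (rule std_free_hom(1)[OF SA p(1)])
  have \<Psi>_vec: "\<Psi> (std_vec A m1 j) = p j" if "j < m1" for j
    unfolding \<Psi>_def by (rule std_free_hom(2)[OF SA p(1) that])
  have G\<Psi>: "G2 (\<Psi> v) = \<phi> (G1 v)" if "v \<in> carrier (std_free A m1)" for v
    by (rule std_free_hom_eqI[OF N mod_hom_comp[OF \<Psi> G2] mod_hom_comp[OF G1 \<phi>] _ that]) (simp add: \<Psi>_vec p(2))
  \<comment> \<open>\<Psi> sends the relations of \<open>M\<close> into the kernel of G2, which is
    the image of F2; the preimages are the entries of \<Theta>.\<close>
  have "\<exists>q\<in>carrier (std_free A n2). F2 q = \<Psi> (F1 (std_vec A n1 j))" for j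
  proof -
    let ?x = "F1 (std_vec A n1 j)"
    have x: "?x \<in> carrier (std_free A m1)" "G1 ?x = \<zero>\<^bsub>M\<^esub>" using ex1 std_vec_closed[of n1 j] by blast+
    have "G2 (\<Psi> ?x) = \<zero>\<^bsub>N\<^esub>" using G\<Psi>[OF x(1)] x(2) mod_hom_zero[OF M N \<phi>] by simp
    then have "\<Psi> ?x \<in> F2 ` carrier (std_free A n2)" using ex2 mod_homD(1)[OF \<Psi> x(1)] by blast
    then show ?thesis by (metis imageE)
  qed
  then obtain q where q: "\<And>j. q j \<in> carrier (std_free A n2)" "\<And>j. F2 (q j) = \<Psi> (F1 (std_vec A n1 j))"
    by metis
  define \<Theta> where "\<Theta> w = (\<Oplus>\<^bsub>std_free A n2\<^esub>i\<in>{..<n1}. w i \<odot>\<^bsub>std_free A n2\<^esub> q i)" for w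
  have \<Theta>: "\<Theta> \<in> mod_hom A (std_free A n1) (std_free A n2)"
    unfolding \<Theta>_def by (rule std_free_hom(1)[OF SA q(1)])
  have \<Theta>_vec: "\<Theta> (std_vec A n1 j) = q j" if "j < n1" for j
    unfolding \<Theta>_def by (rule std_free_hom(2)[OF SA q(1) that])
  have F\<Theta>: "F2 (\<Theta> w) = \<Psi> (F1 w)" if "w \<in> carrier (std_free A n1)" for w
    by (rule std_free_hom_eqI[OF SA mod_hom_comp[OF \<Theta> F2] mod_hom_comp[OF F1 \<Psi>] _ that]) (simp add: \<Theta>_vec q(2))
  let ?V1 = "(\<lambda>j. (F1 (std_vec A n1 j), m1)) ` {..<n1}" and ?V2 = "(\<lambda>j. (F2 (std_vec A n2 j), m2)) ` {..<n2}"
    and ?V3 = "(\<lambda>i. (p i, m2)) ` {..<m1}" and ?V4 = "(\<lambda>j. (q j, n2)) ` {..<n1}"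
  \<comment> \<open>One stage for all four matrices. There the identity F2 \<Theta> = \<Psi> F1 is
    the restriction of the one over \<open>A\<close>.\<close>
  obtain B where B: "B \<in> \<S>" "\<And>v k. (v, k) \<in> ?V1 \<union> ?V2 \<union> ?V3 \<union> ?V4 \<Longrightarrow> v \<in> carrier (std_free (A\<lparr>carrier := B\<rparr>) k)"
  proof (rule stage_vectors[of "?V1 \<union> ?V2 \<union> ?V3 \<union> ?V4"])
    fix v k assume "(v, k) \<in> ?V1 \<union> ?V2 \<union> ?V3 \<union> ?V4"
    then show "v \<in> carrier (std_free A k)"
      using mod_homD(1)[OF F1 std_vec_closed] mod_homD(1)[OF F2 std_vec_closed] p(1) q(1) by blast
  qed blast+
  let ?R = "A\<lparr>carrier := B\<rparr>"
  have e1: "\<forall>j<n1. F1 (std_vec A n1 j) \<in> carrier (std_free ?R m1)" using B(2) by blast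
  have e2: "\<forall>j<n2. F2 (std_vec A n2 j) \<in> carrier (std_free ?R m2)" using B(2) by blast
  have e3: "\<Psi> (std_vec A m1 j) \<in> carrier (std_free ?R m2)" if "j < m1" for j
    unfolding \<Psi>_vec[OF that] by (rule B(2)) (use that in blast)
  have e4: "\<Theta> (std_vec A n1 j) \<in> carrier (std_free ?R n2)" if "j < n1" for j
    unfolding \<Theta>_vec[OF that] by (rule B(2)) (use that in blast)
  note stage = ring_axioms stage_subring[OF B(1)]
  define M'' where "M'' = quot_mod (std_free ?R m1) (F1 ` carrier (std_free ?R n1))"
  define N'' where "N'' = quot_mod (std_free ?R m2) (F2 ` carrier (std_free ?R n2))"
  let ?\<pi>1 = "cls (std_free ?R m1) (F1 ` carrier (std_free ?R n1))"
    and ?\<pi>2 = "cls (std_free ?R m2) (F2 ` carrier (std_free ?R n2))"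
  note d1 = descent[OF stage M p1 e1, folded M''_def] and d2 = descent[OF stage N p2 e2, folded N''_def]
  interpret Q1: quotient_module ?R "std_free ?R m1" "F1 ` carrier (std_free ?R n1)" by (rule d1(2))
  interpret Q2: quotient_module ?R "std_free ?R m2" "F2 ` carrier (std_free ?R n2)" by (rule d2(2))
  note \<pi>1 = Q1.cls_hom[folded M''_def] and \<pi>2 = Q2.cls_hom[folded N''_def]
  have \<Psi>R: "\<Psi> \<in> mod_hom ?R (std_free ?R m1) (std_free ?R m2)"
    by (rule std_free_hom_stage[OF stage \<Psi> e3])
  have \<Theta>R: "\<Theta> \<in> mod_hom ?R (std_free ?R n1) (std_free ?R n2)"
    by (rule std_free_hom_stage[OF stage \<Theta> e4])
  \<comment> \<open>A relation F1 w over the stage goes to F2 (\<Theta> w) with \<Theta> w over the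
    stage, hence into the relations that define N''.\<close>
  have kill: "?\<pi>2 (\<Psi> v) = \<zero>\<^bsub>N''\<^esub>" if "v \<in> F1 ` carrier (std_free ?R n1)" for v
  proof -
    obtain w where w: "w \<in> carrier (std_free ?R n1)" "v = F1 w" using \<open>v \<in> _\<close> by (rule imageE)
    have "\<Psi> v = F2 (\<Theta> w)" using F\<Theta>[OF std_free_sub[OF stage w(1)]] w(2) by simp
    then have "\<Psi> v \<in> F2 ` carrier (std_free ?R n2)" using mod_homD(1)[OF \<Theta>R w(1)] by blast
    then show ?thesis
      using Q2.cls_zero_iff[folded N''_def] Q2.N'(1) by blast
  qed
  obtain \<phi>'' where \<phi>'': "\<phi>'' \<in> mod_hom ?R M'' N''" "\<And>v. v \<in> carrier (std_free ?R m1) \<Longrightarrow> \<phi>'' (?\<pi>1 v) = ?\<pi>2 (\<Psi> v)"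
    using Q1.quot_universal[folded M''_def, OF d2(1) mod_hom_comp[OF \<Psi>R \<pi>2] kill] by blast
  obtain \<alpha> where \<alpha>: "\<alpha> \<in> mod_iso A (base_change ?R A (\<lambda>x. x) M'') M"
    "\<And>a v. \<lbrakk>a \<in> carrier A; v \<in> carrier (std_free ?R m1)\<rbrakk> \<Longrightarrow> \<alpha> (pure_tensor ?R (rmod (\<lambda>x. x) A) M'' a (?\<pi>1 v)) = a \<odot>\<^bsub>M\<^esub> G1 v"
    using d1(5) by blast
  obtain \<beta> where \<beta>: "\<beta> \<in> mod_iso A (base_change ?R A (\<lambda>x. x) N'') N"
    "\<And>a v. \<lbrakk>a \<in> carrier A; v \<in> carrier (std_free ?R m2)\<rbrakk> \<Longrightarrow> \<beta> (pure_tensor ?R (rmod (\<lambda>x. x) A) N'' a (?\<pi>2 v)) = a \<odot>\<^bsub>N\<^esub> G2 v"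
    using d2(5) by blast
  have \<alpha>h: "\<alpha> \<in> mod_hom A (base_change ?R A (\<lambda>x. x) M'') M" and \<beta>h: "\<beta> \<in> mod_hom A (base_change ?R A (\<lambda>x. x) N'') N"
    using \<alpha>(1) \<beta>(1) by (simp_all add: mod_iso_def)
  note b1 = base_change_moduleI[OF stage d1(1)] and b2 = base_change_moduleI[OF stage d2(1)]
  note bm = base_change_map_hom[OF b1 b2 \<phi>''(1)]
  \<comment> \<open>Both composites are A-linear, so pure tensors of a with the class of v suffice;
    there the square reduces to G2 \<Psi> = \<phi> G1 on v.\<close>
  have "\<beta> (base_change_map ?R A (\<lambda>x. x) N'' \<phi>'' u) = \<phi> (\<alpha> u)" if u: "u \<in> carrier (base_change ?R A (\<lambda>x. x) M'')" for u
  proof (rule base_change_module.AM_hom_eqI[OF b1 mod_hom_comp[OF bm(1) \<beta>h] mod_hom_comp[OF \<alpha>h \<phi>] _ u])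
    fix a x assume a: "a \<in> carrier A" and x: "x \<in> carrier M''"
    obtain v where v: "v \<in> carrier (std_free ?R m1)" "x = ?\<pi>1 v"
      using x unfolding Q1.carrier_Q[folded M''_def] by (rule imageE)
    have vA: "v \<in> carrier (std_free A m1)" by (rule std_free_sub[OF stage v(1)])
    have "\<beta> (base_change_map ?R A (\<lambda>x. x) N'' \<phi>'' (pure_tensor ?R (rmod (\<lambda>x. x) A) M'' a x))
        = \<beta> (pure_tensor ?R (rmod (\<lambda>x. x) A) N'' a (?\<pi>2 (\<Psi> v)))"
      using bm(2)[OF a x] \<phi>''(2)[OF v(1)] v(2) by simp
    also have "\<dots> = a \<odot>\<^bsub>N\<^esub> \<phi> (G1 v)"
      using \<beta>(2)[OF a mod_homD(1)[OF \<Psi>R v(1)]] G\<Psi>[OF vA] by simp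
    also have "\<dots> = \<phi> (\<alpha> (pure_tensor ?R (rmod (\<lambda>x. x) A) M'' a x))"
      using mod_homD(3)[OF \<phi> a mod_homD(1)[OF G1 vA]] \<alpha>(2)[OF a v(1)] v(2) by simp
    finally show "\<beta> (base_change_map ?R A (\<lambda>x. x) N'' \<phi>'' (pure_tensor ?R (rmod (\<lambda>x. x) A) M'' a x))
        = \<phi> (\<alpha> (pure_tensor ?R (rmod (\<lambda>x. x) A) M'' a x))" .
  qed
  then show ?thesis
    using B(1) d1(1) d2(1) fin_presentation_fin_gen[OF d1(1,3)] fin_presentation_fin_gen[OF d2(1,3)] \<phi>''(1) \<alpha>(1) \<beta>(1)
    by blast
qed

end

theorem proposition4p2:
  fixes K :: "('k, 'e) ring_scheme" and A :: "('k, 'a, 'f) module_scheme"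
    and \<Lambda> :: "'l set" and rel :: "('l \<times> 'l) set" and l0 :: 'l
    and S :: "'l \<Rightarrow> 'a set" and \<epsilon> :: "'l \<Rightarrow> 'a \<Rightarrow> 'k"
  assumes "locally_frobenius K A \<Lambda> rel l0 S \<epsilon>"
  shows
    "(\<forall>l\<in>\<Lambda>.
        injective_module TYPE('x) TYPE('y) (A\<lparr>carrier := S l\<rparr>) (lmod (\<lambda>x. x) A) \<and>
        projective_module TYPE('x) TYPE('y) (A\<lparr>carrier := S l\<rparr>) (lmod (\<lambda>x. x) A) \<and>
        flat_left_module TYPE('x) TYPE('y) (A\<lparr>carrier := S l\<rparr>) (lmod (\<lambda>x. x) A) \<and>
        injective_module TYPE('x) TYPE('y) (opp (A\<lparr>carrier := S l\<rparr>)) (rmod (\<lambda>x. x) A) \<and>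
        projective_module TYPE('x) TYPE('y) (opp (A\<lparr>carrier := S l\<rparr>)) (rmod (\<lambda>x. x) A) \<and>
        flat_right_module TYPE('x) TYPE('y) (A\<lparr>carrier := S l\<rparr>) (rmod (\<lambda>x. x) A))
     \<and> coherent_ring A
     \<and> (\<forall>M :: ('a, 'm) module. coherent_module A M \<longrightarrow>
          (\<exists>l\<in>\<Lambda>. \<exists>M' :: ('a, (nat \<Rightarrow> 'a) set) module. \<exists>m n g f G F.
             left_module (A\<lparr>carrier := S l\<rparr>) M' \<and>
             fin_presentation (A\<lparr>carrier := S l\<rparr>) M' m n g f \<and>
             induced_presentation (A\<lparr>carrier := S l\<rparr>) A (\<lambda>x. x) M' m n g f G F \<and>
             fin_presentation A (base_change (A\<lparr>carrier := S l\<rparr>) A (\<lambda>x. x) M') m n G F \<and>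
             (\<exists>\<alpha>. \<alpha> \<in> mod_iso A (base_change (A\<lparr>carrier := S l\<rparr>) A (\<lambda>x. x) M') M)))
     \<and> (\<forall>(M :: ('a, 'm) module) (N :: ('a, 'n) module) \<phi>.
          coherent_module A M \<and> coherent_module A N \<and> \<phi> \<in> mod_hom A M N \<longrightarrow>
          (\<exists>l\<in>\<Lambda>. \<exists>(M'' :: ('a, (nat \<Rightarrow> 'a) set) module) (N'' :: ('a, (nat \<Rightarrow> 'a) set) module)
             \<phi>'' \<alpha> \<beta>.
             left_module (A\<lparr>carrier := S l\<rparr>) M'' \<and> fin_gen (A\<lparr>carrier := S l\<rparr>) M'' \<and>
             left_module (A\<lparr>carrier := S l\<rparr>) N'' \<and> fin_gen (A\<lparr>carrier := S l\<rparr>) N'' \<and>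
             \<phi>'' \<in> mod_hom (A\<lparr>carrier := S l\<rparr>) M'' N'' \<and>
             \<alpha> \<in> mod_iso A (base_change (A\<lparr>carrier := S l\<rparr>) A (\<lambda>x. x) M'') M \<and>
             \<beta> \<in> mod_iso A (base_change (A\<lparr>carrier := S l\<rparr>) A (\<lambda>x. x) N'') N \<and>
             (\<forall>u\<in>carrier (base_change (A\<lparr>carrier := S l\<rparr>) A (\<lambda>x. x) M'').
                \<beta> (base_change_map (A\<lparr>carrier := S l\<rparr>) A (\<lambda>x. x) N'' \<phi>'' u) = \<phi> (\<alpha> u))))"
proof -
  interpret locally_frobenius K A \<Lambda> rel l0 S \<epsilon> by fact
  interpret T: frobenius_tower A "S l0" "S ` \<Lambda>" by (rule frobenius_tower)
  have S: "S l \<in> S ` \<Lambda>" if "l \<in> \<Lambda>" for l using that by (rule imageI)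
  show ?thesis
  proof (intro conjI ballI allI impI, goal_cases)
    case (9 M N \<phi>)
    \<comment> \<open>The tower is the image of \<Lambda> under \<open>S\<close>, and a bounded
      existential over an image becomes one over the indices.\<close>
    from T.coherent_hom_descent[of M N \<phi>] 9 show ?case by (simp only: bex_simps)
  next
    case (8 M)
    from T.coherent_descent[OF 8] show ?case by (simp only: bex_simps)
  next
    case 7
    show ?case by (rule T.coherent)
  qed (rule T.stage_left T.stage_right, rule S, assumption)+
qed

end
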